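(* Let $t$ be a prime power, $q=t^2$, and let $\mathcal{X}\subset\mathbb{P}^4(\mathbb{F}_q)$ be the non-degenerate hermitian variety $x_0^{t+1}+x_1^{t+1}+x_2^{t+1}+x_3^{t+1}+x_4^{t+1}=0$. The fourth weight of the code $C_2(\mathcal{X})$ is $t^7-t^5$. The codewords of fourth weight are exactly the codewords $c(f)$ for which the quadric $\mathcal{Q}=Z(f)$ is of one of the following kinds: (1) $\mathcal{Q}$ is a pair of hyperplanes (over $\mathbb{F}_q$), one tangent to $\mathcal{X}$ and the other, $H$, non-tangent to $\mathcal{X}$, such that the plane of intersection of the two hyperplanes is tangent to the non-singular hermitian surface $\mathcal{X}\cap H$; (2) $\mathcal{Q}$ is a pair of distinct hyperplanes (over $\mathbb{F}_q$), both tangent to $\mathcal{X}$, such that the plane of intersection of the two hyperplanes intersects $\mathcal{X}$ in a single line.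
   Context: Functional code: let $\mathcal{F}_2$ be the $\mathbb{F}_q$-vector space of forms of degree 2 in $x_0,\dots,x_4$ (with $0$). The code $C_2(\mathcal{X})$ is the image of the linear map $c:\mathcal{F}_2\to\mathbb{F}_q^{|\mathcal{X}|}$, $c(f)=(c_x(f))_{x\in\mathcal{X}(\mathbb{F}_q)}$, where $c_x(f)=f(x_0,\dots,x_4)/x_i^2$ for $x=(x_0:\dots:x_4)$ and $i$ the smallest index with $x_i\ne0$. The weight of $c(f)$ is $\#\mathcal{X}(\mathbb{F}_q)-\#(\mathcal{X}\cap Z(f))(\mathbb{F}_q)$, where $Z(f)$ is the zero set of $f$ in $\mathbb{P}^4(\mathbb{F}_q)$. The $i$-th weight of the code is the $i$-th smallest value among the weights of nonzero codewords. A hyperplane is tangent to $\mathcal{X}$ if it is the tangent hyperplane $\sum_i p_i^t x_i=0$ at some point $P=(p_0:\dots:p_4)$ of $\mathcal{X}$; if $H$ is a non-tangent hyperplane, $\mathcal{X}\cap H$ is a non-singular hermitian surface in $H\cong\mathbb{P}^3(\mathbb{F}_q)$, and tangency of planes of $H$ to it is defined in the same way. *)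

theory Defs
  imports "HOL-Analysis.Analysis" "HOL-Library.Poly_Mapping" "HOL-Number_Theory.Number_Theory"
begin

text \<open>
  A point of the projective space of \<open>'a ^ 'n\<close> is a one-dimensional subspace; the nonzero
  vectors in a point are its homogeneous coordinate vectors.  Projective subsets are sets of points.
  For the index type \<open>5\<close> the elements \<open>0, \<dots>, 4\<close> are the indices of \<open>x\<^sub>0, \<dots>, x\<^sub>4\<close>, in this order.
\<close>

definition proj_points :: "('a::field ^ 'n) set set" where
  "proj_points = {vec.span {x} |x. x \<noteq> 0}"

definition proj_flats :: "nat \<Rightarrow> ('a::field ^ 'n) set set set" where
  "proj_flats d = {{P \<in> proj_points. P \<subseteq> W} |W. vec.subspace W \<and> vec.dim W = d + 1}"

definition proj_lines :: "('a::field ^ 'n) set set set" where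
  "proj_lines = proj_flats 1"

definition hyperplanes :: "('a::field ^ 'n) set set set" where
  "hyperplanes = proj_flats (CARD('n) - 2)"

text \<open>
  Polynomials in variables indexed by \<open>'n\<close> are finitely supported maps from monomials
  (exponent vectors) to coefficients.
\<close>

type_synonym ('n, 'a) mpoly = "('n \<Rightarrow>\<^sub>0 nat) \<Rightarrow>\<^sub>0 'a"

definition forms :: "nat \<Rightarrow> ('n::finite, 'a::zero) mpoly set" where
  "forms d = {f. \<forall>m\<in>Poly_Mapping.keys f. (\<Sum>i\<in>UNIV. Poly_Mapping.lookup m i) = d}"

definition eval_form :: "('n::finite, 'a::comm_semiring_1) mpoly \<Rightarrow> 'a ^ 'n \<Rightarrow> 'a" where
  "eval_form f x = (\<Sum>m\<in>Poly_Mapping.keys f. Poly_Mapping.lookup f m * (\<Prod>i\<in>UNIV. (x $ i) ^ Poly_Mapping.lookup m i))"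

definition zero_locus :: "('n::finite, 'a::field) mpoly \<Rightarrow> ('a ^ 'n) set set" where
  "zero_locus f = {P \<in> proj_points. \<forall>x\<in>P. eval_form f x = 0}"

definition hermitian_variety :: "nat \<Rightarrow> ('a::field ^ 'n) set set" where
  "hermitian_variety t = {P \<in> proj_points. \<forall>x\<in>P. (\<Sum>i\<in>UNIV. (x $ i) ^ (t + 1)) = 0}"

definition tangent_hyperplane_at :: "nat \<Rightarrow> ('a::field ^ 'n) set \<Rightarrow> ('a ^ 'n) set set" where
  "tangent_hyperplane_at t P =
     {R \<in> proj_points. \<forall>p\<in>P. \<forall>x\<in>R. (\<Sum>i\<in>UNIV. (p $ i) ^ t * x $ i) = 0}"

definition is_tangent :: "nat \<Rightarrow> ('a::field ^ 'n) set set \<Rightarrow> bool" where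
  "is_tangent t H \<longleftrightarrow> (\<exists>P \<in> hermitian_variety t. H = tangent_hyperplane_at t P)"

text \<open>
  For a non-tangent hyperplane \<open>H\<close> of the four-dimensional projective space, a plane \<open>\<pi>\<close> of \<open>H\<close> is
  tangent to the section of the hermitian variety by \<open>H\<close> if it is so in coordinates of \<open>H\<close>: there is
  an isomorphism from the three-dimensional projective space onto \<open>H\<close> that carries the standard
  hermitian surface onto that section and some tangent plane of the surface onto \<open>\<pi>\<close>.
\<close>

definition tangent_to_section ::
    "nat \<Rightarrow> ('a::field ^ 5) set set \<Rightarrow> ('a ^ 5) set set \<Rightarrow> bool" where
  "tangent_to_section t H \<pi> \<longleftrightarrow>
     (\<exists>\<phi> :: 'a ^ 4 \<Rightarrow> 'a ^ 5. Vector_Spaces.linear (*s) (*s) \<phi> \<and> inj \<phi> \<and>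
        (\<lambda>P. \<phi> ` P) ` proj_points = H \<and>
        (\<lambda>P. \<phi> ` P) ` hermitian_variety t = hermitian_variety t \<inter> H \<and>
        (\<exists>E. is_tangent t E \<and> \<pi> = (\<lambda>P. \<phi> ` P) ` E))"

text \<open>
  For a form of degree 2 the value \<open>f(x) / x\<^sub>i\<^sup>2\<close> does not depend on the coordinate vector \<open>x\<close> chosen
  for the point, see \<open>code_entry_eq\<close> below.  Words over a set of points are extended by 0.
\<close>

definition code_entry ::
    "('n, 'a::field) mpoly \<Rightarrow> ('a ^ 'n::{finite,wellorder}) set \<Rightarrow> 'a" where
  "code_entry f P =
     (let x = (SOME x. x \<in> P \<and> x \<noteq> 0); i = (LEAST i. x $ i \<noteq> 0) in eval_form f x / (x $ i)\<^sup>2)"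

definition codeword ::
    "('a::field ^ 'n::{finite,wellorder}) set set \<Rightarrow> ('n, 'a) mpoly \<Rightarrow>
      ('a ^ 'n::{finite,wellorder}) set \<Rightarrow> 'a" where
  "codeword X f = (\<lambda>P. if P \<in> X then code_entry f P else 0)"

definition code2 ::
    "('a::field ^ 'n::{finite,wellorder}) set set \<Rightarrow> (('a ^ 'n::{finite,wellorder}) set \<Rightarrow> 'a) set" where
  "code2 X = codeword X ` forms 2"

definition hamming_weight :: "'p set \<Rightarrow> ('p \<Rightarrow> 'a::zero) \<Rightarrow> nat" where
  "hamming_weight X w = card {P \<in> X. w P \<noteq> 0}"

definition is_ith_weight :: "'p set \<Rightarrow> ('p \<Rightarrow> 'a::zero) set \<Rightarrow> nat \<Rightarrow> nat \<Rightarrow> bool" where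
  "is_ith_weight X C i v \<longleftrightarrow>
     (let W = hamming_weight X ` (C - {\<lambda>_. 0}) in v \<in> W \<and> card {u \<in> W. u < v} + 1 = i)"

definition quadric_kind1 :: "nat \<Rightarrow> ('a::field ^ 5) set set \<Rightarrow> bool" where
  "quadric_kind1 t Q \<longleftrightarrow>
     (\<exists>H' \<in> hyperplanes. \<exists>H \<in> hyperplanes. Q = H' \<union> H \<and> is_tangent t H' \<and> \<not> is_tangent t H \<and>
        tangent_to_section t H (H' \<inter> H))"

definition quadric_kind2 :: "nat \<Rightarrow> ('a::field ^ 5) set set \<Rightarrow> bool" where
  "quadric_kind2 t Q \<longleftrightarrow>
     (\<exists>H \<in> hyperplanes. \<exists>H' \<in> hyperplanes. Q = H \<union> H' \<and> H \<noteq> H' \<and> is_tangent t H \<and> is_tangent t H' \<and>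
        H \<inter> H' \<inter> hermitian_variety t \<in> proj_lines)"

lemma proj_point_iff: "P \<in> proj_points \<longleftrightarrow> (\<exists>x. x \<noteq> 0 \<and> P = range (\<lambda>c. c *s x))"
  by (auto simp: proj_points_def vec.span_singleton)

lemma eval_form_scale:
  assumes "f \<in> forms d"
  shows "eval_form f (c *s x) = c ^ d * eval_form f x"
proof -
  have "(\<Prod>i\<in>UNIV. (c * x $ i) ^ Poly_Mapping.lookup m i) = c ^ d * (\<Prod>i\<in>UNIV. (x $ i) ^ Poly_Mapping.lookup m i)"
    if "m \<in> Poly_Mapping.keys f" for m
  proof -
    have "(\<Prod>i\<in>UNIV. c ^ Poly_Mapping.lookup m i) = c ^ d"
      using assms that by (simp add: forms_def flip: power_sum)
    then show ?thesis
      by (simp add: power_mult_distrib prod.distrib)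
  qed
  then show ?thesis
    by (simp add: eval_form_def sum_distrib_left mult.left_commute)
qed

lemma code_entry_eq:
  assumes f: "f \<in> forms 2" and P: "P \<in> proj_points" and x: "x \<in> P" "x \<noteq> 0"
  shows "code_entry f P = eval_form f x / (x $ (LEAST i. x $ i \<noteq> 0))\<^sup>2"
proof -
  define y where "y = (SOME x. x \<in> P \<and> x \<noteq> 0)"
  have y: "y \<in> P" "y \<noteq> 0"
    using someI[of "\<lambda>x. x \<in> P \<and> x \<noteq> 0" x] x by (auto simp: y_def)
  obtain z where z: "P = range (\<lambda>c. c *s z)" using P by (auto simp: proj_point_iff)
  obtain a b where ab: "x = a *s z" "y = b *s z" using x y z by auto
  with x y have nz: "a \<noteq> 0" "b \<noteq> 0" by auto
  define c where "c = b / a"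
  have c: "c \<noteq> 0" "y = c *s x" using ab nz by (auto simp: c_def)
  have "(LEAST i. y $ i \<noteq> 0) = (LEAST i. x $ i \<noteq> 0)" using c by simp
  then show ?thesis
    unfolding code_entry_def y_def[symmetric] Let_def
    using c by (simp add: eval_form_scale[OF f] power_mult_distrib)
qed

lemma hamming_weight_codeword:
  assumes f: "f \<in> forms 2" and X: "X \<subseteq> proj_points" "finite X"
  shows "hamming_weight X (codeword X f) = card X - card (X \<inter> zero_locus f)"
proof -
  have "codeword X f P = 0 \<longleftrightarrow> P \<in> zero_locus f" if "P \<in> X" for P
  proof -
    have P: "P \<in> proj_points" using that X by auto
    then obtain x where x: "x \<noteq> 0" "P = range (\<lambda>c. c *s x)" by (auto simp: proj_point_iff)
    then have xP: "x \<in> P" by (metis rangeI vec.scale_one)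
    obtain j where "x $ j \<noteq> 0" using x by (auto simp: vec_eq_iff)
    then have "x $ (LEAST i. x $ i \<noteq> 0) \<noteq> 0" by (rule LeastI)
    then have "code_entry f P = 0 \<longleftrightarrow> eval_form f x = 0"
      using code_entry_eq[OF f P xP x(1)] by simp
    also have "\<dots> \<longleftrightarrow> (\<forall>y\<in>P. eval_form f y = 0)"
      using xP x(2) eval_form_scale[OF f] by auto
    finally show ?thesis using that P by (simp add: codeword_def zero_locus_def)
  qed
  then have "{P \<in> X. codeword X f P \<noteq> 0} = X - X \<inter> zero_locus f" by auto
  then show ?thesis
    using X by (simp add: hamming_weight_def card_Diff_subset)
qed

end

theory Submission
  imports Defs
begin

text \<open>
  Every hyperplane is the polar \<open>perp {a}\<close> of a point, and the number of points of the hermitian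
  variety in a subspace depends only on the dimensions of the subspace and of its radical.  So pairs
  of hyperplanes are settled by the radical of the span of the two poles: the possible numbers of
  points are the four largest ones below the whole variety, and smaller ones.  It remains to see that
  a quadric without a hyperplane meets the variety in fewer than \<open>K = 2t\<^sup>5 + t\<^sup>2 + 1\<close> points.

  If it contains a plane, then it is a union of \<open>t\<^sup>2 + 1\<close> planes, each with at most \<open>t\<^sup>3 + t\<^sup>2 + 1\<close>
  points.  Otherwise fix a line on the quadric.  Every plane through it meets the quadric in
  at most one further line, which meets the variety in at most \<open>t + 1\<close> points unless it lies on the
  variety.  If the quadric and the variety share no line, this is small enough.  If they share one,
  the further shared lines through a point of it lie in the intersection of the two tangent hyperplanes, so
  there are few of them when these are distinct.  At a point where they coincide, some line of the
  quadric through the point is not on the variety, for otherwise a conic would lie on a hermitian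
  curve; counting along that line instead gives the bound, since a line in the tangent
  hyperplane through its point of contact lies on the variety or meets it there only.
\<close>

section \<open>Finite fields of square order\<close>

text \<open>The constant \<open>K\<close> is |X| - (t^7 - t^5) with |X| = t^7 + t^5 + t^2 + 1. A
  pair of distinct hyperplanes has about 2t^5 points on X, while every quadric without a hyperplane
  is shown to have t^5 plus terms of order t^4. For t = 2 the margin is narrow: K = 69, and the five
  bounds compared in \<open>bounds_less\<close> are 66, 57, 65, 57 and 65. The obstacle is a further
  line that lies on X. It contributes q = t^2 points off the fixed line instead of at most t + 1,
  and doing so in all q^2 + q + 1 planes through the fixed line would give order t^6. Hence the
  distinction according to tangent hyperplanes, whose only purpose is to limit the number of such
  planes. Counting is done with vectors: a plane through the line of a subspace \<open>W\<close> is
  a coset \<open>x + W\<close> up to scalars, and a quadratic form that vanishes on \<open>W\<close>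
  is affine on each coset. Quadratic forms are handled through their polar form, so that only
  \<open>ex_singular\<close> has to treat characteristic 2 separately.\<close>

lemma power_card_eq_self:
  fixes x :: "'a::{field,finite}"
  shows "x ^ CARD('a) = x"
proof (cases "x = 0")
  case False
  have "(\<Prod>y\<in>UNIV-{0}. y) = (\<Prod>y\<in>UNIV-{0}. x * y)"
    by (rule prod.reindex_bij_witness[of _ "\<lambda>y. x * y" "\<lambda>y. y / x"]) (use False in auto)
  also have "\<dots> = x ^ (CARD('a) - 1) * (\<Prod>y\<in>UNIV-{0}. y)"
    by (simp add: prod.distrib)
  finally have "x ^ (CARD('a) - 1) = 1"
    by simp
  moreover have "CARD('a) = Suc (CARD('a) - 1)"
    by simp
  ultimately show ?thesis
    by (metis mult.right_neutral power_Suc)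
qed simp

lemma card_power_eq_le:
  fixes d :: "'a::{field,finite}"
  assumes "n > 0"
  shows "card {c. c ^ n = d} \<le> n"
proof -
  let ?p = "Polynomial.monom 1 n - [:d:]"
  have "degree ?p \<le> n"
    by (intro degree_diff_le degree_monom_le) simp
  moreover have "Polynomial.coeff ?p n = 1"
    using assms by (cases n) auto
  then have "?p \<noteq> 0" by force
  ultimately show ?thesis
    using card_poly_roots_bound[of ?p] by (simp add: poly_monom)
qed

section \<open>Conjugation by the power t, and the norm to its fixed field\<close>

locale square_field =
  fixes t :: nat and K :: "'a::{field,finite} itself"
  assumes primepow_t: "primepow t" and card_K: "CARD('a) = t\<^sup>2"
begin

abbreviation "q \<equiv> t\<^sup>2"

lemma t_ge_2: "t \<ge> 2"
  using primepow_gt_Suc_0[OF primepow_t] by simp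

lemma q_gt_1: "q > 1"
  using t_ge_2 by (metis one_less_power Suc_1 Suc_le_lessD zero_less_numeral)

text \<open>The characteristic divides the field order t^2, so it is the prime of which t is a
  power. This is what makes conjugation additive.\<close>

lemma t_eq_char_power: "\<exists>n. t = CHAR('a) ^ n"
proof -
  obtain p k where p: "prime p" "t = p ^ k" using primepow_t by (auto simp: primepow_def)
  have "prime CHAR('a)"
    by (rule prime_CHAR_semidom) (simp add: finite_imp_CHAR_pos)
  moreover have "CHAR('a) dvd p ^ (k * 2)"
    using CHAR_dvd_CARD[where ?'a = 'a] card_K p by (simp add: power_mult)
  ultimately have "CHAR('a) = p"
    using p by (metis prime_dvd_power primes_dvd_imp_eq)
  then show ?thesis using p by auto
qed

lemma add_power_t: "(x + y) ^ t = x ^ t + (y::'a) ^ t"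
  using t_eq_char_power
  by (metis CHAR_pos_iff freshmans_dream' finite_imp_CHAR_pos finite prime_CHAR_semidom)

lemma sum_power_t: "sum f A ^ t = (\<Sum>i\<in>A. (f i :: 'a) ^ t)"
  by (induction A rule: infinite_finite_induct) (use t_ge_2 in \<open>auto simp: add_power_t\<close>)

lemma power_t_t [simp]: "((x::'a) ^ t) ^ t = x"
  using power_card_eq_self[of x] by (simp add: card_K power2_eq_square flip: power_mult)

lemma minus_power_t [simp]: "(- (x::'a)) ^ t = - (x ^ t)"
proof -
  have "x ^ t + (- x) ^ t = (x + (- x)) ^ t"
    by (rule add_power_t[symmetric])
  also have "\<dots> = 0"
    using t_ge_2 by simp
  finally show ?thesis
    by (simp add: add_eq_0_iff)
qed

lemma diff_power_t: "(x - y) ^ t = x ^ t - (y::'a) ^ t"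
  using add_power_t[of x "- y"] by simp

lemma zero_power_t [simp]: "0 ^ t = (0::'a)"
  using t_ge_2 by simp

lemma card_fixed: "card {d::'a. d ^ t = d} \<le> t"
proof -
  let ?p = "Polynomial.monom 1 t - [:0, 1::'a:]"
  have "degree ?p \<le> t"
    using t_ge_2 by (intro degree_diff_le degree_monom_le) simp
  moreover have "Polynomial.coeff ?p t = 1"
    using t_ge_2 by (auto simp: coeff_pCons split: nat.splits)
  then have "?p \<noteq> 0" by force
  ultimately show ?thesis
    using card_poly_roots_bound[of ?p] by (simp add: poly_monom)
qed

text \<open>The norm maps the \<open>(t + 1)(t - 1)\<close> units to at most \<open>t - 1\<close> values and has fibres of size at
  most \<open>t + 1\<close>, so equality holds throughout.\<close>

lemma card_norm_fibre:
  fixes d :: 'a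
  assumes d: "d ^ t = d" "d \<noteq> 0"
  shows "card {c. c ^ (t + 1) = d} = t + 1"
proof (rule ccontr)
  assume ne: "card {c. c ^ (t + 1) = d} \<noteq> t + 1"
  define S where "S = {d::'a. d ^ t = d} - {0}"
  have le: "card {c::'a. c ^ (t + 1) = e} \<le> t + 1" for e
    by (rule card_power_eq_le) simp
  have S: "card S \<le> t - 1"
    using card_fixed by (simp add: S_def zero_power_t)
  have norm_fixed: "(c ^ (t + 1)) ^ t = c ^ (t + 1)" for c :: 'a
  proof -
    have "(c ^ (t + 1)) ^ t = (c ^ t) ^ t * c ^ t"
      by (simp only: power_add power_one_right power_mult_distrib)
    then show ?thesis by (simp add: mult.commute)
  qed
  have "(UNIV - {0::'a}) = (\<Union>e\<in>S. {c. c ^ (t + 1) = e})"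
    using norm_fixed by (auto simp: S_def)
  then have "card (UNIV - {0::'a}) = card (\<Union>e\<in>S. {c::'a. c ^ (t + 1) = e})"
    by simp
  also have "\<dots> \<le> (\<Sum>e\<in>S. card {c::'a. c ^ (t + 1) = e})"
    by (rule card_UN_le) simp
  \<comment> \<open>One fibre that is too short already leaves fewer than t^2 - 1 units.\<close>
  also have "\<dots> < (\<Sum>e\<in>S. t + 1)"
    by (rule sum_strict_mono_ex1) (use le ne d in \<open>auto simp: S_def le_less\<close>)
  also have "\<dots> \<le> (t - 1) * (t + 1)"
    using S by (simp only: sum_constant of_nat_id) (rule mult_right_mono, auto)
  finally have "t\<^sup>2 - 1 < (t - 1) * (t + 1)"
    by (simp add: card_K)
  then show False
    using t_ge_2 by (simp add: power2_eq_square algebra_simps diff_mult_distrib)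
qed

end

section \<open>Functionals and hermitian forms\<close>

text \<open>The scalars are not of the form \<open>'a ^ 'n\<close>, so additivity and homogeneity of
  a linear form are stated directly.\<close>

definition functional :: "('a::field ^ 'n \<Rightarrow> 'a) \<Rightarrow> bool" where
  "functional f \<longleftrightarrow> (\<forall>x y. f (x + y) = f x + f y) \<and> (\<forall>c x. f (c *s x) = c * f x)"

lemma functional_add: "functional f \<Longrightarrow> f (x + y) = f x + f y"
  and functional_scale: "functional f \<Longrightarrow> f (c *s x) = c * f x"
  by (simp_all add: functional_def)

lemma functional_0: "functional f \<Longrightarrow> f 0 = 0"
  using functional_scale[of f 0 0] by simp

lemma functional_minus: "functional f \<Longrightarrow> f (- x) = - f x"
  using functional_scale[of f "-1" x] by simp

lemma functional_diff: "functional f \<Longrightarrow> f (x - y) = f x - f y"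
  using functional_add[of f x "- y"] functional_minus[of f y] by simp

lemma functional_sum: "functional f \<Longrightarrow> f (sum g A) = (\<Sum>i\<in>A. f (g i))"
  by (induction A rule: infinite_finite_induct) (auto simp: functional_0 functional_add)

lemmas functional_simps = functional_add functional_scale functional_0 functional_minus functional_diff

lemma subspace_kernel:
  "vec.subspace W \<Longrightarrow> functional f \<Longrightarrow> vec.subspace {x\<in>W. f x = 0}"
  by (auto simp: vec.subspace_def functional_simps)

text \<open>\<open>W\<close> is the direct sum of the kernel and the line of
  \<open>w\<close>.\<close>

lemma card_kernel:
  fixes W :: "('a::{field,finite} ^ 'n) set"
  assumes W: "vec.subspace W" and f: "functional f" and w: "w \<in> W" "f w \<noteq> 0"
  shows "card W = CARD('a) * card {x\<in>W. f x = 0}"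
proof -
  have "bij_betw (\<lambda>(c, x). x + c *s w) (UNIV \<times> {x\<in>W. f x = 0}) W"
  proof (rule bij_betwI[where g = "\<lambda>x. (f x / f w, x - (f x / f w) *s w)"])
    show "(\<lambda>(c, x). x + c *s w) \<in> UNIV \<times> {x \<in> W. f x = 0} \<rightarrow> W"
      using W w by (auto intro: vec.subspace_add vec.subspace_scale)
    show "(\<lambda>x. (f x / f w, x - (f x / f w) *s w)) \<in> W \<rightarrow> UNIV \<times> {x \<in> W. f x = 0}"
      using W w f by (auto intro: vec.subspace_diff vec.subspace_scale simp: functional_simps)
  qed (use w f in \<open>auto simp: functional_simps\<close>)
  from bij_betw_same_card[OF this] show ?thesis
    by (simp add: card_cartesian_product)
qed

lemma card_kernel_ge:
  fixes W :: "('a::{field,finite} ^ 'n) set"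
  assumes W: "vec.subspace W" and f: "functional f"
  shows "card W \<le> CARD('a) * card {x\<in>W. f x = 0}"
proof (cases "\<exists>w\<in>W. f w \<noteq> 0")
  case True
  then show ?thesis using card_kernel[OF W f] by force
next
  case False
  then have "{x\<in>W. f x = 0} = W" by auto
  then show ?thesis by simp
qed

lemma functional_extend:
  fixes W :: "('a::field ^ 'n) set"
  assumes W: "vec.subspace W" and v: "v \<notin> W"
  obtains f where "functional f" "\<And>w. w \<in> W \<Longrightarrow> f w = 0" "f v = 1"
proof -
  obtain B where B: "B \<subseteq> W" "vec.independent B" "W = vec.span B"
    using vec.basis_exists[of W] W by (metis vec.span_subspace)
  have ind: "vec.independent (insert v B)"
    using B v by (simp add: vec.independent_insert)
  \<comment> \<open>The index \<open>undefined\<close> merely selects some coordinate axis. The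
    extension is vector-valued, and its coordinate on that axis is the wanted functional.\<close>
  obtain g where g: "Vector_Spaces.linear (*s) (*s) g"
      "\<And>x. x \<in> insert v B \<Longrightarrow> g x = (if x = v then axis undefined 1 else 0 :: 'a ^ 'n)"
    using vec.linear_independent_extend[OF ind, of "\<lambda>x. if x = v then axis undefined 1 else 0"] by blast
  interpret g: Vector_Spaces.linear "(*s)" "(*s)" g by fact
  define f where "f = (\<lambda>x. g x $ undefined)"
  show thesis
  proof
    show "functional f"
      by (simp add: f_def functional_def g.add g.scale)
    show "f v = 1" by (simp add: f_def g(2))
    show "f w = 0" if "w \<in> W" for w
    proof -
      have "g w = 0"
        using that unfolding B(3)
        by (rule g.eq_0_on_span[rotated]) (use g(2) B(1) v in auto)
      then show ?thesis by (simp add: f_def)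
    qed
  qed
qed

text \<open>Induction on the basis: a functional that vanishes on the old span but not at the new
  vector exhibits the old span as its kernel in the new one.\<close>

lemma card_span_independent:
  fixes B :: "('a::{field,finite} ^ 'n) set"
  assumes "vec.independent B"
  shows "card (vec.span B) = CARD('a) ^ card B"
proof -
  have "finite B" by simp
  then show ?thesis using assms
  proof (induction B)
    case (insert v B)
    then have v: "v \<notin> vec.span B" and ind: "vec.independent B"
      by (auto simp: vec.independent_insert split: if_splits)
    obtain f where f: "functional f" "\<And>w. w \<in> vec.span B \<Longrightarrow> f w = 0" "f v = 1"
      using functional_extend[OF vec.subspace_span v] by blast
    have "{x \<in> vec.span (insert v B). f x = 0} = vec.span B" (is "?L = ?R")
    proof (intro equalityI subsetI)
      fix x assume x: "x \<in> ?L"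
      then obtain k where k: "x - k *s v \<in> vec.span B" by (auto simp: vec.span_insert)
      then have "f (x - k *s v) = 0" by (rule f)
      then have "k = 0" using x f by (simp add: functional_simps)
      then show "x \<in> ?R" using k by simp
    qed (use f vec.span_mono[of B "insert v B"] in auto)
    moreover have "v \<in> vec.span (insert v B)" by (simp add: vec.span_base)
    ultimately have "card (vec.span (insert v B)) = CARD('a) * card (vec.span B)"
      using card_kernel[OF vec.subspace_span f(1), of v "insert v B"] f(3) by simp
    then show ?case using insert ind by simp
  qed simp
qed

lemma card_subspace:
  fixes W :: "('a::{field,finite} ^ 'n) set"
  assumes "vec.subspace W"
  shows "card W = CARD('a) ^ vec.dim W"
proof -
  obtain B where B: "vec.independent B" "W = vec.span B"
    using vec.basis_exists[of W] assms by (metis vec.span_subspace)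
  then show ?thesis
    using card_span_independent[OF B(1)] vec.dim_span_eq_card_independent[OF B(1)] by simp
qed

lemma card_field_gt_1: "CARD('a::{field,finite}) > 1"
proof -
  have "card {0, 1::'a} \<le> CARD('a)" by (rule card_mono) auto
  then show ?thesis by simp
qed

lemma power_le_card_subspace_iff:
  fixes W :: "('a::{field,finite} ^ 'n) set"
  assumes "vec.subspace W"
  shows "CARD('a) ^ n \<le> card W \<longleftrightarrow> n \<le> vec.dim W"
  using card_field_gt_1[where ?'a = 'a] by (simp add: card_subspace[OF assms])

section \<open>Orthogonality, radicals and isotropic vectors of the hermitian form\<close>

context square_field
begin

text \<open>The second argument is the conjugated one, so that \<open>h x p = 0\<close>, as an
  equation for \<open>x\<close>, is the tangent hyperplane at \<open>p\<close>.\<close>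

definition h :: "'a ^ 'n \<Rightarrow> 'a ^ 'n \<Rightarrow> 'a" where
  "h x y = (\<Sum>i\<in>UNIV. x $ i * (y $ i) ^ t)"

lemma h_add_left: "h (x + y) z = h x z + h y z"
  and h_scale_left: "h (c *s x) z = c * h x z"
  and h_add_right: "h z (x + y) = h z x + h z y"
  and h_scale_right: "h z (c *s x) = c ^ t * h z x"
  by (simp_all add: h_def algebra_simps sum.distrib sum_distrib_left add_power_t power_mult_distrib)

lemma h_sym: "h y x = h x y ^ t"
  by (simp add: h_def sum_power_t power_mult_distrib mult.commute)

lemma h_self_fixed: "h x x ^ t = h x x"
  by (simp flip: h_sym)

lemma h_eq_0_sym: "h x y = 0 \<longleftrightarrow> h y x = 0"
  by (metis h_sym zero_power_t)

lemma functional_h: "functional (\<lambda>x. h x y)"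
  by (simp add: functional_def h_add_left h_scale_left)

lemma h_0_left [simp]: "h 0 y = 0"
  by (simp add: h_def)

lemma h_0_right [simp]: "h y 0 = 0"
  by (simp add: h_def)

lemma h_minus_left: "h (- x) y = - h x y"
  and h_diff_left: "h (x - z) y = h x y - h z y"
  using functional_minus[OF functional_h] functional_diff[OF functional_h] by auto

lemma h_minus_right: "h y (- x) = - h y x"
  and h_diff_right: "h y (x - z) = h y x - h y z"
  by (simp_all add: h_def sum_negf diff_power_t algebra_simps sum_subtractf)

lemmas h_simps = h_add_left h_add_right h_scale_left h_scale_right h_minus_left h_diff_left
  h_minus_right h_diff_right

lemma functional_riesz:
  fixes f :: "'a ^ 'n \<Rightarrow> 'a"
  assumes "functional f"
  obtains a where "\<And>x. f x = h x a"
proof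
  fix x :: "'a ^ 'n"
  have "f x = f (\<Sum>i\<in>UNIV. x $ i *s axis i 1)"
    by (simp add: basis_expansion)
  also have "\<dots> = (\<Sum>i\<in>UNIV. x $ i * f (axis i 1))"
    by (simp add: functional_sum[OF assms] functional_scale[OF assms])
  finally have "f x = (\<Sum>i\<in>UNIV. x $ i * f (axis i 1))" .
  \<comment> \<open>The exponent t cancels the conjugation of the second argument of
    \<open>h\<close>.\<close>
  then show "f x = h x (\<chi> i. f (axis i 1) ^ t)"
    by (simp add: h_def)
qed

lemma h_axis_right [simp]: "h x (axis i 1) = x $ i"
proof -
  have "h x (axis i 1) = (\<Sum>j\<in>UNIV. if j = i then x $ j else 0)"
    unfolding h_def by (rule sum.cong) (use t_ge_2 in \<open>auto simp: axis_def\<close>)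
  then show ?thesis by simp
qed

lemma h_nondegenerate: "(\<And>x. h x a = 0) \<Longrightarrow> a = 0"
proof -
  assume "\<And>x. h x a = 0"
  then have "h a (axis i 1) = 0" for i by (metis h_eq_0_sym)
  then show "a = 0" by (simp add: vec_eq_iff)
qed

definition perp :: "('a ^ 'n) set \<Rightarrow> ('a ^ 'n) set" where
  "perp W = {x. \<forall>y\<in>W. h x y = 0}"

definition rad :: "('a ^ 'n) set \<Rightarrow> ('a ^ 'n) set" where
  "rad W = W \<inter> perp W"

definition iso :: "('a ^ 'n) set \<Rightarrow> ('a ^ 'n) set" where
  "iso W = {x\<in>W. h x x = 0}"

lemma subspace_perp [simp]: "vec.subspace (perp W)"
  by (auto simp: vec.subspace_def perp_def h_simps)

lemma subspace_rad: "vec.subspace W \<Longrightarrow> vec.subspace (rad W)"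
  by (simp add: rad_def vec.subspace_inter)

lemma perp_span [simp]: "perp (vec.span B) = perp B"
proof -
  have "h x y = 0" if "x \<in> perp B" "y \<in> vec.span B" for x y
    using that(2) by (rule vec.span_induct) (use that(1) in \<open>auto simp: perp_def vec.subspace_def h_simps\<close>)
  then show ?thesis
    by (auto simp: perp_def intro: vec.span_base)
qed

lemma perp_insert: "perp (insert v B) = {x \<in> perp B. h x v = 0}"
  by (auto simp: perp_def)

text \<open>A further independent vector \<open>v\<close> cuts \<open>perp B\<close> down by exactly
  the factor q: a functional that vanishes on the span of \<open>B\<close> but not at
  \<open>v\<close> is represented by a vector of \<open>perp B\<close> that is not orthogonal to
  \<open>v\<close>.\<close>

lemma card_perp_span:
  fixes B :: "('a ^ 'n) set"
  assumes "vec.independent B"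
  shows "card (perp B) * q ^ card B = q ^ CARD('n)"
proof -
  have "finite B" by simp
  then show ?thesis using assms
  proof (induction B)
    case empty
    have "perp {} = (UNIV :: ('a ^ 'n) set)" by (simp add: perp_def)
    then show ?case by (simp add: card_K)
  next
    case (insert v B)
    then have v: "v \<notin> vec.span B" and ind: "vec.independent B"
      by (auto simp: vec.independent_insert split: if_splits)
    obtain f where f: "functional f" "\<And>w. w \<in> vec.span B \<Longrightarrow> f w = 0" "f v = 1"
      using functional_extend[OF vec.subspace_span v] by blast
    obtain a where a: "\<And>x. f x = h x a" using functional_riesz[OF f(1)] by blast
    have "a \<in> perp B"
      using f(2) a by (auto simp: perp_def h_eq_0_sym[of a] vec.span_base)
    moreover have "h a v \<noteq> 0" using f(3) a h_eq_0_sym[of a v] by simp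
    ultimately have "card (perp B) = q * card (perp (insert v B))"
      using card_kernel[OF subspace_perp functional_h] by (simp add: perp_insert card_K)
    then show ?case using insert ind by (simp add: algebra_simps)
  qed
qed

lemma card_perp:
  fixes W :: "('a ^ 'n) set"
  assumes "vec.subspace W"
  shows "card (perp W) * card W = q ^ CARD('n)"
proof -
  obtain B where B: "vec.independent B" "W = vec.span B"
    using vec.basis_exists[of W] assms by (metis vec.span_subspace)
  then show ?thesis
    using card_perp_span[OF B(1)] card_span_independent[OF B(1)] by (simp add: card_K)
qed

lemma perp_perp:
  assumes "vec.subspace W"
  shows "perp (perp W) = W"
proof -
  have "W \<subseteq> perp (perp W)"
    by (auto simp: perp_def h_eq_0_sym)
  moreover have "card (perp (perp W)) = card W"
  proof -
    have "card (perp (perp W)) * card (perp W) = card W * card (perp W)"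
      using card_perp[OF assms] card_perp[OF subspace_perp, of W] by (simp add: mult.commute)
    moreover have "card (perp W) \<noteq> 0"
      using vec.subspace_0[OF subspace_perp, of W] by (auto simp: card_eq_0_iff)
    ultimately show ?thesis by simp
  qed
  ultimately show ?thesis
    by (metis card_subset_eq finite)
qed

lemma rad_perp: "vec.subspace W \<Longrightarrow> rad (perp W) = rad W"
  by (auto simp: rad_def perp_perp)

text \<open>With z = \<open>h x y\<close>, isotropy of \<open>x + c *s y\<close> gives c^t z + c z^t
  = 0 for every c. For c = 1 this is z^t = - z, and then z \<noteq> 0 would put the whole field into
  the fixed field of conjugation.\<close>

lemma polarize:
  fixes x y :: "'a ^ 'n"
  assumes W: "vec.subspace W" and iso: "\<And>w. w \<in> W \<Longrightarrow> h w w = 0" and "x \<in> W" "y \<in> W"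
  shows "h x y = 0"
proof (rule ccontr)
  define z where "z = h x y"
  assume "h x y \<noteq> 0"
  then have z: "z \<noteq> 0" by (simp add: z_def)
  have "c ^ t * z + c * z ^ t = 0" for c
  proof -
    have "h (x + c *s y) (x + c *s y) = 0"
      using assms by (intro iso vec.subspace_add vec.subspace_scale) auto
    moreover have "h x x = 0" "h y y = 0" using assms by auto
    moreover have "h y x = z ^ t" by (simp add: z_def flip: h_sym)
    ultimately show ?thesis by (simp add: h_simps z_def add.commute)
  qed
  note eq = this
  have "c ^ t = c" for c :: 'a
  proof -
    have 1: "z ^ t = - z" using eq[of 1] by (simp add: add_eq_0_iff)
    have "z * (c ^ t - c) = 0" using eq[of c] 1 by (simp add: algebra_simps)
    then show ?thesis using z by simp
  qed
  then have "{d::'a. d ^ t = d} = UNIV" by auto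
  then have "t\<^sup>2 \<le> t" using card_fixed by (simp add: card_K)
  then show False using t_ge_2 by (simp add: power2_eq_square)
qed

text \<open>Splitting off a nonisotropic vector multiplies the count through the fibres of the norm:
  a value \<open>0\<close> has one preimage, every other value of the subfield has \<open>t + 1\<close>.\<close>

lemma card_iso:
  fixes W :: "('a ^ 'n) set"
  assumes W: "vec.subspace W" and card: "card W = q ^ n * card (rad W)"
  shows "int t * card (iso W) = card (rad W) * (int q ^ n + (-1) ^ n * (int t - 1) * int t ^ n)"
  using assms
proof (induction n arbitrary: W)
  case 0
  then have "rad W = W"
    by (intro card_subset_eq) (auto simp: rad_def)
  then have "iso W = W"
    by (auto simp: iso_def rad_def perp_def)
  then show ?case using \<open>rad W = W\<close> by simp
next
  case (Suc n)
  have "0 \<in> rad W" using subspace_rad[OF Suc.prems(1)] by (simp add: vec.subspace_0)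
  then have pos: "card (rad W) > 0" by (auto simp: card_gt_0_iff)
  have "W \<noteq> rad W"
  proof
    assume "W = rad W"
    then have "card (rad W) = q ^ Suc n * card (rad W)" using Suc.prems by simp
    then have "q ^ Suc n = 1" using pos by (metis less_numeral_extra(3) mult_cancel2 nat_mult_1)
    then show False using one_less_power[OF q_gt_1, of "Suc n"] by linarith
  qed
  then obtain w where w: "w \<in> W" "h w w \<noteq> 0"
    using polarize[OF Suc.prems(1)] by (auto simp: rad_def perp_def)
  define V where "V = {x\<in>W. h x w = 0}"
  have V: "vec.subspace V"
    unfolding V_def by (rule subspace_kernel[OF Suc.prems(1) functional_h])
  have cW: "card W = q * card V"
    using card_kernel[OF Suc.prems(1) functional_h w] by (simp add: V_def card_K)
  have decomp: "\<exists>v c. v \<in> V \<and> x = v + c *s w" if "x \<in> W" for x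
  proof (intro exI[of _ "x - (h x w / h w w) *s w"] exI[of _ "h x w / h w w"] conjI)
    show "x - (h x w / h w w) *s w \<in> V"
      using that w Suc.prems(1) by (auto simp: V_def h_simps intro: vec.subspace_diff vec.subspace_scale)
  qed simp
  have radV: "rad V = rad W"
  proof (intro equalityI subsetI)
    fix x assume x: "x \<in> rad V"
    have "h x y = 0" if y: "y \<in> W" for y
    proof -
      obtain v c where "v \<in> V" "y = v + c *s w" using decomp[OF y] by blast
      then show ?thesis using x by (simp add: rad_def perp_def V_def h_simps)
    qed
    then show "x \<in> rad W" using x by (simp add: rad_def perp_def V_def)
  qed (use w in \<open>auto simp: rad_def perp_def V_def\<close>)
  have cV: "card V = q ^ n * card (rad V)"
    using Suc.prems(2) cW radV t_ge_2 by simp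
  have IH: "int t * card (iso V) = card (rad W) * (int q ^ n + (-1) ^ n * (int t - 1) * int t ^ n)"
    using Suc.IH[OF V cV] radV by simp
  \<comment> \<open>Since \<open>v\<close> is orthogonal to \<open>w\<close>, isotropy of
    \<open>v + c *s w\<close> is a norm equation for \<open>c\<close> whose right-hand side lies in
    the fixed field.\<close>
  define fib where "fib = (\<lambda>v. {c. h (v + c *s w) (v + c *s w) = 0})"
  have fib: "fib v = {c. c ^ (t + 1) = - (h v v / h w w)}" if "v \<in> V" for v
  proof -
    have "h (v + c *s w) (v + c *s w) = h v v + c ^ (t + 1) * h w w" for c
      using that h_eq_0_sym[of v w] by (simp add: h_simps V_def algebra_simps)
    moreover have "x + k * h w w = 0 \<longleftrightarrow> k = - (x / h w w)" for x k
      using w by (auto simp: eq_neg_iff_add_eq_0 field_simps)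
    ultimately show ?thesis
      by (simp only: fib_def)
  qed
  have fib_card: "card (fib v) = (if h v v = 0 then 1 else t + 1)" if "v \<in> V" for v
  proof (cases "h v v = 0")
    case True
    then have "fib v = {0}" unfolding fib[OF that] by auto
    then show ?thesis using True by simp
  next
    case False
    have "(- (h v v / h w w)) ^ t = - (h v v / h w w)"
      by (simp add: power_divide h_self_fixed)
    then show ?thesis unfolding fib[OF that] using card_norm_fibre False w by simp
  qed
  have "bij_betw (\<lambda>(v, c). v + c *s w) (SIGMA v:V. fib v) (iso W)"
  proof (rule bij_betwI[where g = "\<lambda>x. (x - (h x w / h w w) *s w, h x w / h w w)"])
    show "(\<lambda>(v, c). v + c *s w) \<in> (SIGMA v:V. fib v) \<rightarrow> iso W"
      using w Suc.prems(1)
      by (auto simp: iso_def V_def fib_def intro: vec.subspace_add vec.subspace_scale)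
    show "(\<lambda>x. (x - (h x w / h w w) *s w, h x w / h w w)) \<in> iso W \<rightarrow> (SIGMA v:V. fib v)"
      using w Suc.prems(1)
      by (auto simp: iso_def V_def fib_def h_diff_left h_scale_left intro: vec.subspace_diff vec.subspace_scale)
  qed (use w in \<open>auto simp: V_def h_simps\<close>)
  from bij_betw_same_card[OF this] have "card (iso W) = (\<Sum>v\<in>V. card (fib v))"
    by simp
  also have "\<dots> = (\<Sum>v\<in>V. if h v v = 0 then 1 else t + 1)"
    by (rule sum.cong) (auto simp: fib_card)
  also have "\<dots> = card (iso V) + (t + 1) * card (V - iso V)"
  proof -
    have "V \<inter> {v. h v v = 0} = iso V" "V \<inter> - {v. h v v = 0} = V - iso V"
      by (auto simp: iso_def)
    then show ?thesis by (simp add: sum.If_cases)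
  qed
  finally have "int (card (iso W)) = card (iso V) + (int t + 1) * card (V - iso V)"
    by (simp add: algebra_simps)
  moreover have "int (card (V - iso V)) = int (card V) - card (iso V)"
  proof -
    have "iso V \<subseteq> V" by (auto simp: iso_def)
    then show ?thesis by (simp add: card_Diff_subset card_mono of_nat_diff)
  qed
  \<comment> \<open>In this recursion the main term acquires the factor q and the deviation from it
    the factor - t, which is the origin of (-1)^n t^n.\<close>
  ultimately have cW': "int (card (iso W)) = card (iso V) + (int t + 1) * (int (card V) - card (iso V))"
    by simp
  have "int t * card (iso W) = int t * (int t + 1) * card V - int t * (int t * card (iso V))"
    unfolding cW' by (simp add: algebra_simps)
  also have "\<dots> = card (rad W) * (int q ^ Suc n + (-1) ^ Suc n * (int t - 1) * int t ^ Suc n)"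
    unfolding IH cV radV by (simp add: algebra_simps power2_eq_square)
  finally show ?case .
qed

end

section \<open>Points and sections\<close>

definition cone :: "('a::field ^ 'n) set \<Rightarrow> bool" where
  "cone Z \<longleftrightarrow> (\<forall>x\<in>Z. \<forall>c. c *s x \<in> Z)"

text \<open>The passage from vectors to projective points. The nonzero vectors of a cone are shared
  out evenly among its points, so sets of points can be counted through vectors.\<close>

definition pts :: "('a::field ^ 'n) set \<Rightarrow> ('a ^ 'n) set set" where
  "pts Z = {P\<in>proj_points. P \<subseteq> Z}"

lemma cone_subspace [intro]: "vec.subspace W \<Longrightarrow> cone W"
  by (simp add: cone_def vec.subspace_scale)

lemma cone_Un [intro]: "cone A \<Longrightarrow> cone B \<Longrightarrow> cone (A \<union> B)"
  by (auto simp: cone_def)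

lemma span_subset_cone_iff: "cone Z \<Longrightarrow> vec.span {x} \<subseteq> Z \<longleftrightarrow> x \<in> Z"
  using vec.span_base[of x "{x}"] by (auto simp: cone_def vec.span_singleton)

lemma pts_eq: "cone Z \<Longrightarrow> pts Z = {vec.span {x} |x. x \<in> Z \<and> x \<noteq> 0}"
  unfolding pts_def proj_points_def using span_subset_cone_iff[of Z] by blast

lemma span_in_pts_iff: "cone Z \<Longrightarrow> x \<noteq> 0 \<Longrightarrow> vec.span {x} \<in> pts Z \<longleftrightarrow> x \<in> Z"
  unfolding pts_def proj_points_def using span_subset_cone_iff[of Z x] by blast

lemma pts_Int: "pts (A \<inter> B) = pts A \<inter> pts B"
  by (auto simp: pts_def)

lemma pts_Un:
  assumes "cone A" "cone B"
  shows "pts (A \<union> B) = pts A \<union> pts B"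
  using assms by (auto simp: pts_eq cone_Un)

lemma pts_eq_iff:
  assumes "cone A" "cone B" "0 \<in> A" "0 \<in> B"
  shows "pts A = pts B \<longleftrightarrow> A = B"
proof
  assume eq: "pts A = pts B"
  have "x \<in> A \<longleftrightarrow> x \<in> B" for x
    using eq assms span_in_pts_iff[of A x] span_in_pts_iff[of B x] by (cases "x = 0") auto
  then show "A = B" by auto
qed simp

lemma proj_point_span:
  assumes "P \<in> proj_points" "x \<in> P" "x \<noteq> 0"
  shows "P = vec.span {x}"
proof -
  obtain z where z: "P = vec.span {z}" "z \<noteq> 0" using assms by (auto simp: proj_points_def)
  then obtain c where c: "x = c *s z" using assms by (auto simp: vec.span_singleton)
  then have "c \<noteq> 0" using assms by auto
  then have "range (\<lambda>k. k *s x) = range (\<lambda>k. k *s z)"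
  proof (intro equalityI subsetI)
    fix y assume "y \<in> range (\<lambda>k. k *s z)"
    then obtain k where "y = k *s z" by auto
    then have "y = (k / c) *s x" using c \<open>c \<noteq> 0\<close> by simp
    then show "y \<in> range (\<lambda>k. k *s x)" by auto
  qed (use c in auto)
  then show ?thesis using z by (simp add: vec.span_singleton)
qed

lemma card_pts:
  fixes Z :: "('a::{field,finite} ^ 'n) set"
  assumes Z: "cone Z"
  shows "card (pts Z) * (CARD('a) - 1) = card (Z - {0})"
proof -
  have "Z - {0} = (\<Union>P\<in>pts Z. P - {0})"
  proof (intro equalityI subsetI)
    fix x assume "x \<in> Z - {0}"
    then show "x \<in> (\<Union>P\<in>pts Z. P - {0})"
      using span_in_pts_iff[OF Z, of x] by (auto intro!: bexI[of _ "vec.span {x}"] vec.span_base)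
  qed (auto simp: pts_def)
  then have "card (Z - {0}) = card (\<Union>P\<in>pts Z. P - {0})" by simp
  also have "\<dots> = (\<Sum>P\<in>pts Z. card (P - {0}))"
    by (rule card_UN_disjoint) (auto simp: pts_def dest: proj_point_span)
  also have "\<dots> = (\<Sum>P\<in>pts Z. CARD('a) - 1)"
  proof (rule sum.cong)
    fix P assume "P \<in> pts Z"
    then obtain z where z: "P = vec.span {z}" "z \<noteq> 0" by (auto simp: pts_def proj_points_def)
    then have "card P = CARD('a)"
      using card_span_independent[of "{z}"] by simp
    moreover have "0 \<in> P" by (simp add: z vec.span_zero)
    ultimately show "card (P - {0}) = CARD('a) - 1" by simp
  qed simp
  finally show ?thesis by simp
qed

section \<open>Numbers of points of hermitian sections\<close>

context square_field
begin

lemma card_pts_q: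
  fixes Z :: "('a ^ 'n) set"
  assumes "cone Z" "0 \<in> Z"
  shows "int (card (pts Z)) * (int q - 1) = int (card Z) - 1"
proof -
  have "int (card (pts Z) * (CARD('a) - 1)) = int (card Z - 1)"
    using card_pts[OF assms(1)] assms(2) by simp
  moreover have "card Z > 0" using assms(2) by (auto simp: card_gt_0_iff)
  ultimately show ?thesis
    using q_gt_1 by (simp add: card_K of_nat_diff)
qed

lemma cone_iso [intro]: "cone W \<Longrightarrow> cone (iso W)"
  by (auto simp: cone_def iso_def h_simps)

lemma zero_in_iso: "vec.subspace W \<Longrightarrow> 0 \<in> iso W"
  by (simp add: iso_def vec.subspace_0)

lemma hermitian_variety_eq: "hermitian_variety t = pts (iso UNIV)"
  by (auto simp: hermitian_variety_def pts_def iso_def h_def mult.commute)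

lemma pts_iso: "pts (iso W) = hermitian_variety t \<inter> pts W"
  by (auto simp: hermitian_variety_eq pts_def iso_def)

text \<open>Here n is the rank of the form on \<open>W\<close> and k the dimension of its radical.
  Integers accommodate the sign, and the equation is multiplied out to avoid division by t and q -
  1.\<close>

lemma card_pts_iso:
  fixes W :: "('a ^ 'n) set"
  assumes W: "vec.subspace W" and dim: "vec.dim W = n + k" "vec.dim (rad W) = k"
  shows "int t * (int (card (pts (iso W))) * (int q - 1) + 1) =
    int q ^ k * (int q ^ n + (-1) ^ n * (int t - 1) * int t ^ n)"
proof -
  have cr: "card (rad W) = q ^ k"
    using card_subspace[OF subspace_rad[OF W]] dim by (simp add: card_K)
  have "card W = q ^ n * card (rad W)"
    unfolding cr using card_subspace[OF W] dim by (simp add: card_K power_add)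
  from card_iso[OF W this] show ?thesis
    using card_pts_q[OF cone_iso[OF cone_subspace[OF W]] zero_in_iso[OF W]] cr by simp
qed

lemma cancel_tq:
  assumes "int t * (int N * (int q - 1) + 1) = int t * (int M * (int q - 1) + 1)"
  shows "N = M"
proof -
  have "int t \<noteq> 0" "int q - 1 \<noteq> 0"
    using t_ge_2 q_gt_1 by (auto simp del: of_nat_power)
  then have "int N = int M"
    using assms by (metis add_right_cancel mult_left_cancel mult_right_cancel)
  then show ?thesis by simp
qed

text \<open>In this order: the whole variety, the hermitian surface, the cone over a hermitian
  curve, the hermitian curve, t + 1 lines through a point, a single line, t + 1 points of a line, a
  single point.\<close>

lemma card_pts_iso_values:
  fixes W :: "('a ^ 'n) set"
  assumes W: "vec.subspace W"
  shows "vec.dim W = 5 \<Longrightarrow> vec.dim (rad W) = 0 \<Longrightarrow> card (pts (iso W)) = t ^ 7 + t ^ 5 + t ^ 2 + 1"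
    and "vec.dim W = 4 \<Longrightarrow> vec.dim (rad W) = 0 \<Longrightarrow> card (pts (iso W)) = t ^ 5 + t ^ 3 + t ^ 2 + 1"
    and "vec.dim W = 4 \<Longrightarrow> vec.dim (rad W) = 1 \<Longrightarrow> card (pts (iso W)) = t ^ 5 + t ^ 2 + 1"
    and "vec.dim W = 3 \<Longrightarrow> vec.dim (rad W) = 0 \<Longrightarrow> card (pts (iso W)) = t ^ 3 + 1"
    and "vec.dim W = 3 \<Longrightarrow> vec.dim (rad W) = 1 \<Longrightarrow> card (pts (iso W)) = t ^ 3 + t ^ 2 + 1"
    and "vec.dim W = 3 \<Longrightarrow> vec.dim (rad W) = 2 \<Longrightarrow> card (pts (iso W)) = t ^ 2 + 1"
    and "vec.dim W = 2 \<Longrightarrow> vec.dim (rad W) = 0 \<Longrightarrow> card (pts (iso W)) = t + 1"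
    and "vec.dim W = 2 \<Longrightarrow> vec.dim (rad W) = 1 \<Longrightarrow> card (pts (iso W)) = 1"
  subgoal using card_pts_iso[OF W, of 5 0] by (intro cancel_tq) (simp, simp add: eval_nat_numeral algebra_simps)
  subgoal using card_pts_iso[OF W, of 4 0] by (intro cancel_tq) (simp, simp add: eval_nat_numeral algebra_simps)
  subgoal using card_pts_iso[OF W, of 3 1] by (intro cancel_tq) (simp, simp add: eval_nat_numeral algebra_simps)
  subgoal using card_pts_iso[OF W, of 3 0] by (intro cancel_tq) (simp, simp add: eval_nat_numeral algebra_simps)
  subgoal using card_pts_iso[OF W, of 2 1] by (intro cancel_tq) (simp, simp add: eval_nat_numeral algebra_simps)
  subgoal using card_pts_iso[OF W, of 1 2] by (intro cancel_tq) (simp, simp add: eval_nat_numeral algebra_simps)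
  subgoal using card_pts_iso[OF W, of 2 0] by (intro cancel_tq) (simp, simp add: eval_nat_numeral algebra_simps)
  subgoal using card_pts_iso[OF W, of 1 1] by (intro cancel_tq) (simp, simp add: eval_nat_numeral algebra_simps)
  done

lemma dim_perp:
  fixes W :: "('a ^ 'n) set"
  assumes "vec.subspace W"
  shows "vec.dim (perp W) + vec.dim W = CARD('n)"
proof -
  have "q ^ (vec.dim (perp W) + vec.dim W) = q ^ CARD('n)"
    using card_perp[OF assms] card_subspace[OF assms] card_subspace[OF subspace_perp, of W]
    by (simp add: card_K power_add)
  then show ?thesis
    by (rule power_inject_exp[OF q_gt_1, THEN iffD1])
qed

lemma rad_span: "rad (vec.span B) = vec.span B \<inter> perp B"
  by (simp add: rad_def)

lemma rad_perp_set: "rad (perp B) = rad (vec.span B)"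
  using rad_perp[OF vec.subspace_span, of B] by simp

lemma dim_rad_span_1:
  assumes "a \<noteq> 0"
  shows "vec.dim (rad (vec.span {a})) = (if h a a = 0 then 1 else 0)"
proof (cases "h a a = 0")
  case True
  then have "rad (vec.span {a}) = vec.span {a}"
    unfolding rad_span by (auto simp: perp_def vec.span_singleton h_simps)
  then show ?thesis using True assms by simp
next
  case False
  then have "rad (vec.span {a}) \<subseteq> {0}"
    unfolding rad_span by (auto simp: perp_def vec.span_singleton h_simps)
  then show ?thesis using False by simp
qed

lemma card_X: "card (hermitian_variety t :: ('a ^ 5) set set) = t ^ 7 + t ^ 5 + t ^ 2 + 1"
proof -
  have "rad (UNIV :: ('a ^ 5) set) \<subseteq> {0}"
    using h_nondegenerate h_eq_0_sym by (force simp: rad_def perp_def)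
  then have "vec.dim (rad (UNIV :: ('a ^ 5) set)) = 0" by simp
  moreover have "vec.dim (UNIV :: ('a ^ 5) set) = 5"
    by (subst vec_dim_card) simp
  ultimately show ?thesis
    unfolding hermitian_variety_eq by (intro card_pts_iso_values) auto
qed

lemma card_hyperplane_section:
  fixes a :: "'a ^ 5"
  assumes "a \<noteq> 0"
  shows "card (pts (iso (perp {a}))) = (if h a a = 0 then t ^ 5 + t ^ 2 + 1 else t ^ 5 + t ^ 3 + t ^ 2 + 1)"
proof -
  have "vec.dim (perp {a}) = 4"
    using dim_perp[OF vec.subspace_span, of "{a}"] assms by simp
  then show ?thesis
    using card_pts_iso_values(2,3)[OF subspace_perp, of "{a}"] dim_rad_span_1[OF assms]
    by (simp add: rad_perp_set)
qed

end

section \<open>Pairs of hyperplanes\<close>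

lemma pts_UNIV: "pts UNIV = proj_points"
  by (simp add: pts_def)

lemma image_pts:
  assumes lin: "Vector_Spaces.linear (*s) (*s) \<phi>" and inj: "inj \<phi>" and Z: "cone Z"
  shows "(\<lambda>P. \<phi> ` P) ` pts Z = pts (\<phi> ` Z)"
proof -
  interpret g: Vector_Spaces.linear "(*s)" "(*s)" \<phi> by fact
  have nz: "\<phi> x \<noteq> 0 \<longleftrightarrow> x \<noteq> 0" for x
    using inj g.zero by (metis injD)
  have im: "\<phi> ` vec.span {x} = vec.span {\<phi> x}" for x
    using g.span_image[of "{x}"] by simp
  have "cone (\<phi> ` Z)"
    using Z by (auto simp: cone_def simp flip: g.scale)
  then show ?thesis
    unfolding pts_eq[OF Z] pts_eq[OF \<open>cone (\<phi> ` Z)\<close>] using nz im by (auto simp: image_iff) metis+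
qed

lemma span_pair_iff: "x \<in> vec.span {a, b} \<longleftrightarrow> (\<exists>k l. x = k *s a + l *s b)"
proof -
  have "x \<in> vec.span {a, b} \<longleftrightarrow> (\<exists>k. x - k *s a \<in> vec.span {b})"
    by (rule vec.span_breakdown_eq)
  also have "\<dots> \<longleftrightarrow> (\<exists>k l. x - k *s a = l *s b)"
    by (simp add: vec.span_singleton image_iff)
  finally show ?thesis by (simp add: diff_eq_eq add.commute)
qed

context square_field
begin

lemma zero_in_perp [simp]: "0 \<in> perp B"
  by (simp add: perp_def)

lemma pts_perp_Int: "pts (perp {a}) \<inter> pts (perp {b}) = pts (perp {a, b})"
  by (auto simp: perp_def simp flip: pts_Int intro!: arg_cong[where f = pts])

lemma dim_perp_1:
  assumes "a \<noteq> 0"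
  shows "vec.dim (perp {a :: 'a ^ 'n}) = CARD('n) - 1"
  using dim_perp[OF vec.subspace_span, of "{a}"] assms by simp

lemma subspace_eqI:
  fixes V :: "('a ^ 'n) set"
  assumes "vec.subspace V" "vec.subspace W" "V \<subseteq> W" "vec.dim V = vec.dim W"
  shows "V = W"
  using assms card_subspace by (metis card_subset_eq finite)

text \<open>A nonzero functional that vanishes on the hyperplane is represented by its pole
  \<open>a\<close>; equality follows by comparing dimensions.\<close>

lemma hyperplane_subspace:
  fixes W :: "('a ^ 'n) set"
  assumes W: "vec.subspace W" and dim: "vec.dim W = CARD('n) - 1"
  obtains a where "a \<noteq> 0" "W = perp {a}"
proof -
  have "vec.dim (UNIV :: ('a ^ 'n) set) = CARD('n)"
    by (subst vec_dim_card) simp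
  then obtain v where "v \<notin> W"
    using dim by (metis UNIV_eq_I diff_less zero_less_card_finite less_irrefl zero_less_one)
  then obtain f where f: "functional f" "\<And>w. w \<in> W \<Longrightarrow> f w = 0" "f v = 1"
    using functional_extend[OF W] by blast
  obtain a where a: "\<And>x. f x = h x a" using functional_riesz[OF f(1)] by blast
  have "a \<noteq> 0" using a[of v] f(3) by auto
  moreover have "W = perp {a}"
    using f(2) a dim dim_perp_1[OF \<open>a \<noteq> 0\<close>] by (intro subspace_eqI W subspace_perp) (auto simp: perp_def)
  ultimately show thesis using that by blast
qed

lemma hyperplanes_iff:
  "(H :: ('a ^ 5) set set) \<in> hyperplanes \<longleftrightarrow> (\<exists>a. a \<noteq> 0 \<and> H = pts (perp {a}))"
proof
  assume "H \<in> hyperplanes"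
  then obtain W :: "('a ^ 5) set" where "H = pts W" "vec.subspace W" "vec.dim W = CARD(5) - 1"
    by (auto simp: hyperplanes_def proj_flats_def pts_def)
  then show "\<exists>a. a \<noteq> 0 \<and> H = pts (perp {a})"
    using hyperplane_subspace by metis
next
  assume "\<exists>a. a \<noteq> 0 \<and> H = pts (perp {a})"
  then obtain a where "a \<noteq> 0" "H = pts (perp {a})" by blast
  then show "H \<in> hyperplanes"
    using dim_perp_1[of a] by (auto simp: hyperplanes_def proj_flats_def pts_def intro!: exI[of _ "perp {a}"])
qed

lemma tangent_hyperplane_at_eq:
  "tangent_hyperplane_at t (vec.span {a}) = pts (perp {a})"
proof -
  have "tangent_hyperplane_at t (vec.span {a}) = pts (perp (vec.span {a}))"
    by (auto simp: tangent_hyperplane_at_def pts_def perp_def h_def mult.commute)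
  then show ?thesis by (simp del: vec.span_singleton)
qed

lemma is_tangent_iff: "is_tangent t H \<longleftrightarrow> (\<exists>a. a \<noteq> 0 \<and> h a a = 0 \<and> H = pts (perp {a}))"
  unfolding is_tangent_def hermitian_variety_eq pts_eq[OF cone_iso[OF cone_subspace[OF vec.subspace_UNIV]]]
  using tangent_hyperplane_at_eq by (fastforce simp: iso_def)

lemma card_tangent_section:
  assumes "is_tangent t (pts (perp {b :: 'a ^ 5}))"
  shows "card (pts (iso (perp {b}))) = t ^ 5 + t ^ 2 + 1"
proof -
  obtain a where "a \<noteq> 0" "h a a = 0" "pts (perp {b}) = pts (perp {a})"
    using assms by (auto simp: is_tangent_iff)
  then show ?thesis
    using card_hyperplane_section[of a] by (simp add: pts_iso)
qed

text \<open>Tangent and non-tangent sections differ by t^3 points, so counting decides tangency even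
  if the hyperplane is presented through another pole.\<close>

lemma is_tangent_perp_iff:
  assumes "b \<noteq> (0 :: 'a ^ 5)"
  shows "is_tangent t (pts (perp {b})) \<longleftrightarrow> h b b = 0"
proof
  assume "is_tangent t (pts (perp {b}))"
  then show "h b b = 0"
    using card_tangent_section[of b] card_hyperplane_section[OF assms] t_ge_2 by (auto split: if_splits)
qed (use assms in \<open>auto simp: is_tangent_iff\<close>)

lemma card_pair:
  fixes a b :: "'a ^ 5"
  shows "card (hermitian_variety t \<inter> (pts (perp {a}) \<union> pts (perp {b}))) + card (pts (iso (perp {a, b}))) =
    card (pts (iso (perp {a}))) + card (pts (iso (perp {b})))"
proof -
  have "hermitian_variety t \<inter> (pts (perp {a}) \<union> pts (perp {b})) = pts (iso (perp {a})) \<union> pts (iso (perp {b}))"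
    by (auto simp: pts_iso)
  moreover have "pts (iso (perp {a, b})) = pts (iso (perp {a})) \<inter> pts (iso (perp {b}))"
    unfolding pts_iso pts_perp_Int[symmetric] by auto
  ultimately show ?thesis
    using card_Un_Int[of "pts (iso (perp {a}))" "pts (iso (perp {b}))"] by simp
qed

text \<open>The line of poles and the intersection of the two hyperplanes have the same radical, so
  these facts determine how many points of the variety the hyperplanes share.\<close>

lemma dim_rad_pair:
  fixes a b :: "'a ^ 'n"
  defines "r \<equiv> vec.dim (rad (vec.span {a, b}))"
  assumes ind: "vec.independent {a, b}" "a \<noteq> b"
  shows "r \<le> 2"
    and "r = 2 \<longleftrightarrow> h a a = 0 \<and> h b b = 0 \<and> h a b = 0"
    and "h a a = 0 \<Longrightarrow> h a b \<noteq> 0 \<Longrightarrow> r = 0"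
    and "\<exists>x \<in> rad (vec.span {a, b}). x \<noteq> 0 \<Longrightarrow> r > 0"
proof -
  have d2: "vec.dim (vec.span {a, b}) = 2"
    using vec.dim_span_eq_card_independent[OF ind(1)] ind(2) by simp
  have sub: "rad (vec.span {a, b}) \<subseteq> vec.span {a, b}" by (auto simp: rad_def)
  show "r \<le> 2" unfolding r_def using vec.dim_subset[OF sub] d2 by simp
  have rad_iff: "x \<in> rad (vec.span {a, b}) \<longleftrightarrow> x \<in> vec.span {a, b} \<and> h x a = 0 \<and> h x b = 0" for x
    by (simp add: rad_span perp_def)
  have ab: "a \<in> vec.span {a, b}" "b \<in> vec.span {a, b}" by (simp_all add: vec.span_base)
  show "r = 2 \<longleftrightarrow> h a a = 0 \<and> h b b = 0 \<and> h a b = 0"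
  proof
    assume "r = 2"
    then have "rad (vec.span {a, b}) = vec.span {a, b}"
      using sub d2 by (intro subspace_eqI subspace_rad vec.subspace_span) (auto simp: r_def)
    then show "h a a = 0 \<and> h b b = 0 \<and> h a b = 0" using ab rad_iff by metis
  next
    assume "h a a = 0 \<and> h b b = 0 \<and> h a b = 0"
    then have "{a, b} \<subseteq> perp {a, b}" using h_eq_0_sym by (auto simp: perp_def)
    then have "vec.span {a, b} \<subseteq> perp {a, b}" by (rule vec.span_minimal) simp
    then show "r = 2" unfolding r_def rad_span using d2 by (simp add: Int_absorb2)
  qed
  show "r = 0" if h: "h a a = 0" "h a b \<noteq> 0"
  proof -
    have "x = 0" if xr: "x \<in> rad (vec.span {a, b})" for x
    proof -
      obtain k l where x: "x = k *s a + l *s b"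
        using xr by (auto simp: rad_iff span_pair_iff)
      have "h b a \<noteq> 0" using h h_eq_0_sym by metis
      then have "l = 0" using xr h by (simp add: rad_iff x h_simps)
      then have "k = 0" using xr h by (simp add: rad_iff x h_simps)
      then show "x = 0" using x \<open>l = 0\<close> by simp
    qed
    then have "rad (vec.span {a, b}) \<subseteq> {0}" by auto
    then show ?thesis by (simp add: r_def)
  qed
  show "r > 0" if "\<exists>x \<in> rad (vec.span {a, b}). x \<noteq> 0"
  proof (rule gr0I)
    assume "r = 0"
    then have "rad (vec.span {a, b}) \<subseteq> {0}" by (simp add: r_def)
    then show False using that by blast
  qed
qed

lemma card_codim2_section:
  fixes a b :: "'a ^ 5"
  assumes ind: "vec.independent {a, b}" "a \<noteq> b"
  shows "card (pts (iso (perp {a, b}))) =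
    (let r = vec.dim (rad (vec.span {a, b})) in
      if r = 0 then t ^ 3 + 1 else if r = 1 then t ^ 3 + t ^ 2 + 1 else t ^ 2 + 1)"
proof -
  have "vec.dim (perp {a, b}) = 3"
    using dim_perp[OF vec.subspace_span, of "{a, b}"] vec.dim_span_eq_card_independent[OF ind(1)] ind(2)
    by simp
  moreover define r where "r = vec.dim (rad (vec.span {a, b}))"
  moreover have "r = 0 \<or> r = 1 \<or> r = 2"
    using dim_rad_pair(1)[OF ind, folded r_def] by auto
  ultimately show ?thesis
    using card_pts_iso_values(4-6)[OF subspace_perp, of "{a, b}", unfolded rad_perp_set, folded r_def]
    by (auto simp: Let_def)
qed

text \<open>If exactly one hyperplane is tangent, the last assumption makes it the first one. The
  count is inclusion and exclusion.\<close>

lemma pair_cases: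
  fixes a b :: "'a ^ 5"
  defines "N \<equiv> card (hermitian_variety t \<inter> (pts (perp {a}) \<union> pts (perp {b})))"
  assumes nz: "a \<noteq> 0" "b \<noteq> 0" "\<not> (h a a \<noteq> 0 \<and> h b b = 0)"
  shows "N \<in> {2 * t ^ 5 + t ^ 3 + 2 * t ^ 2 + 1, 2 * t ^ 5 + t ^ 3 + t ^ 2 + 1, 2 * t ^ 5 + 2 * t ^ 2 + 1} \<or>
    N < 2 * t ^ 5 + t ^ 2 + 1 \<or>
    N = 2 * t ^ 5 + t ^ 2 + 1 \<and> h a a = 0 \<and> h a b = 0 \<and> vec.independent {a, b} \<and> a \<noteq> b"
proof (cases "vec.independent {a, b} \<and> a \<noteq> b")
  case dep: False
  have "pts (perp {a}) = pts (perp {b})"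
  proof (cases "a = b")
    case False
    then have "a \<in> vec.span {b}"
      using dep nz by (simp add: vec.independent_insert del: vec.span_singleton)
    then obtain c where c: "a = c *s b" by (auto simp: vec.span_singleton)
    then have "c \<noteq> 0" using nz by auto
    then show ?thesis unfolding c by (simp add: perp_def h_simps)
  qed simp
  then have "N = card (pts (iso (perp {a})))" by (simp add: N_def pts_iso)
  then have "N \<le> t ^ 5 + t ^ 3 + t ^ 2 + 1" using card_hyperplane_section[OF nz(1)] by auto
  moreover have "t ^ 3 < t ^ 5" using t_ge_2 by (intro power_strict_increasing) auto
  ultimately show ?thesis by linarith
next
  case True
  then have ind: "vec.independent {a, b}" "a \<noteq> b" by auto
  define r where "r = vec.dim (rad (vec.span {a, b}))"
  note r = dim_rad_pair[OF ind, folded r_def]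
  have t: "t ^ 2 < t ^ 3" using t_ge_2 by (intro power_strict_increasing) auto
  define A B C where "A = card (pts (iso (perp {a})))" and "B = card (pts (iso (perp {b})))"
    and "C = card (pts (iso (perp {a, b})))"
  have eq: "N + C = A + B"
    using card_pair[of a b] by (simp add: N_def A_def B_def C_def)
  have A: "A = (if h a a = 0 then t ^ 5 + t ^ 2 + 1 else t ^ 5 + t ^ 3 + t ^ 2 + 1)"
    unfolding A_def by (rule card_hyperplane_section[OF nz(1)])
  have B: "B = (if h b b = 0 then t ^ 5 + t ^ 2 + 1 else t ^ 5 + t ^ 3 + t ^ 2 + 1)"
    unfolding B_def by (rule card_hyperplane_section[OF nz(2)])
  have C: "C = (if r = 0 then t ^ 3 + 1 else if r = 1 then t ^ 3 + t ^ 2 + 1 else t ^ 2 + 1)"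
    unfolding C_def card_codim2_section[OF ind, folded r_def] by (simp add: Let_def)
  consider "h a a \<noteq> 0" "h b b \<noteq> 0" | "h a a = 0" "h b b \<noteq> 0" | "h a a = 0" "h b b = 0"
    using nz(3) by blast
  then show ?thesis
  proof cases
    case 1
    then have "r \<noteq> 2" using r(2) by blast
    then have "N \<in> {2 * t ^ 5 + t ^ 3 + 2 * t ^ 2 + 1, 2 * t ^ 5 + t ^ 3 + t ^ 2 + 1}"
      using 1 eq A B C r(1) by (cases "r = 0") simp_all
    then show ?thesis by blast
  next
    case 2
    show ?thesis
    proof (cases "r = 0")
      case True
      then have "N = 2 * t ^ 5 + 2 * t ^ 2 + 1" using 2 eq A B C by simp
      then show ?thesis by simp
    next
      case False
      then have "r = 1" "h a b = 0" using 2 r(1-3) by force+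
      then have "N = 2 * t ^ 5 + t ^ 2 + 1" using 2 eq A B C by simp
      then show ?thesis using 2 \<open>h a b = 0\<close> ind by blast
    qed
  next
    case 3
    show ?thesis
    proof (cases "h a b = 0")
      case True
      then have "r = 2" using r(2) 3 by blast
      then have "N = 2 * t ^ 5 + t ^ 2 + 1" using 3 eq A B C by simp
      then show ?thesis using 3 True ind by blast
    next
      case False
      \<comment> \<open>Here r = 0, so N exceeds the bound by t^2 - t^3, which is negative.\<close>
      then have "N < 2 * t ^ 5 + t ^ 2 + 1" using 3 eq A B C r(3) t by simp
      then show ?thesis by blast
    qed
  qed
qed

end

section \<open>The two kinds of quadrics\<close>

context square_field
begin

lemma norm_surj:
  assumes "(d::'a) ^ t = d"
  obtains c where "c * c ^ t = d"
proof (cases "d = 0")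
  case False
  then have "{c. c ^ (t + 1) = d} \<noteq> {}"
    using card_norm_fibre[OF assms False] by (metis card.empty Suc_eq_plus1 nat.distinct(1))
  then show thesis using that by auto
qed (use that[of 0] in auto)

text \<open>Gram-Schmidt: \<open>polarize\<close> supplies a nonisotropic vector, surjectivity of
  the norm scales it to length 1, and its orthogonal complement is again nondegenerate.\<close>

lemma orthonormal_family:
  fixes W :: "('a ^ 'n) set"
  assumes "vec.subspace W" "rad W = {0}" "vec.dim W = m"
  shows "\<exists>u. (\<forall>i<m. u i \<in> W) \<and> (\<forall>i<m. \<forall>j<m. h (u i) (u j) = (if i = j then 1 else 0))"
  using assms
proof (induction m arbitrary: W)
  case (Suc m)
  have "W \<noteq> {0}" using Suc.prems(3) by auto
  then have "rad W \<noteq> W" using Suc.prems(2) by simp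
  then obtain w where w: "w \<in> W" "h w w \<noteq> 0"
    using polarize[OF Suc.prems(1)] by (auto simp: rad_def perp_def)
  have "inverse (h w w) ^ t = inverse (h w w)" by (simp add: power_inverse h_self_fixed)
  then obtain c where c': "c * c ^ t = inverse (h w w)" by (rule norm_surj)
  have "h (c *s w) (c *s w) = (c * c ^ t) * h w w"
    by (simp add: h_simps)
  then have c: "h (c *s w) (c *s w) = 1"
    unfolding c' using w by simp
  define v where "v = c *s w"
  have v: "v \<in> W" "h v v = 1" using w c Suc.prems(1) by (auto simp: v_def vec.subspace_scale)
  define V where "V = {x\<in>W. h x v = 0}"
  have V: "vec.subspace V" unfolding V_def by (rule subspace_kernel[OF Suc.prems(1) functional_h])
  have "card W = q * card V"
    using card_kernel[OF Suc.prems(1) functional_h v(1)] v by (simp add: V_def card_K)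
  then have "q ^ Suc m = q * q ^ vec.dim V"
    using card_subspace[OF V] card_subspace[OF Suc.prems(1)] Suc.prems(3) by (simp add: card_K)
  then have "q ^ Suc m = q ^ Suc (vec.dim V)" by simp
  then have "Suc m = Suc (vec.dim V)" by (rule power_inject_exp[OF q_gt_1, THEN iffD1])
  then have dimV: "vec.dim V = m" by simp
  have "x \<in> rad W" if x: "x \<in> rad V" for x
  proof -
    have "h x y = 0" if y: "y \<in> W" for y
    proof -
      have "y - h y v *s v \<in> V"
        using y v Suc.prems(1) by (auto simp: V_def h_simps intro: vec.subspace_diff vec.subspace_scale)
      then have "h x (y - h y v *s v) = 0" using x by (simp add: rad_def perp_def)
      moreover have "h x v = 0" using x by (simp add: rad_def V_def)
      ultimately show ?thesis by (simp add: h_simps)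
    qed
    then show ?thesis using x by (simp add: rad_def perp_def V_def)
  qed
  then have "rad V = {0}"
    using Suc.prems(2) vec.subspace_0[OF subspace_rad[OF V]] by auto
  from Suc.IH[OF V this dimV] obtain u where
    u: "\<forall>i<m. u i \<in> V" "\<forall>i<m. \<forall>j<m. h (u i) (u j) = (if i = j then 1 else 0)" by blast
  define u' where "u' = u(m := v)"
  have uv: "h (u i) v = 0" "h v (u i) = 0" if "i < m" for i
    using u(1) that h_eq_0_sym[of v "u i"] by (auto simp: V_def)
  have "\<forall>i<Suc m. u' i \<in> W"
    using u(1) v by (auto simp: u'_def V_def less_Suc_eq)
  moreover have "\<forall>i<Suc m. \<forall>j<Suc m. h (u' i) (u' j) = (if i = j then 1 else 0)"
    using u(2) uv v by (auto simp: u'_def less_Suc_eq)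
  ultimately show ?case by blast
qed simp

text \<open>This supplies the coordinates that \<open>tangent_to_section\<close> asks for, by
  sending the standard basis to an orthonormal one.\<close>

lemma isometry_onto_hyperplane:
  fixes b :: "'a ^ 5"
  assumes b: "h b b \<noteq> 0"
  obtains \<phi> :: "'a ^ 4 \<Rightarrow> 'a ^ 5" where "Vector_Spaces.linear (*s) (*s) \<phi>" "inj \<phi>"
    "\<And>x y. h (\<phi> x) (\<phi> y) = h x y" "range \<phi> = perp {b}"
proof -
  have "b \<noteq> 0" using b by auto
  have dim: "vec.dim (perp {b}) = 4"
    using dim_perp_1[OF \<open>b \<noteq> 0\<close>] by simp
  have "vec.dim (rad (perp {b})) = 0"
    using dim_rad_span_1[OF \<open>b \<noteq> 0\<close>] b by (simp add: rad_perp_set del: vec.dim_eq_0)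
  then have "rad (perp {b}) = {0}"
    using vec.subspace_0[OF subspace_rad[OF subspace_perp], of "{b}"] by auto
  from orthonormal_family[OF subspace_perp this dim]
  obtain u where u: "\<forall>i<4::nat. u i \<in> perp {b}"
      "\<forall>i<4::nat. \<forall>j<4. h (u i) (u j) = (if i = j then 1 else 0 :: 'a)"
    by (elim exE conjE)
  obtain e where e: "bij_betw e (UNIV :: 4 set) {0..<CARD(4)}"
    using ex_bij_betw_finite_nat[of "UNIV :: 4 set"] by auto
  define w where "w = (\<lambda>j. u (e j))"
  have e_lt: "e j < 4" for j using bij_betwE[OF e] by simp
  have e_inj: "e i = e j \<longleftrightarrow> i = j" for i j using bij_betw_imp_inj_on[OF e] by (simp add: inj_eq)
  have w: "w j \<in> perp {b}" "h (w i) (w j) = (if i = j then 1 else 0)" for i j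
    using u(1)[rule_format, OF e_lt] u(2)[rule_format, OF e_lt e_lt, of i j] e_inj[of i j]
    by (simp_all add: w_def)
  define M where "M = (\<chi> k j. w j $ k)"
  define \<phi> where "\<phi> = (\<lambda>x. M *v x)"
  have phi: "\<phi> x = (\<Sum>j\<in>UNIV. x $ j *s w j)" for x
    by (simp add: \<phi>_def M_def matrix_vector_mult_def vec_eq_iff sum_component mult.commute)
  have fl: "h (sum g A) y = (\<Sum>i\<in>A. h (g i) y)" for g :: "4 \<Rightarrow> 'a ^ 5" and A y
    by (rule functional_sum[OF functional_h])
  have fr: "h y (sum g A) = (\<Sum>i\<in>A. h y (g i))" for g :: "4 \<Rightarrow> 'a ^ 5" and A y
    by (induction A rule: infinite_finite_induct) (auto simp: h_simps)
  have iso: "h (\<phi> x) (\<phi> y) = h x y" for x y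
  proof -
    have "h (\<phi> x) (\<phi> y) = (\<Sum>j\<in>UNIV. \<Sum>i\<in>UNIV. y $ j ^ t * (x $ i * h (w i) (w j)))"
      by (simp add: phi fl fr h_simps sum_distrib_left)
    also have "\<dots> = (\<Sum>j\<in>UNIV. \<Sum>i\<in>UNIV. if i = j then x $ i * y $ j ^ t else 0)"
      by (intro sum.cong) (auto simp: w(2))
    finally show ?thesis by (simp add: h_def)
  qed
  have lin: "Vector_Spaces.linear (*s) (*s) \<phi>"
    unfolding \<phi>_def by (rule matrix_vector_mul_linear_gen)
  interpret g: Vector_Spaces.linear "(*s)" "(*s)" \<phi> by fact
  have inj: "inj \<phi>"
  proof (rule injI)
    fix x y assume "\<phi> x = \<phi> y"
    then have "\<phi> (x - y) = 0" by (simp add: g.diff)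
    then have "h z (x - y) = 0" for z using iso[of z "x - y"] by simp
    then have "x - y = 0" by (rule h_nondegenerate)
    then show "x = y" by simp
  qed
  have "range \<phi> \<subseteq> perp {b}"
    unfolding phi by (auto intro!: vec.subspace_sum vec.subspace_scale w)
  moreover have "card (range \<phi>) = card (perp {b})"
    using card_image[OF inj] card_subspace[OF subspace_perp, of "{b}"] dim by (simp add: card_K)
  ultimately have "range \<phi> = perp {b}" by (metis card_subset_eq finite)
  then show thesis using that lin inj iso by blast
qed

text \<open>The coordinate map is injective on points. So the plane of intersection has as many
  points on the variety as a tangent plane has on the hermitian surface, namely t^3 + t^2 +
  1.\<close>

lemma card_kind1:
  fixes Q :: "('a ^ 5) set set"
  assumes "quadric_kind1 t Q"
  shows "card (hermitian_variety t \<inter> Q) = 2 * t ^ 5 + t ^ 2 + 1"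
proof -
  let ?X = "hermitian_variety t :: ('a ^ 5) set set"
  obtain H' H where HH: "H' \<in> hyperplanes" "H \<in> hyperplanes" "Q = H' \<union> H" "is_tangent t H'"
      "\<not> is_tangent t H" "tangent_to_section t H (H' \<inter> H)"
    using assms by (auto simp: quadric_kind1_def)
  obtain a where a: "a \<noteq> 0" "h a a = 0" "H' = pts (perp {a})" using HH(4) by (auto simp: is_tangent_iff)
  obtain b where b: "b \<noteq> 0" "H = pts (perp {b})" using HH(2) by (auto simp: hyperplanes_iff)
  have hb: "h b b \<noteq> 0" using HH(5) b is_tangent_perp_iff by blast
  obtain \<phi> :: "'a ^ 4 \<Rightarrow> 'a ^ 5" and E where phi: "inj \<phi>"
      "(\<lambda>P. \<phi> ` P) ` hermitian_variety t = ?X \<inter> H" "is_tangent t E" "H' \<inter> H = (\<lambda>P. \<phi> ` P) ` E"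
    using HH(6) by (auto simp: tangent_to_section_def)
  obtain p where p: "p \<noteq> 0" "h p p = 0" "E = pts (perp {p})" using phi(3) by (auto simp: is_tangent_iff)
  have injP: "inj (\<lambda>P. \<phi> ` P)" using phi(1) by (simp add: inj_on_image)
  have "card (pts (iso (perp {a, b}))) = card (?X \<inter> (H' \<inter> H))"
    by (simp add: pts_iso a b pts_perp_Int)
  also have "?X \<inter> (H' \<inter> H) = (\<lambda>P. \<phi> ` P) ` (hermitian_variety t \<inter> E)"
    unfolding image_Int[OF injP] phi(2) phi(4)[symmetric] by auto
  also have "card \<dots> = card (hermitian_variety t \<inter> E)"
    using injP by (intro card_image) (auto intro: inj_on_subset)
  also have "\<dots> = card (pts (iso (perp {p})))" by (simp add: p pts_iso)
  also have "\<dots> = t ^ 3 + t ^ 2 + 1"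
    using dim_perp_1[OF p(1)] dim_rad_span_1[OF p(1)] p(2)
    by (intro card_pts_iso_values) (simp_all add: rad_perp_set)
  finally show ?thesis
    using card_pair[of a b] card_hyperplane_section[OF a(1)] card_hyperplane_section[OF b(1)] a b(2) hb HH(3)
    by simp
qed

lemma card_kind2:
  fixes Q :: "('a ^ 5) set set"
  assumes "quadric_kind2 t Q"
  shows "card (hermitian_variety t \<inter> Q) = 2 * t ^ 5 + t ^ 2 + 1"
proof -
  let ?X = "hermitian_variety t :: ('a ^ 5) set set"
  obtain H' H where HH: "Q = H \<union> H'" "is_tangent t H" "is_tangent t H'" "H \<inter> H' \<inter> ?X \<in> proj_lines"
    using assms by (auto simp: quadric_kind2_def)
  obtain a where a: "a \<noteq> 0" "h a a = 0" "H = pts (perp {a})" using HH(2) by (auto simp: is_tangent_iff)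
  obtain b where b: "b \<noteq> 0" "h b b = 0" "H' = pts (perp {b})" using HH(3) by (auto simp: is_tangent_iff)
  obtain L where L: "vec.subspace L" "vec.dim L = 2" "H \<inter> H' \<inter> ?X = pts L"
    using HH(4) by (auto simp: proj_lines_def proj_flats_def pts_def)
  have "int (card (pts L)) * (int q - 1) = int q ^ 2 - 1"
    using card_pts_q[OF cone_subspace[OF L(1)] vec.subspace_0[OF L(1)]] card_subspace[OF L(1)] L(2)
    by (simp add: card_K)
  also have "\<dots> = (int q + 1) * (int q - 1)" by (simp add: power2_eq_square algebra_simps)
  finally have "int (card (pts L)) = int q + 1"
    using q_gt_1 by (subst (asm) mult_cancel_right) (auto simp del: of_nat_power)
  then have "card (pts L) = t ^ 2 + 1" by linarith
  moreover have "pts (iso (perp {a, b})) = pts L"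
    using L(3) by (auto simp: pts_iso a b simp flip: pts_perp_Int)
  ultimately show ?thesis
    using card_pair[of a b] card_hyperplane_section[OF a(1)] card_hyperplane_section[OF b(1)] a b HH(1)
    by simp
qed

text \<open>Orthogonality puts the pole \<open>a\<close> into \<open>perp {b}\<close>; its preimage
  under the isometry is the point of contact of the plane.\<close>

lemma kind1I:
  fixes a b :: "'a ^ 5"
  assumes a: "a \<noteq> 0" "h a a = 0" and b: "h b b \<noteq> 0" and ab: "h a b = 0"
  shows "quadric_kind1 t (pts (perp {a}) \<union> pts (perp {b}))"
proof -
  have "b \<noteq> 0" using b by auto
  obtain \<phi> :: "'a ^ 4 \<Rightarrow> 'a ^ 5" where phi: "Vector_Spaces.linear (*s) (*s) \<phi>" "inj \<phi>"
    "\<And>x y. h (\<phi> x) (\<phi> y) = h x y" "range \<phi> = perp {b}"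
    by (rule isometry_onto_hyperplane[OF b]) (rule that; assumption)
  interpret g: Vector_Spaces.linear "(*s)" "(*s)" \<phi> by fact
  have "a \<in> perp {b}" using ab by (simp add: perp_def)
  then obtain p where p: "a = \<phi> p" using phi(4) by auto
  have "p \<noteq> 0" using a(1) p by auto
  have "h p p = 0" using a(2) phi(3) p by metis
  note im = image_pts[OF phi(1,2)]
  have 1: "(\<lambda>P. \<phi> ` P) ` proj_points = pts (perp {b})"
    unfolding pts_UNIV[symmetric] by (subst im) (auto simp: phi(4))
  have X4: "hermitian_variety t = pts (iso (UNIV :: ('a ^ 4) set))"
    by (rule hermitian_variety_eq)
  have "\<phi> ` iso UNIV = iso (perp {b})"
    unfolding phi(4)[symmetric] by (auto simp: iso_def phi(3))
  then have 2: "(\<lambda>P. \<phi> ` P) ` hermitian_variety t = hermitian_variety t \<inter> pts (perp {b})"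
    by (simp add: X4 im cone_iso cone_subspace flip: pts_iso)
  have "\<phi> ` perp {p} = perp {a} \<inter> range \<phi>"
    by (auto simp: perp_def p phi(3))
  then have 3: "pts (perp {a}) \<inter> pts (perp {b}) = (\<lambda>P. \<phi> ` P) ` pts (perp {p})"
    by (subst im) (auto simp: phi(4) pts_Int)
  have "tangent_to_section t (pts (perp {b})) (pts (perp {a}) \<inter> pts (perp {b}))"
    unfolding tangent_to_section_def is_tangent_iff using phi(1,2) 1 2 3 \<open>p \<noteq> 0\<close> \<open>h p p = 0\<close> by blast
  moreover have "is_tangent t (pts (perp {a}))" "\<not> is_tangent t (pts (perp {b}))"
    using is_tangent_perp_iff a b \<open>b \<noteq> 0\<close> by simp_all
  moreover have "pts (perp {a}) \<in> hyperplanes" "pts (perp {b}) \<in> hyperplanes"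
    using a(1) \<open>b \<noteq> 0\<close> by (auto simp: hyperplanes_iff)
  ultimately show ?thesis
    unfolding quadric_kind1_def by (intro bexI[of _ "pts (perp {a})"] bexI[of _ "pts (perp {b})"] conjI) simp_all
qed

text \<open>The line of poles is totally isotropic, hence it is the radical of its orthogonal plane.
  A form of rank 1 has no isotropic vectors outside its radical.\<close>

lemma kind2I:
  fixes a b :: "'a ^ 5"
  assumes ind: "vec.independent {a, b}" "a \<noteq> b" and iso0: "h a a = 0" "h b b = 0" "h a b = 0"
  shows "quadric_kind2 t (pts (perp {a}) \<union> pts (perp {b}))"
proof -
  have nz: "a \<noteq> 0" "b \<noteq> 0" using ind(1) vec.dependent_zero by blast+
  let ?L = "vec.span {a, b}" and ?W = "perp {a, b}"
  have dimL: "vec.dim ?L = 2" using vec.dim_span_eq_card_independent[OF ind(1)] ind(2) by simp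
  have dimW: "vec.dim ?W = 3" using dim_perp[OF vec.subspace_span, of "{a, b}"] dimL by simp
  have "{a, b} \<subseteq> ?W" using iso0 h_eq_0_sym by (auto simp: perp_def)
  then have LW: "?L \<subseteq> ?W" by (rule vec.span_minimal) simp
  have "iso ?W = ?L"
  proof (rule sym, rule card_subset_eq)
    have "h x x = 0" if "x \<in> ?L" for x
    proof -
      have "x \<in> perp ?L" using LW that by (simp add: subset_iff)
      then show ?thesis using that by (simp only: perp_def mem_Collect_eq)
    qed
    then show "?L \<subseteq> iso ?W" using LW by (auto simp: iso_def)
    have r: "vec.dim (rad ?W) = 2"
      using dim_rad_pair(2)[OF ind] iso0 by (simp add: rad_perp_set)
    \<comment> \<open>For rank 1 the factor is q - (t - 1) t = t.\<close>
    have "int t * card (iso ?W) = card (rad ?W) * (int q ^ 1 + (- 1) ^ 1 * (int t - 1) * int t ^ 1)"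
      using card_subspace[OF subspace_perp, of "{a, b}"]
        card_subspace[OF subspace_rad[OF subspace_perp], of "{a, b}"] dimW r
      by (intro card_iso subspace_perp) (simp add: card_K power_add[symmetric] power_numeral_reduce)
    also have "\<dots> = int t * card (rad ?W)" by (simp add: power2_eq_square algebra_simps)
    finally have "card (iso ?W) = card (rad ?W)" using t_ge_2 by simp
    also have "\<dots> = card ?L"
      using card_subspace[OF subspace_rad[OF subspace_perp], of "{a, b}"]
        card_subspace[OF vec.subspace_span, of "{a, b}"] r dimL by simp
    finally show "card ?L = card (iso ?W)" by simp
  qed simp
  then have "hermitian_variety t \<inter> pts ?W = pts ?L"
    by (simp flip: pts_iso)
  then have "pts (perp {a}) \<inter> pts (perp {b}) \<inter> hermitian_variety t = pts ?L"
    unfolding pts_perp_Int by (simp add: Int_commute)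
  moreover have "pts ?L \<in> proj_lines"
    unfolding proj_lines_def proj_flats_def pts_def using dimL
    by (auto intro!: exI[of _ ?L] simp del: vec.dim_span)
  moreover have "pts (perp {a}) \<noteq> pts (perp {b})"
  proof
    assume "pts (perp {a}) = pts (perp {b})"
    then have "perp {a} = perp {b}"
      by (subst (asm) pts_eq_iff) auto
    then have "perp {a, b} = perp {a}" by (auto simp: perp_def)
    then show False using dimW dim_perp_1[OF nz(1)] by simp
  qed
  moreover have "is_tangent t (pts (perp {a}))" "is_tangent t (pts (perp {b}))"
    using is_tangent_perp_iff nz iso0 by simp_all
  moreover have "pts (perp {a}) \<in> hyperplanes" "pts (perp {b}) \<in> hyperplanes"
    using nz by (auto simp: hyperplanes_iff)
  ultimately show ?thesis
    unfolding quadric_kind2_def by (intro bexI[of _ "pts (perp {a})"] bexI[of _ "pts (perp {b})"] conjI) simp_all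
qed

end

section \<open>Lines on a quadric without planes\<close>

lemma ex_proportional:
  fixes u v x y :: "'a::field"
  assumes eq: "u * x + v * y = 0" and nz: "x \<noteq> 0 \<or> y \<noteq> 0"
  shows "\<exists>c. u = c * y \<and> v = - c * x"
proof (cases "x = 0")
  case True
  then show ?thesis using eq nz by (intro exI[of _ "u / y"]) simp
next
  case False
  have "u * x = - v * y" using eq by (simp add: eq_neg_iff_add_eq_0)
  moreover have "u = (u * x) / x" using False by simp
  ultimately have "u = (- v * y) / x" by simp
  then show ?thesis using False by (intro exI[of _ "- v / x"]) simp
qed

context square_field
begin

lemma h_line:
  "h (x + c *s r) (x + c *s r) = poly ([:h x x:] + Polynomial.monom (h r x) 1 + Polynomial.monom (h x r) t
     + Polynomial.monom (h r r) (t + 1)) c"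
  by (simp add: poly_monom h_simps algebra_simps)

text \<open>The degree of the polynomial in \<open>h_line\<close> is t + 1 or t, depending on
  whether \<open>h r r\<close> vanishes. Only the points \<open>x + c *s r\<close> are counted, not
  the point of \<open>r\<close>.\<close>

lemma card_line:
  fixes x r :: "'a ^ 'n"
  shows "h r r \<noteq> 0 \<Longrightarrow> card {c. h (x + c *s r) (x + c *s r) = 0} \<le> t + 1"
    and "h r r = 0 \<Longrightarrow> h x r \<noteq> 0 \<Longrightarrow> card {c. h (x + c *s r) (x + c *s r) = 0} \<le> t"
    and "h r r = 0 \<Longrightarrow> h x r = 0 \<Longrightarrow> h x x \<noteq> 0 \<Longrightarrow> card {c. h (x + c *s r) (x + c *s r) = 0} = 0"
    and "card {c. h (x + c *s r) (x + c *s r) = 0} \<le> q"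
proof -
  define P where "P = [:h x x:] + Polynomial.monom (h r x) 1 + Polynomial.monom (h x r) t
     + Polynomial.monom (h r r) (t + 1)"
  have roots: "card {c. h (x + c *s r) (x + c *s r) = 0} \<le> n" if "Polynomial.coeff P m \<noteq> 0" "degree P \<le> n" for n m
  proof -
    have "P \<noteq> 0" using that by auto
    from card_poly_roots_bound[OF this] show ?thesis using that unfolding h_line P_def[symmetric] by simp
  qed
  show "card {c. h (x + c *s r) (x + c *s r) = 0} \<le> t + 1" if "h r r \<noteq> 0"
  proof (rule roots)
    show "Polynomial.coeff P (t + 1) \<noteq> 0"
      using t_ge_2 that by (simp add: P_def coeff_pCons split: nat.split)
    show "degree P \<le> t + 1"
      unfolding P_def by (intro degree_add_le order_trans[OF degree_monom_le]) auto
  qed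
  show "card {c. h (x + c *s r) (x + c *s r) = 0} \<le> t" if "h r r = 0" "h x r \<noteq> 0"
  proof (rule roots)
    show "Polynomial.coeff P t \<noteq> 0"
      using t_ge_2 that by (auto simp: P_def coeff_pCons split: nat.split)
    show "degree P \<le> t"
      unfolding P_def that(1) using t_ge_2
      by (simp only: monom_eq_0 add_0_right) (intro degree_add_le order_trans[OF degree_monom_le], auto)
  qed
  show "card {c. h (x + c *s r) (x + c *s r) = 0} = 0" if "h r r = 0" "h x r = 0" "h x x \<noteq> 0"
    using that h_eq_0_sym[of r x] by (simp add: h_simps)
  show "card {c. h (x + c *s r) (x + c *s r) = 0} \<le> q"
    using card_mono[of UNIV "{c. h (x + c *s r) (x + c *s r) = 0}"] by (simp add: card_K)
qed

text \<open>A totally isotropic subspace lies in its orthogonal complement, so in dimension 5 it has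
  dimension at most 2.\<close>

lemma no_isotropic_plane:
  fixes x y z :: "'a ^ 5"
  assumes "x \<noteq> 0" "y \<notin> vec.span {x}" "z \<notin> vec.span {y, x}"
    and "h x x = 0" "h y y = 0" "h z z = 0" "h y x = 0" "h z x = 0" "h z y = 0"
  shows False
proof -
  let ?V = "vec.span {z, y, x}"
  have "vec.dim ?V = 3"
    using assms(1-3) vec.dim_insert[of z "{y, x}"] vec.dim_insert[of y "{x}"]
    by (simp del: vec.span_singleton)
  moreover have "{z, y, x} \<subseteq> perp {z, y, x}"
    using assms h_eq_0_sym by (auto simp: perp_def)
  then have "?V \<subseteq> perp {z, y, x}" by (rule vec.span_minimal) simp
  then have "vec.dim ?V \<le> vec.dim (perp {z, y, x})" by (rule vec.dim_subset)
  moreover have "vec.dim (perp {z, y, x}) + vec.dim ?V = 5"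
    using dim_perp[OF vec.subspace_span, of "{z, y, x}"] by simp
  ultimately show False by linarith
qed

text \<open>Double counting: a vector outside \<open>W\<close> is reached once from every vector of
  its coset. The sum over vectors stands in for a sum over cosets.\<close>

lemma sum_card_translates:
  fixes W :: "('a ^ 'n) set"
  assumes W: "vec.subspace W"
  shows "(\<Sum>x\<in>-W. card {w\<in>W. P (x + w)}) = card W * card ({x. P x} - W)"
proof -
  have *: "x + w \<in> W \<longleftrightarrow> x \<in> W" if "w \<in> W" for x w
    using vec.subspace_add[OF W _ that] vec.subspace_diff[OF W _ that] by (metis add_diff_cancel_right')
  have "bij_betw (\<lambda>(x, w). (w, x + w)) (SIGMA x:-W. {w\<in>W. P (x + w)}) (W \<times> ({x. P x} - W))"
  proof (rule bij_betwI[where g = "\<lambda>(w, y). (y - w, w)"])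
    show "(\<lambda>(w, y). (y - w, w)) \<in> W \<times> ({x. P x} - W) \<rightarrow> (SIGMA x:-W. {w\<in>W. P (x + w)})"
      using *[of _ "_ - _"] by (auto dest: *[THEN iffD2, of _ "_ - _"])
  qed (auto simp: *)
  from bij_betw_same_card[OF this] show ?thesis
    by (simp add: card_cartesian_product)
qed

end

text \<open>The form and its polar form are kept side by side because in characteristic 2 the polar
  form does not determine \<open>F\<close>. Symmetry of \<open>B\<close>, and with it linearity on
  the other side, follows from \<open>polar\<close>.\<close>

locale quadric = square_field t K for t and K :: "'a::{field,finite} itself" +
  fixes F :: "'a ^ 5 \<Rightarrow> 'a" and B :: "'a ^ 5 \<Rightarrow> 'a ^ 5 \<Rightarrow> 'a"
  assumes polar: "F (x + y) = F x + F y + B x y"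
    and homog: "F (c *s x) = c\<^sup>2 * F x"
    and functional_B: "functional (\<lambda>x. B x y)"
begin

lemma B_add_left: "B (x + y) z = B x z + B y z"
  and B_scale_left: "B (c *s x) z = c * B x z"
  and B_0_left [simp]: "B 0 z = 0"
  and B_diff_left: "B (x - y) z = B x z - B y z"
  by (rule functional_add[OF functional_B] functional_scale[OF functional_B]
      functional_0[OF functional_B] functional_diff[OF functional_B])+

lemma B_sym: "B x y = B y x"
  using polar[of x y] polar[of y x] by (simp add: add.commute)

lemma B_add_right: "B z (x + y) = B z x + B z y"
  and B_scale_right: "B z (c *s x) = c * B z x"
  and B_0_right [simp]: "B z 0 = 0"
  and B_diff_right: "B z (x - y) = B z x - B z y"
  by (simp_all add: B_sym[of z] B_add_left B_scale_left B_diff_left)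

lemmas B_simps = B_add_left B_add_right B_scale_left B_scale_right B_diff_left B_diff_right

lemma F_0 [simp]: "F 0 = 0"
  using homog[of 0 0] by simp

lemma B_self: "B x x = 2 * F x"
proof -
  have "F x + F x + B x x = F (x + x)" by (rule polar[symmetric])
  also have "x + x = 2 *s x" by (simp add: vec_eq_iff)
  finally show ?thesis by (simp add: homog power2_eq_square algebra_simps)
qed

lemma F_pair: "F (a *s x + b *s y) = a\<^sup>2 * F x + b\<^sup>2 * F y + a * b * B x y"
  by (simp add: polar homog B_simps)

definition Z :: "('a ^ 5) set" where
  "Z = {x. F x = 0 \<and> h x x = 0}"

lemma cone_Z: "cone Z"
  by (auto simp: cone_def Z_def homog h_simps)

lemma card_pts_Z: "card (pts Z) * (q - 1) = card (Z - {0})"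
  using card_pts[OF cone_Z] by (simp add: card_K)

end

locale planeless_quadric = quadric +
  assumes no_plane: "vec.subspace V \<Longrightarrow> vec.dim V = 3 \<Longrightarrow> \<exists>x\<in>V. F x \<noteq> 0"

locale singular_line = planeless_quadric +
  fixes p e :: "'a ^ 5"
  assumes p_nz: "p \<noteq> 0" and e_notin: "e \<notin> vec.span {p}" and F_p: "F p = 0" and F_e: "F e = 0"
    and B_pe: "B p e = 0"
begin

definition "W = vec.span {e, p}"

lemma subspace_W: "vec.subspace W"
  by (simp add: W_def)

lemma W_iff: "w \<in> W \<longleftrightarrow> (\<exists>a b. w = a *s p + b *s e)"
  unfolding W_def span_pair_iff by (metis add.commute)

lemma p_in_W: "p \<in> W" and e_in_W: "e \<in> W"
  by (simp_all add: W_def vec.span_base)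

lemma dim_W: "vec.dim W = 2"
  using p_nz e_notin vec.dim_insert[of e "{p}"] by (simp add: W_def del: vec.span_singleton)

lemma card_W: "card W = q\<^sup>2"
  using card_subspace[OF subspace_W] dim_W by (simp add: card_K)

lemma F_W: "w \<in> W \<Longrightarrow> F w = 0"
  by (auto simp: W_iff F_pair F_p F_e B_pe)

text \<open>Otherwise \<open>F\<close> would vanish on the whole plane spanned by \<open>x\<close>
  and \<open>W\<close>.\<close>

lemma F_outside:
  assumes "x \<notin> W" "B x p = 0" "B x e = 0"
  shows "F x \<noteq> 0"
proof
  assume "F x = 0"
  have "vec.dim (vec.span (insert x W)) = 3"
    using assms(1) vec.dim_insert[of x W] vec.span_subspace[OF subset_refl vec.span_superset subspace_W]
      dim_W vec.span_eq_iff[of W] subspace_W by simp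
  then obtain y where y: "y \<in> vec.span (insert x W)" "F y \<noteq> 0"
    using no_plane[OF vec.subspace_span] by blast
  then obtain k where "y - k *s x \<in> W"
    using vec.span_breakdown_eq[of y x W] subspace_W by (auto simp: vec.span_eq_iff[THEN iffD2])
  then obtain a b where "y - k *s x = a *s p + b *s e" by (auto simp: W_iff)
  then have "y = k *s x + (a *s p + b *s e)" by (simp add: diff_eq_eq add.commute)
  then show False
    using y(2) assms \<open>F x = 0\<close> by (simp add: polar homog B_simps F_p F_e B_pe)
qed

text \<open>The plane of \<open>x\<close> and \<open>W\<close> meets the quadric in \<open>W\<close>
  and in at most one further line; \<open>r x\<close> represents the point where that line meets
  \<open>W\<close>. The value 0 means, for \<open>x\<close> outside \<open>W\<close>, that there is
  no further line.\<close>

definition r :: "'a ^ 5 \<Rightarrow> 'a ^ 5" where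
  "r x = B x e *s p - B x p *s e"

lemma r_in_W: "r x \<in> W"
  by (auto simp: r_def intro: vec.subspace_diff vec.subspace_scale subspace_W p_in_W e_in_W)

lemma B_r: "B x (r x) = 0"
  by (simp add: r_def B_simps)

lemma r_eq_0_iff: "r x = 0 \<longleftrightarrow> B x p = 0 \<and> B x e = 0"
proof
  assume r0: "r x = 0"
  have "B x p = 0"
  proof (rule ccontr)
    assume nz: "B x p \<noteq> 0"
    have "B x p *s e = B x e *s p" using r0 by (simp add: r_def)
    then have "inverse (B x p) *s (B x p *s e) = inverse (B x p) *s (B x e *s p)" by simp
    then have "e = (inverse (B x p) * B x e) *s p" using nz by simp
    then have "e \<in> range (\<lambda>k. k *s p)" by blast
    then show False using e_notin by (simp add: vec.span_singleton)
  qed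
  then show "B x p = 0 \<and> B x e = 0" using r0 p_nz by (simp add: r_def)
qed (simp add: r_def)

text \<open>For \<open>x\<close> outside \<open>W\<close> this counts projective points: every point
  of the plane of \<open>x\<close> and \<open>W\<close> that is off \<open>W\<close> has exactly one
  representative in \<open>x + W\<close>.\<close>

definition n :: "'a ^ 5 \<Rightarrow> nat" where
  "n x = card {w\<in>W. x + w \<in> Z}"

lemma sum_n: "(\<Sum>x\<in>-W. n x) = q\<^sup>2 * card (Z - W)"
  using sum_card_translates[OF subspace_W, of "\<lambda>x. x \<in> Z"] by (simp add: n_def card_W)

lemma n_eq_0_of_r_eq_0: "x \<notin> W \<Longrightarrow> r x = 0 \<Longrightarrow> n x = 0"
proof -
  assume x: "x \<notin> W" "r x = 0"
  have "F (x + w) \<noteq> 0" if "w \<in> W" for w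
  proof -
    have "B x w = 0" using that x(2) by (auto simp: W_iff r_eq_0_iff B_simps)
    then show ?thesis using F_outside[OF x(1)] x(2) F_W[OF that] by (simp add: polar r_eq_0_iff)
  qed
  then have "{w\<in>W. x + w \<in> Z} = {}" by (auto simp: Z_def)
  then show ?thesis by (simp add: n_def)
qed

text \<open>On the coset \<open>x + W\<close> the quadratic form is affine, with zero set a coset of \<open>\<langle>r x\<rangle>\<close>.\<close>

lemma n_le_line:
  assumes "r x \<noteq> 0"
  obtains w where "w \<in> W" "F (x + w) = 0" "n x \<le> card {c. h ((x + w) + c *s r x) ((x + w) + c *s r x) = 0}"
proof -
  have F_add: "F (x + (a *s p + b *s e)) = F x + a * B x p + b * B x e" for a b
    by (simp add: polar homog B_simps F_p F_e B_pe)
  obtain a b where ab: "F x + a * B x p + b * B x e = 0"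
  proof (cases "B x p = 0")
    case True
    then have "B x e \<noteq> 0" using assms by (simp add: r_eq_0_iff)
    then show thesis using that[of 0 "- F x / B x e"] by simp
  next
    case False
    then show thesis using that[of "- F x / B x p" 0] by simp
  qed
  define w where "w = a *s p + b *s e"
  have w: "w \<in> W" "F (x + w) = 0" using ab F_add by (auto simp: w_def W_iff)
  have "{v\<in>W. x + v \<in> Z} \<subseteq> (\<lambda>c. w + c *s r x) ` {c. h ((x + w) + c *s r x) ((x + w) + c *s r x) = 0}"
  proof
    fix v assume v: "v \<in> {v\<in>W. x + v \<in> Z}"
    then obtain a' b' where v': "v = a' *s p + b' *s e" by (auto simp: W_iff)
    then have "F x + a' * B x p + b' * B x e = 0" using v F_add by (simp add: Z_def)
    \<comment> \<open>Two zeros of the affine form differ by a solution of its homogeneous part,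
      which is spanned by the coefficients of \<open>r x\<close>.\<close>
    moreover have "(a' - a) * B x p + (b' - b) * B x e =
        (F x + a' * B x p + b' * B x e) - (F x + a * B x p + b * B x e)"
      by (simp add: algebra_simps)
    ultimately have eq: "(a' - a) * B x p + (b' - b) * B x e = 0" using ab by simp
    have "B x p \<noteq> 0 \<or> B x e \<noteq> 0" using assms by (simp add: r_eq_0_iff)
    then obtain c where c: "a' - a = c * B x e" "b' - b = - c * B x p"
      using ex_proportional[OF eq] by blast
    have ab': "a' = a + c * B x e" "b' = b - c * B x p" using c by (simp_all add: algebra_simps)
    have "v = w + c *s r x"
      unfolding v' w_def r_def ab' by (simp add: vec_eq_iff algebra_simps)
    moreover have "h (x + v) (x + v) = 0" using v by (simp add: Z_def)
    ultimately show "v \<in> (\<lambda>c. w + c *s r x) ` {c. h ((x + w) + c *s r x) ((x + w) + c *s r x) = 0}"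
      by (auto simp: add.assoc)
  qed
  then have "n x \<le> card {c. h ((x + w) + c *s r x) ((x + w) + c *s r x) = 0}"
    unfolding n_def by (rule surj_card_le[rotated]) simp
  then show thesis using w that by blast
qed

lemma card_pts_Z_W: "card (pts Z) * (q - 1) = card (Z \<inter> W - {0}) + card (Z - W)"
proof -
  have "Z - {0} = (Z \<inter> W - {0}) \<union> (Z - W)"
    using vec.subspace_0[OF subspace_W] by auto
  moreover have "card ((Z \<inter> W - {0}) \<union> (Z - W)) = card (Z \<inter> W - {0}) + card (Z - W)"
    by (rule card_Un_disjoint) auto
  ultimately show ?thesis by (simp only: card_pts_Z)
qed

lemma Z_Int_W: "Z \<inter> W = iso W"
  by (auto simp: Z_def iso_def F_W)

text \<open>\<open>M1\<close> bounds the points on the fixed line and \<open>M2\<close> those off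
  it. The factor q^2 is the size of a coset and q - 1 the number of nonzero multiples.\<close>

lemma pts_Z_le:
  assumes "card (Z \<inter> W - {0}) \<le> M1 * (q - 1)" "(\<Sum>x\<in>-W. n x) \<le> q\<^sup>2 * (M2 * (q - 1))"
  shows "card (pts Z) \<le> M1 + M2"
proof -
  have "card (Z - W) \<le> M2 * (q - 1)" using assms(2) t_ge_2 unfolding sum_n by simp
  then have "card (pts Z) * (q - 1) \<le> (M1 + M2) * (q - 1)"
    using assms(1) unfolding card_pts_Z_W add_mult_distrib by linarith
  then show ?thesis using q_gt_1 by simp
qed

lemma card_compl_W: "card (- W) = q ^ 5 - q ^ 2"
proof -
  have "card (UNIV :: ('a ^ 5) set) = q ^ 5" by (simp add: card_K)
  then show ?thesis by (simp add: card_Diff_subset card_W Compl_eq_Diff_UNIV)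
qed

end

lemma power_diff_identities:
  fixes k :: nat
  assumes "k > 0"
  shows "k\<^sup>2 - 1 = (k + 1) * (k - 1)"
    and "k ^ 3 - k\<^sup>2 = k\<^sup>2 * (k - 1)"
    and "k ^ 4 - k\<^sup>2 = k\<^sup>2 * ((k + 1) * (k - 1))"
    and "k ^ 4 - k ^ 3 = k ^ 3 * (k - 1)"
    and "k ^ 5 - k ^ 4 = k ^ 4 * (k - 1)"
    and "k ^ 5 - k\<^sup>2 = k\<^sup>2 * ((k\<^sup>2 + k + 1) * (k - 1))"
proof -
  have *: "a - b = c" if "a = b + c" for a b c :: nat using that by simp
  obtain s where s: "k = Suc s" using assms by (cases k) auto
  show "k\<^sup>2 - 1 = (k + 1) * (k - 1)"
    by (rule *) (simp add: s eval_nat_numeral algebra_simps)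
  show "k ^ 3 - k\<^sup>2 = k\<^sup>2 * (k - 1)"
    by (rule *) (simp add: s eval_nat_numeral algebra_simps)
  show "k ^ 4 - k\<^sup>2 = k\<^sup>2 * ((k + 1) * (k - 1))"
    by (rule *) (simp add: s eval_nat_numeral algebra_simps)
  show "k ^ 4 - k ^ 3 = k ^ 3 * (k - 1)"
    by (rule *) (simp add: s eval_nat_numeral algebra_simps)
  show "k ^ 5 - k ^ 4 = k ^ 4 * (k - 1)"
    by (rule *) (simp add: s eval_nat_numeral algebra_simps)
  show "k ^ 5 - k\<^sup>2 = k\<^sup>2 * ((k\<^sup>2 + k + 1) * (k - 1))"
    by (rule *) (simp add: s eval_nat_numeral algebra_simps)
qed

lemma power_cancel:
  fixes k :: nat
  assumes "k > 0"
  shows "k ^ 5 \<le> k * (k * m) \<Longrightarrow> k ^ 3 \<le> m" and "k ^ 4 \<le> k * m \<Longrightarrow> k ^ 3 \<le> m"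
    and "k ^ 3 \<le> k * m \<Longrightarrow> k\<^sup>2 \<le> m" and "k\<^sup>2 \<le> k * m \<Longrightarrow> k \<le> m" and "k ^ 4 = k * m \<Longrightarrow> k ^ 3 = m"
    and "k ^ 5 = k * m \<Longrightarrow> k ^ 4 = m" and "k ^ 5 = k * (k * m) \<Longrightarrow> k ^ 3 = m"
  using assms by (simp_all add: eval_nat_numeral)

lemma sum_two_values_le:
  fixes f :: "'b \<Rightarrow> nat"
  assumes "finite A" "\<And>x. x \<in> A \<Longrightarrow> x \<in> G \<Longrightarrow> f x \<le> k" "\<And>x. x \<in> A \<Longrightarrow> x \<notin> G \<Longrightarrow> f x \<le> l"
  shows "(\<Sum>x\<in>A. f x) \<le> card (A \<inter> G) * k + card (A - G) * l"
proof -
  have "(\<Sum>x\<in>A. f x) = (\<Sum>x\<in>A \<inter> G. f x) + (\<Sum>x\<in>A - G. f x)"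
    using assms(1) by (simp add: sum.Int_Diff)
  also have "\<dots> \<le> card (A \<inter> G) * k + card (A - G) * l"
    using assms sum_bounded_above[of "A \<inter> G" f k] sum_bounded_above[of "A - G" f l]
    by (intro add_mono) simp_all
  finally show ?thesis .
qed

lemma (in square_field) q_pos: "q > 0"
  using q_gt_1 by linarith

section \<open>Bounds from counting along a fixed line\<close>

context singular_line
begin

lemmas q_diffs = power_diff_identities[OF q_pos]

text \<open>The factor q^2 + q + 1 is the number of planes through the fixed line.\<close>

lemma card_compl_W_factored: "card (- W) = q\<^sup>2 * ((q\<^sup>2 + q + 1) * (q - 1))"
  unfolding card_compl_W by (rule q_diffs)

lemma card_iso_W:
  assumes "\<not> W \<subseteq> Z"
  shows "card (Z \<inter> W - {0}) \<le> (t + 1) * (q - 1)"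
proof -
  have sub: "rad W \<subseteq> W" by (auto simp: rad_def)
  have "vec.dim (rad W) \<le> 2" using vec.dim_subset[OF sub] dim_W by simp
  moreover have "vec.dim (rad W) \<noteq> 2"
  proof
    assume "vec.dim (rad W) = 2"
    then have "rad W = W" using dim_W sub by (intro subspace_eqI subspace_rad subspace_W) auto
    then have "W \<subseteq> Z" using F_W by (auto simp: Z_def rad_def perp_def)
    then show False using assms by simp
  qed
  ultimately have "vec.dim (rad W) = 0 \<or> vec.dim (rad W) = 1" by linarith
  then have "card (pts (iso W)) \<le> t + 1"
    using card_pts_iso_values(7,8)[OF subspace_W dim_W] by (auto simp del: vec.dim_eq_0)
  then have "card (pts (iso W)) * (q - 1) \<le> (t + 1) * (q - 1)" by (rule mult_le_mono1)
  then show ?thesis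
    using card_pts[OF cone_iso[OF cone_subspace[OF subspace_W]]] by (simp only: Z_Int_W card_K)
qed

lemma card_iso_W_full:
  assumes "W \<subseteq> Z"
  shows "card (Z \<inter> W - {0}) = (q + 1) * (q - 1)"
proof -
  have "Z \<inter> W = W" using assms by auto
  then have "card (Z \<inter> W - {0}) = q\<^sup>2 - 1"
    using card_W vec.subspace_0[OF subspace_W] by simp
  also have "\<dots> = (q + 1) * (q - 1)"
    by (rule q_diffs)
  finally show ?thesis .
qed

lemma h_W:
  assumes "W \<subseteq> Z" "v \<in> W" "w \<in> W"
  shows "h v w = 0"
proof (rule polarize[OF subspace_W])
  show "h u u = 0" if "u \<in> W" for u using assms(1) that by (auto simp: Z_def)
qed (use assms in auto)

lemma card_pts_Z_le_no_full_line:
  assumes no_full: "\<And>V. vec.subspace V \<Longrightarrow> vec.dim V = 2 \<Longrightarrow> \<not> V \<subseteq> Z"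
  shows "card (pts Z) \<le> (t + 1) + (t + 1) * (q\<^sup>2 + q + 1)"
proof (rule pts_Z_le)
  show "card (Z \<inter> W - {0}) \<le> (t + 1) * (q - 1)"
    by (rule card_iso_W[OF no_full[OF subspace_W dim_W]])
  have "n x \<le> t + 1" if x: "x \<in> - W" for x
  proof (cases "r x = 0")
    case True
    then show ?thesis using n_eq_0_of_r_eq_0 x by simp
  next
    case False
    then obtain w where w: "w \<in> W" "F (x + w) = 0"
        "n x \<le> card {c. h ((x + w) + c *s r x) ((x + w) + c *s r x) = 0}"
      by (rule n_le_line)
    define y where "y = x + w"
    have Fy: "F y = 0" using w(2) by (simp add: y_def)
    have yW: "y \<notin> W"
      using x w(1) vec.subspace_diff[OF subspace_W, of y w] by (auto simp: y_def)
    have By: "B y (r x) = 0"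
    proof -
      have "B w (r x) = 0"
        using w(1) by (auto simp: W_iff r_def B_simps B_self F_p F_e B_pe B_sym[of e p])
      then show ?thesis by (simp add: y_def B_add_left B_r)
    qed
    \<comment> \<open>The vectors \<open>y\<close> and \<open>r x\<close> span the further line. If
      all three values vanished, this line would be shared, against \<open>no_full\<close>; so one
      of the first three cases of \<open>card_line\<close> applies.\<close>
    have "\<not> (h (r x) (r x) = 0 \<and> h y (r x) = 0 \<and> h y y = 0)"
    proof
      assume iso: "h (r x) (r x) = 0 \<and> h y (r x) = 0 \<and> h y y = 0"
      then have "h (r x) y = 0" using h_eq_0_sym by metis
      then have "vec.span {y, r x} \<subseteq> Z"
        using iso Fy By F_W[OF r_in_W[of x]] by (auto simp: span_pair_iff Z_def F_pair h_simps)
      moreover have "y \<notin> vec.span {r x}"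
      proof -
        have "vec.span {r x} \<subseteq> W"
          by (rule vec.span_minimal) (use r_in_W subspace_W in auto)
        then show ?thesis using yW by blast
      qed
      then have "vec.dim (vec.span {y, r x}) = 2"
        using False vec.dim_insert[of y "{r x}"] by (simp del: vec.span_singleton)
      ultimately show False using no_full[OF vec.subspace_span] by blast
    qed
    then have "card {c. h (y + c *s r x) (y + c *s r x) = 0} \<le> t + 1"
      using card_line(1)[of "r x" y] card_line(2)[of "r x" y] card_line(3)[of "r x" y] by linarith
    then show ?thesis using w(3) by (simp add: y_def)
  qed
  then have "(\<Sum>x\<in>-W. n x) \<le> of_nat (card (- W)) * (t + 1)"
    by (rule sum_bounded_above)
  also have "\<dots> = q\<^sup>2 * ((t + 1) * (q\<^sup>2 + q + 1) * (q - 1))"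
    unfolding card_compl_W_factored by (simp only: of_nat_id mult_ac)
  finally show "(\<Sum>x\<in>-W. n x) \<le> q\<^sup>2 * ((t + 1) * (q\<^sup>2 + q + 1) * (q - 1))" .
qed

text \<open>The further line, if any, meets \<open>W\<close> in the isotropic point of
  \<open>r x\<close>. It can lie on the variety, and so contribute q points, only if
  \<open>x\<close> is orthogonal to that point.\<close>

lemma n_full:
  assumes full: "W \<subseteq> Z" and x: "x \<notin> W"
  shows "n x \<le> q" and "h x (r x) \<noteq> 0 \<Longrightarrow> n x \<le> t" and "r x = 0 \<Longrightarrow> n x \<le> t"
proof -
  show "r x = 0 \<Longrightarrow> n x \<le> t" using n_eq_0_of_r_eq_0[OF x] by simp
  have "n x \<le> q \<and> (h x (r x) \<noteq> 0 \<longrightarrow> n x \<le> t)"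
  proof (cases "r x = 0")
    case False
    then obtain w where w: "w \<in> W" "F (x + w) = 0"
        "n x \<le> card {c. h ((x + w) + c *s r x) ((x + w) + c *s r x) = 0}"
      by (rule n_le_line)
    have hr: "h (r x) (r x) = 0" "h (x + w) (r x) = h x (r x)"
      using h_W[OF full] r_in_W w(1) by (auto simp: h_add_left)
    show ?thesis
      using w(3) card_line(4)[of "x + w" "r x"] card_line(2)[of "r x" "x + w", OF hr(1), unfolded hr(2)]
      by linarith
  qed (use n_eq_0_of_r_eq_0[OF x] in simp)
  then show "n x \<le> q" "h x (r x) \<noteq> 0 \<Longrightarrow> n x \<le> t" by auto
qed

text \<open>At a vertex, \<open>r x\<close> is always a multiple of \<open>p\<close>. So more than t
  points occur only in planes inside the tangent hyperplane \<open>D\<close> of the variety at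
  \<open>p\<close>, which contains q + 1 of the planes through the line.\<close>

lemma card_pts_Z_le_vertex:
  assumes full: "W \<subseteq> Z" and vertex: "\<And>x. B x p = 0"
  shows "card (pts Z) \<le> (q + 1) + ((q + 1) * q + q\<^sup>2 * t)"
proof (rule pts_Z_le)
  show "card (Z \<inter> W - {0}) \<le> (q + 1) * (q - 1)" using card_iso_W_full[OF full] by simp
  define D where "D = perp {p}"
  have "card D = q ^ 4"
    using card_subspace[OF subspace_perp, of "{p}"] dim_perp_1[OF p_nz] by (simp add: card_K D_def)
  have "W \<subseteq> D" using h_W[OF full] p_in_W by (auto simp: D_def perp_def)
  have "(\<Sum>x\<in>-W. n x) \<le> card (- W \<inter> D) * q + card (- W - D) * t"
  proof (rule sum_two_values_le)
    fix x assume x: "x \<in> - W" "x \<notin> D"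
    show "n x \<le> t"
    proof (cases "B x e = 0")
      case True
      then show ?thesis using n_full(3)[OF full] x vertex by (simp add: r_eq_0_iff)
    next
      case False
      then have "h x (r x) \<noteq> 0" using x(2) by (simp add: r_def vertex h_simps D_def perp_def)
      then show ?thesis using n_full(2)[OF full] x by simp
    qed
  qed (use n_full(1)[OF full] in auto)
  also have "card (- W \<inter> D) = q ^ 4 - q\<^sup>2"
  proof -
    have "- W \<inter> D = D - W" by auto
    then show ?thesis using \<open>W \<subseteq> D\<close> \<open>card D = q ^ 4\<close> by (simp add: card_Diff_subset card_W)
  qed
  also have "card (- W - D) = q ^ 5 - q ^ 4"
  proof -
    have "- W - D = UNIV - D" using \<open>W \<subseteq> D\<close> by auto
    then show ?thesis using \<open>card D = q ^ 4\<close> by (simp add: card_Diff_subset card_K)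
  qed
  also have "(q ^ 4 - q\<^sup>2) * q + (q ^ 5 - q ^ 4) * t = q\<^sup>2 * (((q + 1) * q + q\<^sup>2 * t) * (q - 1))"
  proof -
    have "k\<^sup>2 * ((k + 1) * u) * k + k ^ 4 * u * t = k\<^sup>2 * (((k + 1) * k + k\<^sup>2 * t) * u)" for k u :: nat
      by (simp add: eval_nat_numeral algebra_simps)
    then show ?thesis unfolding q_diffs .
  qed
  finally show "(\<Sum>x\<in>-W. n x) \<le> q\<^sup>2 * (((q + 1) * q + q\<^sup>2 * t) * (q - 1))" .
qed

lemma card_pts_Z_le_distinct_tangents:
  assumes full: "W \<subseteq> Z"
    and good: "\<And>s. s \<in> W \<Longrightarrow> s \<noteq> 0 \<Longrightarrow> card {x. B x s = 0 \<and> h x s = 0} \<le> q ^ 3"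
  shows "card (pts Z) \<le> (q + 1) + (t * (q\<^sup>2 + q + 1) + (q - t) * (q + 1))"
proof (rule pts_Z_le)
  show "card (Z \<inter> W - {0}) \<le> (q + 1) * (q - 1)" using card_iso_W_full[OF full] by simp
  \<comment> \<open>\<open>G\<close> holds the vectors whose further line may lie on the
    variety.\<close>
  define G where "G = {x. r x \<noteq> 0 \<and> h x (r x) = 0}"
  define D where "D = (\<lambda>s. {x. B x s = 0 \<and> h x s = 0})"
  have BW: "B v w = 0" if "v \<in> W" "w \<in> W" for v w
    using that by (auto simp: W_iff B_simps B_self F_p F_e B_pe B_sym[of e p])
  have cardD: "card (D s - W) \<le> q ^ 3 - q\<^sup>2" if "s \<in> W - {0}" for s
  proof -
    have "W \<subseteq> D s" using that BW h_W[OF full] by (auto simp: D_def)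
    then have "card (D s - W) = card (D s) - q\<^sup>2" by (simp add: card_Diff_subset card_W)
    then show ?thesis using good[of s] that by (simp add: D_def)
  qed
  \<comment> \<open>Every \<open>x\<close> in \<open>G\<close> lies in both tangent hyperplanes at
    \<open>r x\<close>. Counting pairs of \<open>x\<close> with all q - 1 multiples of
    \<open>r x\<close> bounds \<open>G\<close> by q + 1 planes through the line.\<close>
  have "(q - 1) * card (- W \<inter> G) = card ((UNIV - {0::'a}) \<times> (- W \<inter> G))"
    by (simp add: card_cartesian_product card_K)
  also have "\<dots> \<le> card (SIGMA s:W - {0}. D s - W)"
  proof (rule card_inj_on_le[where f = "\<lambda>(c, x). (c *s r x, x)"])
    show "inj_on (\<lambda>(c, x). (c *s r x, x)) ((UNIV - {0}) \<times> (- W \<inter> G))"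
      by (auto simp: inj_on_def G_def)
    show "(\<lambda>(c, x). (c *s r x, x)) ` ((UNIV - {0}) \<times> (- W \<inter> G)) \<subseteq> (SIGMA s:W - {0}. D s - W)"
      using vec.subspace_scale[OF subspace_W r_in_W] by (auto simp: G_def D_def B_simps B_r h_simps)
  qed simp
  also have "\<dots> \<le> (\<Sum>s\<in>W - {0}. q ^ 3 - q\<^sup>2)"
  proof -
    have "card (SIGMA s:W - {0}. D s - W) = (\<Sum>s\<in>W - {0}. card (D s - W))" by simp
    also have "\<dots> \<le> (\<Sum>s\<in>W - {0}. q ^ 3 - q\<^sup>2)" by (rule sum_mono) (rule cardD)
    finally show ?thesis .
  qed
  also have "\<dots> = (q\<^sup>2 - 1) * (q ^ 3 - q\<^sup>2)"
    using card_W vec.subspace_0[OF subspace_W] by simp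
  also have "\<dots> = (q - 1) * (q\<^sup>2 * ((q + 1) * (q - 1)))"
    unfolding q_diffs by (simp only: mult_ac)
  finally have cG: "card (- W \<inter> G) \<le> q\<^sup>2 * ((q + 1) * (q - 1))"
    using q_gt_1 by simp
  have "(\<Sum>x\<in>-W. n x) \<le> card (- W \<inter> G) * q + card (- W - G) * t"
    by (rule sum_two_values_le) (use n_full[OF full] in \<open>auto simp: G_def\<close>)
  also have "\<dots> = card (- W \<inter> G) * (q - t) + card (- W) * t"
  proof -
    have "card (- W) = card (- W \<inter> G) + card (- W - G)"
      using card_Un_disjoint[of "- W \<inter> G" "- W - G"] by (simp add: Int_Diff_disjoint Int_Diff_Un)
    moreover have "g * k + d * t = g * (k - t) + (g + d) * t" if "t \<le> k" for g d k :: nat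
      using that by (auto simp: le_iff_add algebra_simps)
    moreover have "t \<le> q" using t_ge_2 by (simp add: power2_eq_square)
    ultimately show ?thesis by simp
  qed
  also have "\<dots> \<le> q\<^sup>2 * ((q + 1) * (q - 1)) * (q - t) + card (- W) * t"
    by (intro add_le_mono mult_le_mono1 cG order_refl)
  also note card_compl_W_factored
  also have "q\<^sup>2 * ((q + 1) * (q - 1)) * (q - t) + q\<^sup>2 * ((q\<^sup>2 + q + 1) * (q - 1)) * t =
      q\<^sup>2 * ((t * (q\<^sup>2 + q + 1) + (q - t) * (q + 1)) * (q - 1))"
    by (simp only: add_mult_distrib distrib_left mult_ac)
  finally show "(\<Sum>x\<in>-W. n x) \<le> q\<^sup>2 * ((t * (q\<^sup>2 + q + 1) + (q - t) * (q + 1)) * (q - 1))" .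
qed

text \<open>The fixed line now meets the variety only in \<open>p\<close>. Of the q + 1 planes
  through it inside the common tangent hyperplane \<open>T\<close>, at least one has no further
  point and the others have at most q each. In the q^2 planes outside \<open>T\<close> the point of
  \<open>r x\<close> is nonisotropic, which leaves at most t + 1.\<close>

lemma card_pts_Z_le_same_tangent:
  assumes same: "\<And>x. B x p = 0 \<longleftrightarrow> h x p = 0" and nz: "h e e \<noteq> 0"
  shows "card (pts Z) \<le> 1 + (q\<^sup>2 + (t + 1) * q\<^sup>2)"
proof (rule pts_Z_le)
  have hp: "h p p = 0" "h e p = 0" "h p e = 0"
    using same[of p] same[of e] h_eq_0_sym[of p e] B_pe by (auto simp: B_self F_p B_sym[of e p])
  have "Z \<inter> W \<subseteq> vec.span {p}"
  proof
    fix w assume "w \<in> Z \<inter> W"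
    then obtain a b where w: "w = a *s p + b *s e" "h w w = 0" by (auto simp: W_iff Z_def)
    then have "b = 0" using nz hp by (auto simp: h_simps)
    then show "w \<in> vec.span {p}" using w by (auto simp: vec.span_singleton)
  qed
  then have "Z \<inter> W - {0} \<subseteq> vec.span {p} - {0}" by blast
  then have "card (Z \<inter> W - {0}) \<le> card (vec.span {p} - {0})" by (intro card_mono) auto
  also have "\<dots> = q - 1"
    using card_span_independent[of "{p}"] p_nz vec.span_zero[of "{p}"] by (simp add: card_K)
  finally show "card (Z \<inter> W - {0}) \<le> 1 * (q - 1)" by simp
  define T where "T = perp {p}"
  define T0 where "T0 = {x\<in>T. B x e = 0}"
  have TB: "x \<in> T \<longleftrightarrow> B x p = 0" for x using same by (simp add: T_def perp_def)
  have cT: "card T = q ^ 4"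
    using card_subspace[OF subspace_perp, of "{p}"] dim_perp_1[OF p_nz] by (simp add: card_K T_def)
  have "q ^ 4 \<le> q * card T0"
    using card_kernel_ge[OF subspace_perp functional_B, of "{p}" e] cT by (simp only: T_def T0_def card_K)
  then have cT0: "q ^ 3 \<le> card T0" by (rule power_cancel[OF q_pos])
  have "n x \<le> (if x \<in> T0 then 0 else if x \<in> T then q else t + 1)" if x: "x \<in> - W" for x
  proof (cases "r x = 0")
    case True
    then show ?thesis using n_eq_0_of_r_eq_0 x by simp
  next
    case False
    then obtain w where w: "w \<in> W" "F (x + w) = 0"
        "n x \<le> card {c. h ((x + w) + c *s r x) ((x + w) + c *s r x) = 0}"
      by (rule n_le_line)
    have "x \<notin> T0" using False by (auto simp: T0_def TB r_eq_0_iff)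
    moreover have "n x \<le> q" using w(3) card_line(4)[of "x + w" "r x"] by linarith
    moreover have "n x \<le> t + 1" if "x \<notin> T"
    proof -
      have "h (r x) (r x) \<noteq> 0" using that nz hp by (simp add: TB r_def h_simps)
      then show ?thesis using w(3) card_line(1)[of "r x" "x + w"] by linarith
    qed
    ultimately show ?thesis by simp
  qed
  then have "(\<Sum>x\<in>-W. n x) \<le> (\<Sum>x\<in>-W. if x \<in> T0 then 0 else if x \<in> T then q else t + 1)"
    by (rule sum_mono)
  also have "\<dots> \<le> (\<Sum>x\<in>UNIV. if x \<in> T0 then 0 else if x \<in> T then q else t + 1)"
    by (rule sum_mono2) auto
  also have "\<dots> = (\<Sum>x\<in>UNIV. (if x \<in> T - T0 then q else 0) + (if x \<in> - T then t + 1 else 0))"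
    by (rule sum.cong) (auto simp: T0_def)
  also have "\<dots> = card (T - T0) * q + card (- T) * (t + 1)"
    by (simp add: sum.distrib sum.If_cases set_diff_eq Compl_eq)
  also have "card (T - T0) = q ^ 4 - card T0"
    using cT by (subst card_Diff_subset) (auto simp: T0_def)
  also have "card (- T) = q ^ 5 - q ^ 4"
    using cT by (simp add: card_Diff_subset card_K Compl_eq_Diff_UNIV)
  also have "(q ^ 4 - card T0) * q + (q ^ 5 - q ^ 4) * (t + 1) \<le> (q ^ 4 - q ^ 3) * q + (q ^ 5 - q ^ 4) * (t + 1)"
    using cT0 by (intro add_mono mult_mono) auto
  also have "\<dots> = q\<^sup>2 * ((q\<^sup>2 + (t + 1) * q\<^sup>2) * (q - 1))"
  proof -
    have "k ^ 3 * u * k + k ^ 4 * u * (t + 1) = k\<^sup>2 * ((k\<^sup>2 + (t + 1) * k\<^sup>2) * u)" for k u :: nat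
      by (simp add: eval_nat_numeral algebra_simps)
    then show ?thesis unfolding q_diffs .
  qed
  finally show "(\<Sum>x\<in>-W. n x) \<le> q\<^sup>2 * ((q\<^sup>2 + (t + 1) * q\<^sup>2) * (q - 1))" .
qed

end

section \<open>Coinciding tangent hyperplanes and existence of lines\<close>

lemma functional_eq_mult:
  fixes f g :: "'a::field ^ 'n \<Rightarrow> 'a"
  assumes f: "functional f" and g: "functional g" and ker: "\<And>x. g x = 0 \<Longrightarrow> f x = 0" and nz: "g x0 \<noteq> 0"
  shows "\<exists>c. \<forall>x. f x = c * g x"
proof (intro exI allI)
  fix x
  have "g (x - (g x / g x0) *s x0) = 0" using nz g by (simp add: functional_simps)
  then have "f (x - (g x / g x0) *s x0) = 0" by (rule ker)
  then show "f x = (f x0 / g x0) * g x" using nz f by (simp add: functional_simps)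
qed

text \<open>If all zeros of \<open>F\<close> in the common tangent hyperplane at \<open>p\<close> were isotropic, the conic
  \<open>\<gamma>\<close> obtained by projecting from \<open>p\<close> would lie on a hermitian curve.  Since no two of its points
  are conjugate, the hermitian form on it is \<open>(A c - (A c)\<^sup>t) (c - c\<^sup>t)\<close>, which has too few roots.\<close>

lemma (in singular_line) same_tangent_contradiction:
  assumes full: "W \<subseteq> Z" and same: "\<And>x. B x p = 0 \<longleftrightarrow> h x p = 0"
    and all_iso: "\<And>y. B y p = 0 \<Longrightarrow> F y = 0 \<Longrightarrow> h y y = 0"
    and no_vertex: "\<And>s. s \<in> W \<Longrightarrow> s \<noteq> 0 \<Longrightarrow> \<exists>x. B x s \<noteq> 0"
  shows False
proof -
  have cT: "card {x. B x p = 0} = q ^ 4"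
  proof -
    have "{x. B x p = 0} = perp {p}" using same by (auto simp: perp_def)
    then show ?thesis
      using card_subspace[OF subspace_perp, of "{p}"] dim_perp_1[OF p_nz] by (simp add: card_K)
  qed
  have sT: "vec.subspace {x. B x p = 0}"
    using subspace_kernel[OF vec.subspace_UNIV functional_B, of p] by simp
  obtain x0 where x0: "B x0 p \<noteq> 0" using no_vertex[OF p_in_W p_nz] by blast
  \<comment> \<open>Otherwise the functional of \<open>e\<close> would be a multiple of that of
    \<open>p\<close>, and a combination of the two would be a vertex on the line.\<close>
  have "\<exists>u. B u p = 0 \<and> B u e \<noteq> 0"
  proof (rule ccontr)
    assume "\<not> ?thesis"
    then have "\<And>x. B x p = 0 \<Longrightarrow> B x e = 0" by blast
    then obtain c where c: "\<forall>x. B x e = c * B x p"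
      using functional_eq_mult[OF functional_B functional_B, of p e x0] x0 by blast
    then have "\<forall>x. B x (e - c *s p) = 0" by (simp add: B_simps)
    moreover have "e - c *s p \<in> W"
      by (intro vec.subspace_diff vec.subspace_scale subspace_W e_in_W p_in_W)
    moreover have "e - c *s p \<noteq> 0" using e_notin by (auto simp: vec.span_singleton)
    ultimately show False using no_vertex by blast
  qed
  then obtain u0 where u0: "B u0 p = 0" "B u0 e \<noteq> 0" by blast
  define u where "u = (1 / B u0 e) *s u0"
  have u: "B u p = 0" "B u e = 1" using u0 by (simp_all add: u_def B_simps)
  \<comment> \<open>The correction by \<open>e\<close> makes \<open>f\<close> singular, so that
    \<open>e\<close> and \<open>f\<close> form a hyperbolic pair in the tangent hyperplane at
    \<open>p\<close>.\<close>
  define f where "f = u - F u *s e"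
  have f_alt: "f = 1 *s u + (- F u) *s e" by (simp add: f_def vec_eq_iff)
  have Fe2: "F f = 0" unfolding f_alt F_pair by (simp add: F_e u)
  have Bep: "B e p = 0" using B_pe B_sym by metis
  have Bf: "B f p = 0" "B f e = 1" "B e f = 1" "B p f = 0" "B f f = 0" "B e e = 0" "B p p = 0"
    using u Bep B_sym[of e f] B_sym[of p f] Fe2
    by (simp_all add: f_def B_simps B_self F_e F_p B_sym[of e u])
  have "card {x\<in>{x. B x p = 0}. B x e = 0} = q ^ 3"
  proof -
    have "q ^ 4 = q * card {x\<in>{x. B x p = 0}. B x e = 0}"
      using card_kernel[OF sT functional_B, of u e] u unfolding cT card_K by simp
    then show ?thesis by (rule power_cancel(5)[OF q_pos, symmetric])
  qed
  moreover have "q\<^sup>2 < q ^ 3" using q_gt_1 by (intro power_strict_increasing) auto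
  ultimately have "\<not> {x\<in>{x. B x p = 0}. B x e = 0} \<subseteq> W"
    using card_mono[of W "{x\<in>{x. B x p = 0}. B x e = 0}"] card_W by (metis finite leD)
  then obtain w0 where w0: "B w0 p = 0" "B w0 e = 0" "w0 \<notin> W" by blast
  \<comment> \<open>Removing the component along \<open>e\<close> makes \<open>w\<close> orthogonal
    to \<open>e\<close> and \<open>f\<close>; \<open>F_outside\<close> will show that it is not
    singular.\<close>
  define w where "w = w0 - B w0 f *s e"
  have "w0 = w + B w0 f *s e" by (simp add: w_def)
  then have "w \<notin> W"
    using w0(3) vec.subspace_add[OF subspace_W _ vec.subspace_scale[OF subspace_W e_in_W]] by metis
  have Bw: "B w p = 0" "B w e = 0" "B w f = 0"
    using w0 Bep Bf by (simp_all add: w_def B_simps)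
  define g where "g = - F w"
  have g: "g \<noteq> 0" using F_outside[OF \<open>w \<notin> W\<close>] Bw by (simp add: g_def)
  \<comment> \<open>The zeros of \<open>F\<close> in the plane of \<open>e\<close>,
    \<open>f\<close>, \<open>w\<close> other than \<open>e\<close>, normalised to have coefficient 1
    at \<open>f\<close>; the point \<open>f\<close> itself is \<open>c = 0\<close>.\<close>
  define \<gamma> where "\<gamma> = (\<lambda>c. (g * c\<^sup>2) *s e + (f + c *s w))"
  have B\<gamma>: "B (\<gamma> c) p = 0" "B (\<gamma> c) e = 1" "B (\<gamma> c) f = g * c\<^sup>2" for c
    using Bf Bw Bep by (simp_all add: \<gamma>_def B_simps)
  have F\<gamma>: "F (\<gamma> c) = 0" for c
  proof -
    have e1: "F (f + c *s w) = c\<^sup>2 * F w"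
      using Fe2 Bw B_sym[of f w] by (simp add: polar homog B_simps)
    have e2: "B ((g * c\<^sup>2) *s e) (f + c *s w) = g * c\<^sup>2"
      using Bf Bw B_sym[of e w] by (simp add: B_simps)
    have "F (\<gamma> c) = (g * c\<^sup>2)\<^sup>2 * F e + c\<^sup>2 * F w + g * c\<^sup>2"
      unfolding \<gamma>_def polar[of "(g * c\<^sup>2) *s e"] e1 e2 homog ..
    then show ?thesis by (simp add: F_e g_def algebra_simps)
  qed
  have iso: "h (\<gamma> c) (\<gamma> c) = 0" "h f f = 0" "h e e = 0" "h p p = 0" for c
    using all_iso[OF B\<gamma>(1) F\<gamma>] all_iso[OF Bf(1) Fe2] all_iso[OF Bep F_e] all_iso[OF Bf(7) F_p] by auto
  have hp: "h (\<gamma> c) p = 0" "h f p = 0" "h e p = 0" for c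
    using same B\<gamma>(1) Bf(1) Bep by auto
  have span_B: "B x e = 0" if "x \<in> vec.span {e, p}" for x
    using that Bf B_pe by (auto simp: span_pair_iff B_simps)
  \<comment> \<open>Two conjugate points of the conic would span a totally isotropic plane together
    with \<open>p\<close>.\<close>
  have hef: "h f e \<noteq> 0"
    using no_isotropic_plane[OF p_nz e_notin, of f] iso hp span_B[of f] Bf by auto
  have h\<gamma>e: "h (\<gamma> c) e \<noteq> 0" for c
    using no_isotropic_plane[OF p_nz e_notin, of "\<gamma> c"] iso hp span_B[of "\<gamma> c"] B\<gamma> by auto
  have h\<gamma>f: "h (\<gamma> c) f \<noteq> 0" if "c \<noteq> 0" for c
  proof
    assume 0: "h (\<gamma> c) f = 0"
    have "f \<notin> vec.span {p}" using Bf(2) B_pe by (auto simp: vec.span_singleton B_simps)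
    moreover have "\<gamma> c \<notin> vec.span {f, p}"
    proof
      assume "\<gamma> c \<in> vec.span {f, p}"
      then have "B (\<gamma> c) f = 0" using Bf by (auto simp: span_pair_iff B_simps)
      then show False using B\<gamma>(3) g that by simp
    qed
    ultimately show False
      using no_isotropic_plane[OF p_nz, of f "\<gamma> c"] iso hp 0 by blast
  qed
  have hwe: "h w e = 0"
  proof (rule ccontr)
    assume nz: "h w e \<noteq> 0"
    \<comment> \<open>As a function of c, \<open>h (\<gamma> c) e\<close> is affine with slope
      \<open>h w e\<close>, and this is its root.\<close>
    have "h (\<gamma> (- h f e / h w e)) e = 0" using nz iso by (simp add: \<gamma>_def h_simps)
    then show False using h\<gamma>e by blast
  qed
  have hef': "h e f \<noteq> 0" using hef h_eq_0_sym by metis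
  define A where "A = g * h e f"
  have A: "A \<noteq> 0" using g hef' by (simp add: A_def)
  have hwf: "h w f = 0"
  proof (rule ccontr)
    assume nz: "h w f \<noteq> 0"
    define c where "c = - h w f / A"
    have "h (\<gamma> c) f = c * (A * c + h w f)" using iso
      by (simp add: \<gamma>_def h_simps A_def power2_eq_square algebra_simps)
    also have "\<dots> = 0" using A by (simp add: c_def)
    finally have "h (\<gamma> c) f = 0" .
    moreover have "c \<noteq> 0" using nz A by (simp add: c_def)
    ultimately show False using h\<gamma>f by blast
  qed
  have "h e w = 0" "h f w = 0" "h f e = h e f ^ t"
    using hwe hwf h_eq_0_sym h_sym by metis+
  then have expand: "A * c\<^sup>2 + A ^ t * (c ^ t)\<^sup>2 + h w w * (c * c ^ t) = 0" for c
    using iso(1)[of c] iso hwe hwf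
    by (simp add: \<gamma>_def h_simps A_def power_mult_distrib algebra_simps power2_eq_square)
  have hww: "h w w = - (A + A ^ t)"
    using expand[of 1] by (simp add: add_eq_0_iff2)
  have "(A * c - A ^ t * c ^ t) * (c - c ^ t) = A * c\<^sup>2 + A ^ t * (c ^ t)\<^sup>2 + h w w * (c * c ^ t)" for c
    unfolding hww by (simp add: algebra_simps power2_eq_square)
  then have "(A * c - A ^ t * c ^ t) * (c - c ^ t) = 0" for c
    by (simp only: expand)
  then have cover: "(A * c) ^ t = A * c \<or> c ^ t = c" for c
    by (metis eq_iff_diff_eq_0 mult_eq_0_iff power_mult_distrib)
  let ?S = "{d::'a. d ^ t = d}"
  \<comment> \<open>The two alternatives in \<open>cover\<close> allow at most 2 (t - 1) nonzero
    values of c, fewer than t^2 - 1.\<close>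
  have "(UNIV - {0::'a}) \<subseteq> (\<lambda>d. d / A) ` (?S - {0}) \<union> (?S - {0})"
  proof
    fix c :: 'a assume "c \<in> UNIV - {0}"
    then show "c \<in> (\<lambda>d. d / A) ` (?S - {0}) \<union> (?S - {0})"
      using cover[of c] A by (auto intro!: image_eqI[of _ _ "A * c"])
  qed
  then have "card (UNIV - {0::'a}) \<le> card ((\<lambda>d. d / A) ` (?S - {0}) \<union> (?S - {0}))"
    by (intro card_mono) auto
  also have "\<dots> \<le> card ((\<lambda>d. d / A) ` (?S - {0})) + card (?S - {0})" by (rule card_Un_le)
  also have "\<dots> \<le> card (?S - {0}) + card (?S - {0})" by (intro add_mono card_image_le) auto
  also have "card (?S - {0}) = card ?S - 1" by simp
  also have "\<dots> \<le> t - 1" using card_fixed by simp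
  finally have "q - 1 \<le> (t - 1) + (t - 1)" using card_fixed by (simp add: card_K)
  moreover have "2 * t \<le> q" using t_ge_2 by (simp add: power2_eq_square)
  ultimately show False using t_ge_2 by linarith
qed

section \<open>Existence of singular vectors and singular lines\<close>

context quadric
begin

lemma card_squares: "CARD('a) + 1 \<le> 2 * card (range (\<lambda>x::'a. x\<^sup>2))"
proof -
  let ?R = "range (\<lambda>x::'a. x\<^sup>2)"
  have "card (UNIV - {0::'a}) = card (\<Union>y\<in>?R - {0}. {x. x\<^sup>2 = y})"
    by (rule arg_cong[where f = card]) auto
  also have "\<dots> \<le> (\<Sum>y\<in>?R - {0}. card {x. x\<^sup>2 = y})" by (rule card_UN_le) simp
  also have "\<dots> \<le> (\<Sum>y\<in>?R - {0}. 2)" by (rule sum_mono) (rule card_power_eq_le, simp)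
  also have "\<dots> = 2 * (card ?R - 1)"
  proof -
    have "0 \<in> ?R" by (rule range_eqI[of _ _ 0]) simp
    then show ?thesis by simp
  qed
  finally have "CARD('a) - 1 \<le> 2 * (card ?R - 1)" by simp
  moreover have "card ?R > 0" by (simp add: card_gt_0_iff)
  ultimately show ?thesis using card_field_gt_1[where ?'a = 'a] by linarith
qed

text \<open>The values of a x^2 and those of - c - b y^2 each fill more than half of the field, so
  they have one in common.\<close>

lemma ex_sum_squares:
  fixes a b c :: 'a
  assumes "a \<noteq> 0" "b \<noteq> 0"
  shows "\<exists>x y. a * x\<^sup>2 + b * y\<^sup>2 + c = 0"
proof (rule ccontr)
  assume no: "\<not> ?thesis"
  let ?R = "range (\<lambda>x::'a. x\<^sup>2)"
  let ?S = "(\<lambda>x. a * x) ` ?R" and ?T = "(\<lambda>y. - c - b * y) ` ?R"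
  have "?S \<inter> ?T = {}"
  proof (rule ccontr)
    assume "?S \<inter> ?T \<noteq> {}"
    then obtain x y where "a * x\<^sup>2 = - c - b * y\<^sup>2" by auto
    then have "a * x\<^sup>2 + b * y\<^sup>2 + c = 0" by simp
    then show False using no by blast
  qed
  then have "card ?S + card ?T = card (?S \<union> ?T)" by (intro card_Un_disjoint[symmetric]) auto
  also have "\<dots> \<le> CARD('a)" by (rule card_mono) auto
  finally have "card ?S + card ?T \<le> CARD('a)" .
  moreover have "card ?S = card ?R" "card ?T = card ?R"
    using assms by (auto intro!: card_image inj_onI)
  ultimately show False using card_squares by linarith
qed

lemma square_surj_char2:
  assumes "(2::'a) = 0"
  shows "\<exists>x::'a. x\<^sup>2 = y"
proof -
  have "inj (\<lambda>x::'a. x\<^sup>2)"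
  proof (rule injI)
    fix x y :: 'a assume "x\<^sup>2 = y\<^sup>2"
    then have "(x - y)\<^sup>2 = 2 * (y * y - x * y)" by (simp add: power2_eq_square algebra_simps)
    then show "x = y" using assms by simp
  qed
  then have "surj (\<lambda>x::'a. x\<^sup>2)" by (simp add: finite_UNIV_inj_surj)
  then show ?thesis by (metis surjD)
qed

text \<open>In odd characteristic three mutually orthogonal vectors reduce the claim to
  \<open>ex_sum_squares\<close>. In characteristic 2 every scalar is a square, and two independent
  orthogonal vectors suffice.\<close>

lemma ex_singular:
  assumes V: "vec.subspace V" and card: "q ^ 3 \<le> card V"
  shows "\<exists>x\<in>V. x \<noteq> 0 \<and> F x = 0"
proof (rule ccontr)
  assume "\<not> ?thesis"
  then have aniso: "F x \<noteq> 0" if "x \<in> V" "x \<noteq> 0" for x using that by blast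
  define V1 where "V1 = (\<lambda>u. {x\<in>V. B x u = 0})"
  have V1: "vec.subspace (V1 u)" "q\<^sup>2 \<le> card (V1 u)" for u
  proof -
    show "vec.subspace (V1 u)" unfolding V1_def by (rule subspace_kernel[OF V functional_B])
    have "q ^ 3 \<le> q * card (V1 u)"
      using card_kernel_ge[OF V functional_B, of u] card unfolding V1_def card_K by (rule order_trans[rotated])
    then show "q\<^sup>2 \<le> card (V1 u)" by (rule power_cancel[OF q_pos])
  qed
  have gt: "q < q\<^sup>2" using power_strict_increasing[of 1 2 q] q_gt_1 by simp
  have "1 < card V" using card q_gt_1 one_less_power[of q 3] by linarith
  then have "\<not> V \<subseteq> {0}" using card_mono[of "{0}" V] by auto
  then obtain u where u: "u \<in> V" "u \<noteq> 0" by blast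
  show False
  proof (cases "(2::'a) = 0")
    case True
    \<comment> \<open>In characteristic 2 the vector \<open>u\<close> is orthogonal to itself, so
      \<open>y\<close> has to be chosen off its span.\<close>
    have "\<not> V1 u \<subseteq> vec.span {u}"
      using card_mono[of "vec.span {u}" "V1 u"] V1(2)[of u] gt card_span_independent[of "{u}"] u
      by (auto simp: card_K)
    then obtain y where y: "y \<in> V1 u" "y \<notin> vec.span {u}" by blast
    obtain c where c: "c\<^sup>2 = F y / F u" using square_surj_char2[OF True] by blast
    have "F (1 *s y + c *s u) = 2 * F y"
      unfolding F_pair using c aniso[OF u] y(1) by (simp add: V1_def)
    then have "F (y + c *s u) = 0" using True by simp
    moreover have "y + c *s u \<in> V"
      using y u V by (auto simp: V1_def intro: vec.subspace_add vec.subspace_scale)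
    moreover have "y + c *s u \<noteq> 0"
    proof
      assume "y + c *s u = 0"
      then have "y = (- c) *s u" by (simp add: eq_neg_iff_add_eq_0)
      then have "y \<in> range (\<lambda>k. k *s u)" by (rule range_eqI)
      then show False using y(2) by (simp add: vec.span_singleton)
    qed
    ultimately show False using aniso by blast
  next
    case False
    have "1 < card (V1 u)" using V1(2)[of u] gt q_gt_1 by linarith
    then have "\<not> V1 u \<subseteq> {0}" using card_mono[of "{0}" "V1 u"] by auto
    then obtain v where v: "v \<in> V1 u" "v \<noteq> 0" by blast
    define V2 where "V2 = {x\<in>V1 u. B x v = 0}"
    have "q\<^sup>2 \<le> q * card V2"
      using card_kernel_ge[OF V1(1) functional_B, of u v] V1(2)[of u] unfolding V2_def card_K
      by (rule order_trans[rotated])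
    then have "q \<le> card V2" by (rule power_cancel[OF q_pos])
    then have "1 < card V2" using q_gt_1 by linarith
    then have "\<not> V2 \<subseteq> {0}" using card_mono[of "{0}" V2] by auto
    then obtain w where w: "w \<in> V2" "w \<noteq> 0" by blast
    have in_V: "v \<in> V" "w \<in> V" and B0: "B v u = 0" "B w u = 0" "B w v = 0" "B u w = 0" "B v w = 0"
      using v w B_sym by (auto simp: V1_def V2_def)
    obtain x y where xy: "F u * x\<^sup>2 + F v * y\<^sup>2 + F w = 0"
      using ex_sum_squares aniso u v in_V by metis
    define z where "z = (x *s u + y *s v) + w"
    have "F z = 0"
      using xy B0 B_sym[of u v] by (simp add: z_def polar homog B_simps algebra_simps)
    moreover have "z \<in> V"
      using u in_V V by (auto simp: z_def intro!: vec.subspace_add vec.subspace_scale)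
    moreover have "z \<noteq> 0"
    proof
      assume "z = 0"
      then have "B z w = 0" by simp
      then have "2 * F w = 0" using B0 by (simp add: z_def B_simps B_self)
      then show False using aniso[OF in_V(2) w(2)] False by simp
    qed
    ultimately show False using aniso by blast
  qed
qed

lemma ex_singular_line:
  obtains p e where "p \<noteq> 0" "e \<notin> vec.span {p}" "F p = 0" "F e = 0" "B p e = 0"
proof -
  have "q ^ 3 \<le> card (UNIV :: ('a ^ 5) set)"
    using power_increasing[of 3 5 q] q_gt_1 by (simp add: card_K)
  then obtain p where p: "p \<noteq> 0" "F p = 0" using ex_singular[OF vec.subspace_UNIV] by blast
  \<comment> \<open>The vector \<open>a\<close> serves only as a functional that is nonzero at
    \<open>p\<close>: its kernel in the tangent hyperplane \<open>T\<close> is a complement of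
    \<open>p\<close>, and a singular vector found there is independent of \<open>p\<close>.\<close>
  have "\<exists>a. h p a \<noteq> 0" using h_nondegenerate[of p] h_eq_0_sym p(1) by metis
  then obtain a where a: "h p a \<noteq> 0" by blast
  define T where "T = {x\<in>UNIV. B x p = 0}"
  have T: "vec.subspace T" unfolding T_def by (rule subspace_kernel[OF vec.subspace_UNIV functional_B])
  have "p \<in> T" using p by (simp add: T_def B_self)
  define V where "V = {x\<in>T. h x a = 0}"
  have V: "vec.subspace V" unfolding V_def by (rule subspace_kernel[OF T functional_h])
  have "card (UNIV :: ('a ^ 5) set) = q ^ 5" by (simp add: card_K)
  then have "q ^ 5 \<le> q * card T"
    using card_kernel_ge[OF vec.subspace_UNIV functional_B, of p] by (simp only: T_def card_K)
  also have "card T = q * card V"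
    using card_kernel[OF T functional_h \<open>p \<in> T\<close> a] unfolding V_def card_K .
  finally have "q ^ 3 \<le> card V" by (rule power_cancel[OF q_pos])
  then obtain e where e: "e \<in> V" "e \<noteq> 0" "F e = 0" using ex_singular[OF V] by blast
  have "e \<notin> vec.span {p}"
  proof
    assume "e \<in> vec.span {p}"
    then obtain c where "e = c *s p" by (auto simp: vec.span_singleton)
    then show False using e a by (auto simp: V_def h_simps)
  qed
  then show thesis using that[of p e] p e B_sym by (auto simp: V_def T_def)
qed

end

section \<open>Arbitrary quadrics\<close>

text \<open>Expanded, every left-hand side has leading term t^5; the rest is absorbed by repeated
  use of 2 t^k \<le> t^(k+1). The fourth bound equals the second, as t \<le> t^2 makes the truncated
  difference exact.\<close>

lemma bounds_less:
  fixes t :: nat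
  assumes "t \<ge> 2"
  shows "(t + 1) + (t + 1) * ((t\<^sup>2)\<^sup>2 + t\<^sup>2 + 1) < 2 * t ^ 5 + t ^ 2 + 1"
    and "(t\<^sup>2 + 1) + ((t\<^sup>2 + 1) * t\<^sup>2 + (t\<^sup>2)\<^sup>2 * t) < 2 * t ^ 5 + t ^ 2 + 1"
    and "1 + ((t\<^sup>2)\<^sup>2 + (t + 1) * (t\<^sup>2)\<^sup>2) < 2 * t ^ 5 + t ^ 2 + 1"
    and "(t\<^sup>2 + 1) + (t * ((t\<^sup>2)\<^sup>2 + t\<^sup>2 + 1) + (t\<^sup>2 - t) * (t\<^sup>2 + 1)) < 2 * t ^ 5 + t ^ 2 + 1"
    and "(t\<^sup>2 + 1) * (t ^ 3 + t ^ 2 + 1) < 2 * t ^ 5 + t ^ 2 + 1"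
proof -
  have "2 * t ^ k \<le> t ^ (k + 1)" for k
    using assms by simp
  from this[of 1] this[of 2] this[of 3] this[of 4]
  have p: "2 * t \<le> t ^ 2" "2 * t ^ 2 \<le> t ^ 3" "2 * t ^ 3 \<le> t ^ 4" "2 * t ^ 4 \<le> t ^ 5"
    using assms by (simp_all add: power2_eq_square)
  have "(t + 1) + (t + 1) * ((t\<^sup>2)\<^sup>2 + t\<^sup>2 + 1) = t ^ 5 + t ^ 4 + t ^ 3 + t ^ 2 + 2 * t + 2"
    by (simp add: eval_nat_numeral algebra_simps)
  then show "(t + 1) + (t + 1) * ((t\<^sup>2)\<^sup>2 + t\<^sup>2 + 1) < 2 * t ^ 5 + t ^ 2 + 1"
    using p assms by linarith
  have 2: "(t\<^sup>2 + 1) + ((t\<^sup>2 + 1) * t\<^sup>2 + (t\<^sup>2)\<^sup>2 * t) = t ^ 5 + t ^ 4 + 2 * t ^ 2 + 1"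
    by (simp add: eval_nat_numeral algebra_simps)
  then show "(t\<^sup>2 + 1) + ((t\<^sup>2 + 1) * t\<^sup>2 + (t\<^sup>2)\<^sup>2 * t) < 2 * t ^ 5 + t ^ 2 + 1"
    using p assms by linarith
  have "1 + ((t\<^sup>2)\<^sup>2 + (t + 1) * (t\<^sup>2)\<^sup>2) = t ^ 5 + 2 * t ^ 4 + 1"
    by (simp add: eval_nat_numeral algebra_simps)
  then show "1 + ((t\<^sup>2)\<^sup>2 + (t + 1) * (t\<^sup>2)\<^sup>2) < 2 * t ^ 5 + t ^ 2 + 1"
    using p assms by linarith
  have "(k + 1) + (s * (k\<^sup>2 + k + 1) + (k - s) * (k + 1)) = (k + 1) + ((k + 1) * k + k\<^sup>2 * s)"
    if le: "s \<le> k" for s k :: nat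
  proof -
    obtain d where "k = s + d" using le by (auto simp: le_iff_add)
    then show ?thesis by (simp add: power2_eq_square algebra_simps)
  qed
  from this[of t "t\<^sup>2"] have "(t\<^sup>2 + 1) + (t * ((t\<^sup>2)\<^sup>2 + t\<^sup>2 + 1) + (t\<^sup>2 - t) * (t\<^sup>2 + 1)) =
      (t\<^sup>2 + 1) + ((t\<^sup>2 + 1) * t\<^sup>2 + (t\<^sup>2)\<^sup>2 * t)"
    using p(1) by linarith
  then show "(t\<^sup>2 + 1) + (t * ((t\<^sup>2)\<^sup>2 + t\<^sup>2 + 1) + (t\<^sup>2 - t) * (t\<^sup>2 + 1)) < 2 * t ^ 5 + t ^ 2 + 1"
    using 2 p assms by linarith
  have "(t\<^sup>2 + 1) * (t ^ 3 + t ^ 2 + 1) = t ^ 5 + t ^ 4 + t ^ 3 + 2 * t ^ 2 + 1"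
    by (simp add: eval_nat_numeral algebra_simps)
  then show "(t\<^sup>2 + 1) * (t ^ 3 + t ^ 2 + 1) < 2 * t ^ 5 + t ^ 2 + 1"
    using p assms by linarith
qed

lemma (in planeless_quadric) card_Z_less: "card (pts Z) < 2 * t ^ 5 + t ^ 2 + 1"
proof -
  show ?thesis
  proof (cases "\<forall>V. vec.subspace V \<longrightarrow> vec.dim V = 2 \<longrightarrow> \<not> V \<subseteq> Z")
    case True
    obtain p e where pe: "p \<noteq> 0" "e \<notin> vec.span {p}" "F p = 0" "F e = 0" "B p e = 0"
      by (rule ex_singular_line)
    interpret line: singular_line t K F B p e
      by unfold_locales (use pe in auto)
    have "card (pts Z) \<le> (t + 1) + (t + 1) * (q\<^sup>2 + q + 1)"
      by (rule line.card_pts_Z_le_no_full_line) (use True in simp)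
    also have "\<dots> < 2 * t ^ 5 + t ^ 2 + 1"
      by (rule bounds_less[OF t_ge_2])
    finally show ?thesis .
  next
    case False
    then obtain V where V: "vec.subspace V" "vec.dim V = 2" "V \<subseteq> Z" by blast
    have line: "\<exists>e. singular_line t F B v e \<and> vec.span {e, v} = V" if v: "v \<in> V" "v \<noteq> 0" for v
    proof -
      have "vec.dim (vec.span {v}) = 1" using v by simp
      then have "\<not> V \<subseteq> vec.span {v}" using vec.dim_subset[of V "vec.span {v}"] V(2) by auto
      then obtain e where e: "e \<in> V" "e \<notin> vec.span {v}" by blast
      have "v + e \<in> V" using v e V(1) by (simp add: vec.subspace_add)
      then have "F v = 0" "F e = 0" "F (v + e) = 0" using v e V(3) by (auto simp: Z_def)
      then have B0: "B v e = 0" using polar[of v e] by simp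
      have "singular_line t F B v e"
        by unfold_locales (use v e V(3) B0 in \<open>auto simp: Z_def\<close>)
      moreover have "vec.span {e, v} = V"
      proof (rule subspace_eqI)
        show "vec.span {e, v} \<subseteq> V" by (rule vec.span_minimal) (use e v V(1) in auto)
        show "vec.dim (vec.span {e, v}) = vec.dim V"
          using v e vec.dim_insert[of e "{v}"] V(2) by (simp del: vec.span_singleton)
      qed (use V(1) in auto)
      ultimately show ?thesis by blast
    qed
    have "V \<noteq> {0}" using V(2) by auto
    then obtain v0 where v0: "v0 \<in> V" "v0 \<noteq> 0" using V(1) vec.subspace_0 by blast
    \<comment> \<open>The shared line carries a vertex of the quadric; or it carries none, but a
      point where both tangent hyperplanes coincide; or neither.\<close>
    consider (vertex) v where "v \<in> V" "v \<noteq> 0" "\<And>x. B x v = 0"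
      | (bad) v where "v \<in> V" "v \<noteq> 0" "\<And>x. B x v = 0 \<longleftrightarrow> h x v = 0"
          "\<And>w. w \<in> V \<Longrightarrow> w \<noteq> 0 \<Longrightarrow> \<exists>x. B x w \<noteq> 0"
      | (good) "\<And>v. v \<in> V \<Longrightarrow> v \<noteq> 0 \<Longrightarrow> \<exists>x. B x v \<noteq> 0"
          "\<And>v. v \<in> V \<Longrightarrow> v \<noteq> 0 \<Longrightarrow> \<not> (\<forall>x. B x v = 0 \<longleftrightarrow> h x v = 0)"
      by blast
    then show ?thesis
    proof cases
      case vertex
      obtain e where e: "singular_line t F B v e" "vec.span {e, v} = V" using line vertex by blast
      interpret line: singular_line t K F B v e by (rule e(1))
      have "card (pts Z) \<le> (q + 1) + ((q + 1) * q + q\<^sup>2 * t)"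
        using line.card_pts_Z_le_vertex vertex(3) V(3) e(2) by (simp only: line.W_def)
      also have "\<dots> < 2 * t ^ 5 + t ^ 2 + 1"
        by (rule bounds_less[OF t_ge_2])
      finally show ?thesis .
    next
      case bad
      show ?thesis
      proof (cases "\<exists>y. B y v = 0 \<and> F y = 0 \<and> h y y \<noteq> 0")
        case True
        then obtain y where y: "B y v = 0" "F y = 0" "h y y \<noteq> 0" by blast
        have v: "F v = 0" "h v v = 0" using bad(1) V(3) by (auto simp: Z_def)
        have "y \<notin> vec.span {v}" using y(3) v by (auto simp: vec.span_singleton h_simps)
        \<comment> \<open>The count now runs along the line of \<open>v\<close> and
          \<open>y\<close>, which lies on the quadric but not on the variety.\<close>
        interpret line: singular_line t K F B v y
          by unfold_locales (use bad(2) \<open>y \<notin> vec.span {v}\<close> v y B_sym[of v y] in auto)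
        have "card (pts Z) \<le> 1 + (q\<^sup>2 + (t + 1) * q\<^sup>2)"
          using line.card_pts_Z_le_same_tangent bad(3) y(3) by blast
        also have "\<dots> < 2 * t ^ 5 + t ^ 2 + 1"
          by (rule bounds_less[OF t_ge_2])
        finally show ?thesis .
      next
        case False
        obtain e where e: "singular_line t F B v e" "vec.span {e, v} = V" using line bad by blast
        interpret line: singular_line t K F B v e by (rule e(1))
        have W: "line.W = V" using e(2) by (simp only: line.W_def)
        have False
          by (rule line.same_tangent_contradiction) (use V(3) bad False in \<open>auto simp only: W\<close>)
        then show ?thesis ..
      qed
    next
      case good
      obtain e where e: "singular_line t F B v0 e" "vec.span {e, v0} = V" using line v0 by blast
      interpret line: singular_line t K F B v0 e by (rule e(1))
      have W: "line.W = V" using e(2) by (simp only: line.W_def)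
      have "card {x. B x v = 0 \<and> h x v = 0} \<le> q ^ 3" if v: "v \<in> line.W" "v \<noteq> 0" for v
      proof -
        define T where "T = {x\<in>UNIV. B x v = 0}"
        have T: "vec.subspace T" unfolding T_def by (rule subspace_kernel[OF vec.subspace_UNIV functional_B])
        obtain x0 where x0: "B x0 v \<noteq> 0" using good(1) v W by blast
        have "card (UNIV :: ('a ^ 5) set) = q ^ 5" by (simp add: card_K)
        then have "q ^ 5 = q * card T"
          using card_kernel[OF vec.subspace_UNIV functional_B UNIV_I x0] unfolding T_def[symmetric] card_K by metis
        then have cT: "card T = q ^ 4" by (rule power_cancel(6)[OF q_pos, symmetric])
        have cp: "card (perp {v}) = q ^ 4"
          using card_subspace[OF subspace_perp, of "{v}"] dim_perp_1[OF v(2)] by (simp add: card_K)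
        \<comment> \<open>The two tangent hyperplanes have equal size, so inclusion would make them
          coincide.\<close>
        have "\<not> T \<subseteq> perp {v}"
        proof
          assume "T \<subseteq> perp {v}"
          then have "T = perp {v}" using cT cp by (intro card_subset_eq) auto
          then have "\<forall>x. B x v = 0 \<longleftrightarrow> h x v = 0" by (auto simp: T_def perp_def)
          then show False using good(2) v W by blast
        qed
        then obtain y where y: "y \<in> T" "h y v \<noteq> 0" by (auto simp: perp_def)
        have "q ^ 4 = q * card {x\<in>T. h x v = 0}"
          using card_kernel[OF T functional_h y] unfolding cT card_K .
        then have "q ^ 3 = card {x\<in>T. h x v = 0}" by (rule power_cancel[OF q_pos])
        then show ?thesis by (simp add: T_def)
      qed
      then have "card (pts Z) \<le> (q + 1) + (t * (q\<^sup>2 + q + 1) + (q - t) * (q + 1))"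
        using line.card_pts_Z_le_distinct_tangents V(3) W by blast
      also have "\<dots> < 2 * t ^ 5 + t ^ 2 + 1"
        by (rule bounds_less[OF t_ge_2])
      finally show ?thesis .
    qed
  qed
qed

section \<open>Quadrics containing a plane or a hyperplane\<close>

context square_field
begin

text \<open>The radical lies in \<open>perp W\<close>, which has dimension 2, so the plane cannot be
  totally isotropic.\<close>

lemma card_plane_section_le:
  fixes W :: "('a ^ 5) set"
  assumes W: "vec.subspace W" and dim: "vec.dim W = 3"
  shows "card (pts (iso W)) \<le> t ^ 3 + t ^ 2 + 1"
proof -
  have sub: "rad W \<subseteq> W" "rad W \<subseteq> perp W" by (auto simp: rad_def)
  have "vec.dim (perp W) = 2" using dim_perp[OF W] dim by simp
  then have "vec.dim (rad W) \<le> 2" using vec.dim_subset[OF sub(2)] by simp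
  then have "vec.dim (rad W) = 0 \<or> vec.dim (rad W) = 1 \<or> vec.dim (rad W) = 2" by linarith
  then show ?thesis using card_pts_iso_values(4-6)[OF W dim] by (elim disjE) simp_all
qed

end

context quadric
begin

text \<open>With \<open>h v a = 1\<close>, subtracting \<open>h x a *s v\<close> moves
  \<open>x\<close> into the hyperplane, where \<open>F\<close> vanishes; polarisation leaves only
  terms divisible by \<open>h x a\<close>. The case \<open>b = 0\<close> is that of \<open>F\<close>
  vanishing identically.\<close>

lemma hyperplane_factor:
  assumes V: "vec.subspace V" "vec.dim V = 4" and F0: "\<And>x. x \<in> V \<Longrightarrow> F x = 0"
  shows "\<exists>a b. a \<noteq> 0 \<and> (\<forall>x. F x = h x a * h x b)"
proof -
  have "vec.dim V = CARD(5) - 1" using V(2) by simp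
  then obtain a where a: "a \<noteq> 0" "V = perp {a}"
    by (rule hyperplane_subspace[OF V(1)])
  have "\<exists>v. h v a \<noteq> 0" using h_nondegenerate[of a] a(1) by blast
  then obtain v0 where v0: "h v0 a \<noteq> 0" by blast
  define v where "v = (1 / h v0 a) *s v0"
  have v: "h v a = 1" using v0 by (simp add: v_def h_simps)
  define M where "M = (\<lambda>x. h x a * F v + B (x - h x a *s v) v)"
  have "functional M"
    by (simp add: functional_def M_def B_simps h_simps algebra_simps)
  then obtain b where b: "\<And>x. M x = h x b" using functional_riesz by blast
  have "F x = h x a * M x" for x
  proof -
    have "F (x - h x a *s v) = 0" by (rule F0) (simp add: a perp_def h_simps v)
    moreover have "F ((x - h x a *s v) + h x a *s v) =
        F (x - h x a *s v) + (h x a)\<^sup>2 * F v + h x a * B (x - h x a *s v) v"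
      unfolding polar[of "x - h x a *s v"] homog B_scale_right ..
    ultimately show ?thesis by (simp add: M_def algebra_simps power2_eq_square)
  qed
  then show ?thesis using a(1) b by auto
qed

text \<open>A quadric \<open>\<alpha> A + \<beta> C = 0\<close> containing the plane \<open>\<alpha> = \<beta> = 0\<close> is swept out by the planes
  \<open>\<alpha> = c C, \<beta> = - c A\<close> together with \<open>A = C = 0\<close>.\<close>

lemma card_Z_le_plane:
  assumes V: "vec.subspace V" "vec.dim V = 3" and F0: "\<And>x. x \<in> V \<Longrightarrow> F x = 0"
    and no_hyp: "\<And>V. vec.subspace V \<Longrightarrow> vec.dim V = 4 \<Longrightarrow> \<exists>x\<in>V. F x \<noteq> 0"
  shows "card (pts Z) \<le> (q + 1) * (t ^ 3 + t ^ 2 + 1)"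
proof -
  have dimU: "vec.dim (UNIV :: ('a ^ 5) set) = 5" by (subst vec_dim_card) simp
  then have "V \<noteq> UNIV" using V(2) by auto
  then obtain v1 where v1: "v1 \<notin> V" by blast
  define V' where "V' = vec.span (insert v1 V)"
  have "vec.dim V' = 4"
    using v1 V(2) vec.dim_insert[of v1 V] vec.span_eq_iff[THEN iffD2, OF V(1)] by (simp add: V'_def)
  then have "V' \<noteq> UNIV" using dimU by auto
  then obtain v2 where v2: "v2 \<notin> V'" by blast
  obtain f where f: "functional f" "\<And>w. w \<in> V \<Longrightarrow> f w = 0" "f v1 = 1"
    using functional_extend[OF V(1) v1] by blast
  obtain \<beta> where \<beta>: "functional \<beta>" "\<And>w. w \<in> V' \<Longrightarrow> \<beta> w = 0" "\<beta> v2 = 1"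
    using functional_extend[OF _ v2] unfolding V'_def by blast
  \<comment> \<open>The correction makes the two functionals dual to \<open>v1\<close>,
    \<open>v2\<close>, with \<open>V\<close> as their common kernel.\<close>
  define \<alpha> where "\<alpha> = (\<lambda>x. f x - f v2 * \<beta> x)"
  have \<alpha>: "functional \<alpha>"
    using f(1) \<beta>(1) by (simp add: \<alpha>_def functional_def algebra_simps)
  have inV': "v1 \<in> V'" "\<And>x. x \<in> V \<Longrightarrow> x \<in> V'"
    by (auto simp: V'_def vec.span_base)
  have vals: "\<alpha> v1 = 1" "\<beta> v1 = 0" "\<alpha> v2 = 0" "\<And>x. x \<in> V \<Longrightarrow> \<alpha> x = 0 \<and> \<beta> x = 0"
    using f \<beta> inV' by (auto simp: \<alpha>_def)
  define H where "H = {x\<in>UNIV. \<beta> x = 0}"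
  have H: "vec.subspace H" unfolding H_def by (rule subspace_kernel[OF vec.subspace_UNIV \<beta>(1)])
  have "card (UNIV :: ('a ^ 5) set) = q ^ 5" by (simp add: card_K)
  moreover have nz: "\<beta> v2 \<noteq> 0" "\<alpha> v1 \<noteq> 0" "v1 \<in> H" using \<beta>(3) vals by (simp_all add: H_def)
  ultimately have "q ^ 5 = q * card H"
    using card_kernel[OF vec.subspace_UNIV \<beta>(1) UNIV_I nz(1)] unfolding H_def[symmetric] card_K by simp
  also have "card H = q * card {x\<in>H. \<alpha> x = 0}"
    using card_kernel[OF H \<alpha> nz(3,2)] unfolding card_K .
  finally have "q ^ 5 = q * (q * card {x\<in>H. \<alpha> x = 0})" .
  then have "q ^ 3 = card {x\<in>H. \<alpha> x = 0}" by (rule power_cancel(7)[OF q_pos])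
  then have "V = {x\<in>H. \<alpha> x = 0}"
    using card_subspace[OF V(1)] V(2) vals(4) by (intro card_subset_eq) (auto simp: H_def card_K)
  then have V_iff: "x \<in> V \<longleftrightarrow> \<alpha> x = 0 \<and> \<beta> x = 0" for x by (auto simp: H_def)
  \<comment> \<open>The coefficients come from expanding \<open>F\<close> at a vector of
    \<open>V\<close> plus the combination of \<open>v1\<close> and \<open>v2\<close>; the mixed term
    \<open>B v1 v2\<close> is assigned to \<open>A\<close>.\<close>
  define A where "A = (\<lambda>x. \<alpha> x * F v1 + \<beta> x * B v1 v2 + B (x - (\<alpha> x *s v1 + \<beta> x *s v2)) v1)"
  define C where "C = (\<lambda>x. \<beta> x * F v2 + B (x - (\<alpha> x *s v1 + \<beta> x *s v2)) v2)"
  have A: "functional A" and C: "functional C"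
    using \<alpha> \<beta>(1) by (simp_all add: functional_def A_def C_def B_simps algebra_simps)
  have F_AC: "F x = \<alpha> x * A x + \<beta> x * C x" for x
  proof -
    define y where "y = \<alpha> x *s v1 + \<beta> x *s v2"
    have "F (x - y) = 0"
    proof (rule F0)
      have "\<alpha> (x - y) = 0" "\<beta> (x - y) = 0"
        unfolding y_def functional_diff[OF \<alpha>] functional_diff[OF \<beta>(1)] functional_add[OF \<alpha>]
          functional_add[OF \<beta>(1)] functional_scale[OF \<alpha>] functional_scale[OF \<beta>(1)] vals(1-3) \<beta>(3)
        by simp_all
      then show "x - y \<in> V" by (simp only: V_iff)
    qed
    then have "F ((x - y) + y) = F y + B (x - y) y" unfolding polar[of "x - y" y] by simp
    also have "\<dots> = \<alpha> x * A x + \<beta> x * C x"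
      unfolding y_def F_pair A_def C_def by (simp add: B_add_right B_scale_right algebra_simps power2_eq_square)
    finally show ?thesis by simp
  qed
  define U where "U = (\<lambda>c. {x\<in>{x\<in>UNIV. \<alpha> x - c * C x = 0}. \<beta> x + c * A x = 0})"
  define U' where "U' = {x\<in>{x\<in>UNIV. A x = 0}. C x = 0}"
  have plane: "card (pts (iso {x\<in>{x\<in>UNIV. f x = 0}. g x = 0})) \<le> t ^ 3 + t ^ 2 + 1"
    if fg: "functional f" "functional g" and 0: "\<And>x. f x = 0 \<Longrightarrow> g x = 0 \<Longrightarrow> F x = 0" for f g
  proof -
    let ?L = "{x\<in>UNIV. f x = 0}" and ?P = "{x\<in>{x\<in>UNIV. f x = 0}. g x = 0}"
    have L: "vec.subspace ?L" by (rule subspace_kernel[OF vec.subspace_UNIV fg(1)])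
    have P: "vec.subspace ?P" by (rule subspace_kernel[OF L fg(2)])
    have "q ^ 5 = card (UNIV :: ('a ^ 5) set)" by (simp add: card_K)
    also have "\<dots> \<le> q * card ?L"
      using card_kernel_ge[OF vec.subspace_UNIV fg(1)] unfolding card_K .
    also have "\<dots> \<le> q * (q * card ?P)"
      using card_kernel_ge[OF L fg(2)] unfolding card_K by (rule mult_le_mono2)
    finally have "q ^ 3 \<le> card ?P" by (rule power_cancel[OF q_pos])
    then have "3 \<le> vec.dim ?P" using power_le_card_subspace_iff[OF P, of 3] unfolding card_K by simp
    \<comment> \<open>Two equations leave dimension at least 3, and dimension 4 would put a
      hyperplane on the quadric.\<close>
    moreover have "\<not> 4 \<le> vec.dim ?P"
    proof
      assume "4 \<le> vec.dim ?P"
      then obtain T where T: "vec.subspace T" "T \<subseteq> vec.span ?P" "vec.dim T = 4"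
        by (rule vec.choose_subspace_of_subspace)
      have "T \<subseteq> ?P" using T(2) P by (simp only: vec.span_eq_iff[THEN iffD2])
      then show False using no_hyp[OF T(1,3)] 0 by blast
    qed
    ultimately have "vec.dim ?P = 3" by linarith
    then show ?thesis by (rule card_plane_section_le[OF P])
  qed
  have fU: "functional (\<lambda>x. \<alpha> x - c * C x)" "functional (\<lambda>x. \<beta> x + c * A x)" for c
    using \<alpha> \<beta>(1) A C by (simp_all add: functional_def algebra_simps)
  have U: "card (pts (iso (U c))) \<le> t ^ 3 + t ^ 2 + 1" for c
    unfolding U_def
  proof (rule plane[OF fU])
    show "F x = 0" if 0: "\<alpha> x - c * C x = 0" "\<beta> x + c * A x = 0" for x
    proof -
      have "\<alpha> x = c * C x" "\<beta> x = - (c * A x)" using 0 by (simp_all add: eq_neg_iff_add_eq_0)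
      then show ?thesis by (simp add: F_AC)
    qed
  qed
  have cU': "card (pts (iso U')) \<le> t ^ 3 + t ^ 2 + 1"
    unfolding U'_def by (rule plane[OF A C]) (simp add: F_AC)
  have sub: "vec.subspace (U c)" "vec.subspace U'" for c
    unfolding U_def U'_def by (intro subspace_kernel vec.subspace_UNIV fU A C)+
  have "pts Z \<subseteq> (\<Union>c. pts (iso (U c))) \<union> pts (iso U')"
  proof
    fix P assume "P \<in> pts Z"
    then obtain x where x: "P = vec.span {x}" "x \<in> Z" "x \<noteq> 0" by (auto simp: pts_eq[OF cone_Z])
    have iso: "h x x = 0" and eq: "\<alpha> x * A x + \<beta> x * C x = 0" using x F_AC by (auto simp: Z_def)
    show "P \<in> (\<Union>c. pts (iso (U c))) \<union> pts (iso U')"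
    proof (cases "A x = 0 \<and> C x = 0")
      case True
      then have "x \<in> iso U'" using iso by (simp add: iso_def U'_def)
      then show ?thesis
        using span_in_pts_iff[OF cone_iso[OF cone_subspace[OF sub(2)]] x(3)] x(1) by blast
    next
      case False
      then obtain c where "\<alpha> x = c * C x" "\<beta> x = - c * A x"
        using ex_proportional[OF eq] by blast
      then have "x \<in> iso (U c)" using iso by (simp add: iso_def U_def)
      then show ?thesis
        using span_in_pts_iff[OF cone_iso[OF cone_subspace[OF sub(1)]] x(3)] x(1) by blast
    qed
  qed
  then have "card (pts Z) \<le> card ((\<Union>c. pts (iso (U c))) \<union> pts (iso U'))"
    by (intro card_mono) auto
  also have "\<dots> \<le> card (\<Union>c. pts (iso (U c))) + card (pts (iso U'))" by (rule card_Un_le)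
  finally have "card (pts Z) \<le> card (\<Union>c. pts (iso (U c))) + card (pts (iso U'))" .
  moreover have "card (\<Union>c. pts (iso (U c))) \<le> q * (t ^ 3 + t ^ 2 + 1)"
  proof -
    have "card (\<Union>c. pts (iso (U c))) \<le> (\<Sum>c\<in>UNIV. card (pts (iso (U c))))"
      by (rule card_UN_le) simp
    also have "\<dots> \<le> (\<Sum>c\<in>(UNIV :: 'a set). t ^ 3 + t ^ 2 + 1)" by (rule sum_mono) (rule U)
    also have "\<dots> = q * (t ^ 3 + t ^ 2 + 1)" by (simp only: sum_constant card_K of_nat_id)
    finally show ?thesis .
  qed
  ultimately show ?thesis using cU' unfolding add_mult_distrib mult_1 by linarith
qed

lemma factor_or_small:
  "(\<exists>a b. a \<noteq> 0 \<and> (\<forall>x. F x = h x a * h x b)) \<or> card (pts Z) < 2 * t ^ 5 + t ^ 2 + 1"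
proof (cases "\<exists>V. vec.subspace V \<and> vec.dim V = 4 \<and> (\<forall>x\<in>V. F x = 0)")
  case True
  then show ?thesis using hyperplane_factor by metis
next
  case no4: False
  show ?thesis
  proof (cases "\<exists>V. vec.subspace V \<and> vec.dim V = 3 \<and> (\<forall>x\<in>V. F x = 0)")
    case True
    then have "card (pts Z) \<le> (q + 1) * (t ^ 3 + t ^ 2 + 1)"
      using card_Z_le_plane no4 by metis
    also have "\<dots> < 2 * t ^ 5 + t ^ 2 + 1"
      by (rule bounds_less[OF t_ge_2])
    finally show ?thesis ..
  next
    case False
    have "\<exists>x\<in>V. F x \<noteq> 0" if "vec.subspace V" "vec.dim V = 3" for V
      using False that by metis
    then interpret planeless_quadric t K F B by unfold_locales
    show ?thesis using card_Z_less ..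
  qed
qed

end

section \<open>Forms of degree two and the code\<close>

lemma monomial_Suc:
  fixes g :: "'n::finite \<Rightarrow> nat"
  assumes "(\<Sum>i\<in>UNIV. g i) = Suc d"
  shows "\<exists>i g'. (\<Sum>i\<in>UNIV. g' i) = d \<and>
    (\<forall>x :: 'a::comm_monoid_mult ^ 'n. (\<Prod>l\<in>UNIV. (x $ l) ^ g l) = x $ i * (\<Prod>l\<in>UNIV. (x $ l) ^ g' l))"
proof -
  obtain i where i: "g i \<noteq> 0" using assms by (metis nat.distinct(1) sum.neutral)
  define g' where "g' = g(i := g i - 1)"
  have "(\<Sum>l\<in>UNIV. g l) = g i + (\<Sum>l\<in>UNIV - {i}. g l)"
    by (rule sum.remove) auto
  moreover have "(\<Sum>l\<in>UNIV. g' l) = g' i + (\<Sum>l\<in>UNIV - {i}. g' l)"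
    by (rule sum.remove) auto
  moreover have "(\<Sum>l\<in>UNIV - {i}. g' l) = (\<Sum>l\<in>UNIV - {i}. g l)"
    by (rule sum.cong) (auto simp: g'_def)
  ultimately have "(\<Sum>l\<in>UNIV. g' l) = d" using assms i by (simp add: g'_def)
  moreover have "(\<Prod>l\<in>UNIV. (x $ l) ^ g l) = x $ i * (\<Prod>l\<in>UNIV. (x $ l) ^ g' l)" for x :: "'a ^ 'n"
  proof -
    have "(\<Prod>l\<in>UNIV. (x $ l) ^ g l) = (x $ i) ^ g i * (\<Prod>l\<in>UNIV - {i}. (x $ l) ^ g l)"
      by (rule prod.remove) auto
    also have "(\<Prod>l\<in>UNIV - {i}. (x $ l) ^ g l) = (\<Prod>l\<in>UNIV - {i}. (x $ l) ^ g' l)"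
      by (rule prod.cong) (auto simp: g'_def)
    also have "(x $ i) ^ g i = x $ i * (x $ i) ^ g' i" using i by (cases "g i") (auto simp: g'_def)
    also have "\<dots> * (\<Prod>l\<in>UNIV - {i}. (x $ l) ^ g' l) = x $ i * (\<Prod>l\<in>UNIV. (x $ l) ^ g' l)"
      by (subst (2) prod.remove[of _ i]) (auto simp: mult.assoc)
    finally show ?thesis .
  qed
  ultimately show ?thesis by blast
qed

lemma monomial_2:
  fixes g :: "'n::finite \<Rightarrow> nat"
  assumes "(\<Sum>i\<in>UNIV. g i) = 2"
  shows "\<exists>i j. \<forall>x :: 'a::comm_monoid_mult ^ 'n. (\<Prod>l\<in>UNIV. (x $ l) ^ g l) = x $ i * x $ j"
proof -
  obtain i g' where 1: "(\<Sum>i\<in>UNIV. g' i) = Suc 0"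
      "\<And>x :: 'a ^ 'n. (\<Prod>l\<in>UNIV. (x $ l) ^ g l) = x $ i * (\<Prod>l\<in>UNIV. (x $ l) ^ g' l)"
    using monomial_Suc[of g 1] assms by (metis One_nat_def Suc_1)
  obtain j g'' where 2: "(\<Sum>i\<in>UNIV. g'' i) = 0"
      "\<And>x :: 'a ^ 'n. (\<Prod>l\<in>UNIV. (x $ l) ^ g' l) = x $ j * (\<Prod>l\<in>UNIV. (x $ l) ^ g'' l)"
    using monomial_Suc[OF 1(1)] by metis
  have "g'' l = 0" for l using 2(1) by simp
  then show ?thesis using 1(2) 2(2) by simp blast
qed

lemma eval_form_polar:
  fixes f :: "('n::finite, 'a::field) mpoly"
  assumes "f \<in> forms 2"
  shows "\<exists>B. (\<forall>x y. eval_form f (x + y) = eval_form f x + eval_form f y + B x y) \<and>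
    (\<forall>y. functional (\<lambda>x. B x y))"
proof -
  have "\<forall>m\<in>Poly_Mapping.keys f. \<exists>i j. \<forall>x :: 'a ^ 'n.
      (\<Prod>l\<in>UNIV. (x $ l) ^ Poly_Mapping.lookup m l) = x $ i * x $ j"
    using assms by (intro ballI monomial_2) (simp add: forms_def)
  then obtain i j where ij: "\<And>m x. m \<in> Poly_Mapping.keys f \<Longrightarrow>
      (\<Prod>l\<in>UNIV. ((x :: 'a ^ 'n) $ l) ^ Poly_Mapping.lookup m l) = x $ i m * x $ j m"
    by metis
  have eval: "eval_form f x = (\<Sum>m\<in>Poly_Mapping.keys f. Poly_Mapping.lookup f m * (x $ i m * x $ j m))" for x
    unfolding eval_form_def by (rule sum.cong) (simp_all add: ij)
  \<comment> \<open>The polar form of the monomial x_i x_j; for i = j it gives 2 x_i y_i, which is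
    correct in every characteristic.\<close>
  define B where "B = (\<lambda>x y. \<Sum>m\<in>Poly_Mapping.keys f.
    Poly_Mapping.lookup f m * (x $ i m * y $ j m + y $ i m * x $ j m))"
  have "eval_form f (x + y) = eval_form f x + eval_form f y + B x y" for x y
    unfolding eval B_def by (simp add: sum.distrib[symmetric] algebra_simps)
  moreover have "functional (\<lambda>x. B x y)" for y
    by (simp add: functional_def B_def sum.distrib[symmetric] sum_distrib_left algebra_simps)
  ultimately show ?thesis by blast
qed

lemma eval_form_superset:
  assumes "finite S" "Poly_Mapping.keys f \<subseteq> S"
  shows "eval_form f x = (\<Sum>m\<in>S. Poly_Mapping.lookup f m * (\<Prod>i\<in>UNIV. (x $ i) ^ Poly_Mapping.lookup m i))"
  unfolding eval_form_def using assms by (intro sum.mono_neutral_left) (auto simp: in_keys_iff)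

lemma eval_form_add: "eval_form (f + g) x = eval_form f x + eval_form g x"
proof -
  let ?S = "Poly_Mapping.keys f \<union> Poly_Mapping.keys g"
  have "Poly_Mapping.keys (f + g) \<subseteq> ?S" by (rule Poly_Mapping.keys_add)
  then show ?thesis
    by (simp add: eval_form_superset[of ?S] lookup_add distrib_right sum.distrib)
qed

lemma eval_form_sum: "eval_form (\<Sum>i\<in>A. f i) x = (\<Sum>i\<in>A. eval_form (f i) x)"
  by (induction A rule: infinite_finite_induct) (simp_all add: eval_form_add eval_form_def[of 0])

lemma forms_add: "f \<in> forms d \<Longrightarrow> g \<in> forms d \<Longrightarrow> f + g \<in> forms d"
  using Poly_Mapping.keys_add[of f g] by (auto simp: forms_def)

lemma forms_sum: "(\<And>i. i \<in> A \<Longrightarrow> f i \<in> forms d) \<Longrightarrow> (\<Sum>i\<in>A. f i) \<in> forms d"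
  by (induction A rule: infinite_finite_induct) (simp_all add: forms_add, simp_all add: forms_def)

lemma eval_form_product:
  fixes a b :: "'a::field ^ 'n"
  shows "\<exists>f\<in>forms 2. \<forall>x. eval_form f x = (\<Sum>i\<in>UNIV. a $ i * x $ i) * (\<Sum>i\<in>UNIV. b $ i * x $ i)"
proof -
  define m where "m = (\<lambda>i j :: 'n. Poly_Mapping.single i (1::nat) + Poly_Mapping.single j 1)"
  define f where "f = (\<Sum>i\<in>UNIV. \<Sum>j\<in>UNIV. Poly_Mapping.single (m i j) (a $ i * b $ j))"
  have "(\<Sum>l\<in>UNIV. Poly_Mapping.lookup (m i j) l) = 2" for i j
    by (simp add: m_def lookup_add sum.distrib lookup_single when_def)
  then have "Poly_Mapping.single (m i j) c \<in> forms 2" for i j and c :: 'a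
    by (simp add: forms_def)
  then have "f \<in> forms 2" unfolding f_def by (intro forms_sum)
  moreover have "eval_form f x = (\<Sum>i\<in>UNIV. a $ i * x $ i) * (\<Sum>i\<in>UNIV. b $ i * x $ i)" for x
  proof -
    have "(\<Prod>l\<in>UNIV. (x $ l) ^ Poly_Mapping.lookup (m i j) l) = x $ i * x $ j" for i j
      by (simp add: m_def lookup_add power_add prod.distrib lookup_single when_def if_distrib[of "power _"]
          cong: if_cong)
    then have "eval_form (Poly_Mapping.single (m i j) c) x = c * (x $ i * x $ j)" for i j c
      by (simp add: eval_form_def)
    then show ?thesis
      by (simp add: f_def eval_form_sum sum_product mult_ac)
  qed
  ultimately show ?thesis by blast
qed

lemma zero_locus_pts: "zero_locus f = pts {x. eval_form f x = 0}"
  by (auto simp: zero_locus_def pts_def)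

section \<open>From forms to weights\<close>

context square_field
begin

abbreviation "X \<equiv> (hermitian_variety t :: ('a ^ 5) set set)"

lemma finite_X: "finite X"
  by (rule finite_subset[of _ UNIV]) auto

lemma X_subset: "X \<subseteq> proj_points"
  by (auto simp: hermitian_variety_def)

lemma zero_locus_product:
  assumes "\<And>x. eval_form f x = h x a * h x b"
  shows "zero_locus f = pts (perp {a}) \<union> pts (perp {b})"
proof -
  have "{x. eval_form f x = 0} = perp {a} \<union> perp {b}" by (auto simp: assms perp_def)
  then show ?thesis by (simp add: zero_locus_pts pts_Un cone_subspace)
qed

text \<open>The alternative \<open>N = card X\<close> covers the forms that vanish on the variety,
  whose codeword is zero.\<close>

lemma section_cases:
  fixes f :: "(5, 'a) mpoly"
  assumes f: "f \<in> forms 2"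
  defines "N \<equiv> card (X \<inter> zero_locus f)"
  shows "N = card X \<or>
    N \<in> {2 * t ^ 5 + t ^ 3 + 2 * t ^ 2 + 1, 2 * t ^ 5 + t ^ 3 + t ^ 2 + 1, 2 * t ^ 5 + 2 * t ^ 2 + 1} \<or>
    N < 2 * t ^ 5 + t ^ 2 + 1 \<or>
    N = 2 * t ^ 5 + t ^ 2 + 1 \<and> (quadric_kind1 t (zero_locus f) \<or> quadric_kind2 t (zero_locus f))"
proof -
  obtain B where "\<forall>x y. eval_form f (x + y) = eval_form f x + eval_form f y + B x y"
      "\<forall>y. functional (\<lambda>x. B x y)"
    using eval_form_polar[OF f] by blast
  then interpret quadric t K "eval_form f" B
    by unfold_locales (simp_all add: eval_form_scale[OF f])
  have XZ: "X \<inter> zero_locus f = pts Z"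
    by (auto simp: hermitian_variety_eq zero_locus_pts Z_def iso_def simp flip: pts_Int
        intro!: arg_cong[where f = pts])
  consider (small) "card (pts Z) < 2 * t ^ 5 + t ^ 2 + 1"
    | (factor) a b where "a \<noteq> 0" "\<And>x. eval_form f x = h x a * h x b"
    using factor_or_small by metis
  then show ?thesis
  proof cases
    case small
    then show ?thesis by (simp add: N_def XZ)
  next
    case factor
    show ?thesis
    proof (cases "b = 0")
      case True
      then have "zero_locus f = proj_points" using factor by (simp add: zero_locus_pts pts_UNIV)
      then have "X \<inter> zero_locus f = X" using X_subset by auto
      then show ?thesis by (simp add: N_def)
    next
      case False
      have zl: "zero_locus f = pts (perp {a}) \<union> pts (perp {b})" by (rule zero_locus_product[OF factor(2)])
      \<comment> \<open>The factors are ordered as \<open>pair_cases\<close> expects, a lone tangent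
        hyperplane coming first.\<close>
      obtain a' b' where ab: "a' \<noteq> 0" "b' \<noteq> 0" "\<not> (h a' a' \<noteq> 0 \<and> h b' b' = 0)"
          "zero_locus f = pts (perp {a'}) \<union> pts (perp {b'})"
      proof (cases "h a a \<noteq> 0 \<and> h b b = 0")
        case True
        then show thesis using that[of b a] factor(1) \<open>b \<noteq> 0\<close> zl by (simp add: Un_commute)
      next
        case False
        then show thesis using that[of a b] factor(1) \<open>b \<noteq> 0\<close> zl by simp
      qed
      have "quadric_kind1 t (zero_locus f) \<or> quadric_kind2 t (zero_locus f)"
        if "h a' a' = 0" "h a' b' = 0" "vec.independent {a', b'}" "a' \<noteq> b'"
        unfolding ab(4) using kind1I[of a' b'] kind2I[of a' b'] that ab by blast
      then show ?thesis using pair_cases[OF ab(1-3)] unfolding N_def ab(4) by blast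
    qed
  qed
qed

lemma pair_section_form:
  fixes a b :: "'a ^ 5"
  assumes ind: "a \<notin> vec.span {b}" "b \<noteq> 0"
  shows "\<exists>f\<in>forms 2. card (X \<inter> zero_locus f) + (let r = vec.dim (rad (vec.span {a, b})) in
      if r = 0 then t ^ 3 + 1 else if r = 1 then t ^ 3 + t ^ 2 + 1 else t ^ 2 + 1) =
    (if h a a = 0 then t ^ 5 + t ^ 2 + 1 else t ^ 5 + t ^ 3 + t ^ 2 + 1) +
    (if h b b = 0 then t ^ 5 + t ^ 2 + 1 else t ^ 5 + t ^ 3 + t ^ 2 + 1)"
proof -
  have hd: "h x c = (\<Sum>i\<in>UNIV. (\<chi> i. c $ i ^ t) $ i * x $ i)" for x c :: "'a ^ 5"
    by (simp add: h_def mult.commute)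
  obtain f where f: "f \<in> forms 2" "\<forall>x. eval_form f x = h x a * h x b"
    using eval_form_product[of "\<chi> i. a $ i ^ t" "\<chi> i. b $ i ^ t"] unfolding hd by blast
  have zl: "zero_locus f = pts (perp {a}) \<union> pts (perp {b})"
    by (rule zero_locus_product) (simp add: f(2))
  have "a \<noteq> 0" "a \<noteq> b" using ind(1) vec.span_zero vec.span_base by blast+
  have "vec.independent {a, b}"
    using ind by (simp add: vec.independent_insert del: vec.span_singleton)
  from card_pair[of a b, unfolded card_codim2_section[OF this \<open>a \<noteq> b\<close>]
      card_hyperplane_section[OF \<open>a \<noteq> 0\<close>] card_hyperplane_section[OF ind(2)], folded zl]
  show ?thesis by (rule bexI[OF _ f(1)])
qed

text \<open>The values come from two nonisotropic poles whose span has radical of dimension 0 or 1,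
  and from an isotropic and a nonisotropic pole, again with radical of dimension 0 or 1.\<close>

lemma weights_attained:
  assumes "M \<in> {2 * t ^ 5 + t ^ 3 + 2 * t ^ 2 + 1, 2 * t ^ 5 + t ^ 3 + t ^ 2 + 1,
    2 * t ^ 5 + 2 * t ^ 2 + 1, 2 * t ^ 5 + t ^ 2 + 1}"
  shows "\<exists>f\<in>forms 2. card (X \<inter> zero_locus f) = M"
proof -
  define u0 u1 u2 :: "'a ^ 5" where "u0 = axis 0 1" and "u1 = axis 1 1" and "u2 = axis 2 1"
  have hu: "h u0 u0 = 1" "h u1 u1 = 1" "h u2 u2 = 1" "h u0 u1 = 0" "h u0 u2 = 0" "h u1 u0 = 0"
      "h u1 u2 = 0" "h u2 u0 = 0" "h u2 u1 = 0"
    unfolding u0_def u1_def u2_def h_axis_right by (simp_all add: axis_def)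
  obtain \<epsilon> :: 'a where eps: "\<epsilon> * \<epsilon> ^ t = - 1"
    by (rule norm_surj[of "- 1"]) (auto simp: minus_power_t[of 1, simplified])
  \<comment> \<open>\<open>c\<close> is isotropic because the norm of \<epsilon> is -1.\<close>
  define c where "c = u1 + \<epsilon> *s u2"
  have hc: "h c c = 0" "h c u0 = 0" "h u0 c = 0" "h c u1 = 1" "h u1 c = 1"
    using eps by (simp_all add: c_def h_simps hu mult.commute[of _ \<epsilon>])
  have nz: "u0 \<noteq> 0" "u1 \<noteq> 0" "c \<noteq> 0" using hu(1,2) hc(4) by auto
  have notin: "x \<notin> vec.span {y}" if "h y z = 0" "h x z \<noteq> 0" for x y z :: "'a ^ 5"
    using that by (auto simp: vec.span_singleton h_simps)
  have in_rad: "v \<in> rad (vec.span {a, b}) \<longleftrightarrow> v \<in> vec.span {a, b} \<and> h v a = 0 \<and> h v b = 0"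
    for v a b :: "'a ^ 5" by (simp add: rad_span perp_def)
  have ind: "vec.independent {a, b} \<and> a \<noteq> b" if "a \<notin> vec.span {b}" "b \<noteq> 0" for a b :: "'a ^ 5"
    using that vec.span_base[of b "{b}"] by (auto simp: vec.independent_insert simp del: vec.span_singleton)
  consider "M = 2 * t ^ 5 + t ^ 3 + 2 * t ^ 2 + 1" | "M = 2 * t ^ 5 + t ^ 3 + t ^ 2 + 1"
    | "M = 2 * t ^ 5 + 2 * t ^ 2 + 1" | "M = 2 * t ^ 5 + t ^ 2 + 1"
    using assms by blast
  then show ?thesis
  proof cases
    case 1
    have ni: "u0 \<notin> vec.span {u1}" by (rule notin[of _ u0]) (simp_all add: hu)
    have "rad (vec.span {u0, u1}) \<subseteq> {0}"
      by (auto simp: in_rad span_pair_iff h_simps hu)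
    then have "vec.dim (rad (vec.span {u0, u1})) = 0" by simp
    moreover obtain f where f: "f \<in> forms 2" and eq: "card (X \<inter> zero_locus f) + (let r = vec.dim (rad (vec.span {u0, u1})) in
        if r = 0 then t ^ 3 + 1 else if r = 1 then t ^ 3 + t ^ 2 + 1 else t ^ 2 + 1) =
      (if h u0 u0 = 0 then t ^ 5 + t ^ 2 + 1 else t ^ 5 + t ^ 3 + t ^ 2 + 1) +
      (if h u1 u1 = 0 then t ^ 5 + t ^ 2 + 1 else t ^ 5 + t ^ 3 + t ^ 2 + 1)"
      using pair_section_form[OF ni nz(2)] by blast
    ultimately have "card (X \<inter> zero_locus f) = M" using hu 1 by (simp add: Let_def)
    then show ?thesis using f by blast
  next
    case 2
    \<comment> \<open>Both poles have length 1, and their difference \<open>c\<close> is isotropic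
      and orthogonal to both.\<close>
    let ?b = "u0 + c"
    have ni: "u0 \<notin> vec.span {?b}"
    proof
      assume "u0 \<in> vec.span {?b}"
      then obtain k where k: "u0 = k *s ?b" by (auto simp: vec.span_singleton)
      then have "h u0 u1 = h (k *s ?b) u1" by simp
      then have "k = 0" by (simp add: h_simps hu hc)
      then show False using k nz(1) by simp
    qed
    have hb: "h ?b ?b = 1" "h u0 ?b = 1" "h c ?b = 0" by (simp_all add: h_simps hu hc)
    then have "?b \<noteq> 0" by auto
    note i = conjunct1[OF ind[OF ni this]] conjunct2[OF ind[OF ni this]]
    have "c = (- 1) *s u0 + 1 *s ?b" by (simp add: vec_eq_iff)
    then have "c \<in> vec.span {u0, ?b}" unfolding span_pair_iff by blast
    then have "c \<in> rad (vec.span {u0, ?b})"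
      using hb hc by (simp add: in_rad)
    then have "vec.dim (rad (vec.span {u0, ?b})) > 0" using dim_rad_pair(4)[OF i] nz(3) by blast
    moreover have "vec.dim (rad (vec.span {u0, ?b})) \<noteq> 2" using dim_rad_pair(2)[OF i] hu by simp
    ultimately have "vec.dim (rad (vec.span {u0, ?b})) = 1" using dim_rad_pair(1)[OF i] by linarith
    moreover obtain f where f: "f \<in> forms 2" and eq: "card (X \<inter> zero_locus f) + (let r = vec.dim (rad (vec.span {u0, ?b})) in
        if r = 0 then t ^ 3 + 1 else if r = 1 then t ^ 3 + t ^ 2 + 1 else t ^ 2 + 1) =
      (if h u0 u0 = 0 then t ^ 5 + t ^ 2 + 1 else t ^ 5 + t ^ 3 + t ^ 2 + 1) +
      (if h ?b ?b = 0 then t ^ 5 + t ^ 2 + 1 else t ^ 5 + t ^ 3 + t ^ 2 + 1)"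
      using pair_section_form[OF ni \<open>?b \<noteq> 0\<close>] by blast
    ultimately have "card (X \<inter> zero_locus f) = M" using hu hb 2 by (simp add: Let_def)
    then show ?thesis using f by blast
  next
    case 3
    have ni: "u1 \<notin> vec.span {c}"
    proof
      assume "u1 \<in> vec.span {c}"
      then obtain k where "u1 = k *s c" by (auto simp: vec.span_singleton)
      then have "h u1 u1 = h (k *s c) (k *s c)" by simp
      then show False by (simp add: h_simps hu hc)
    qed
    have "c \<notin> vec.span {u1}"
    proof
      assume "c \<in> vec.span {u1}"
      then obtain k where k: "c = k *s u1" by (auto simp: vec.span_singleton)
      then have "h c c = k * k ^ t" by (simp add: h_simps hu)
      then have "k = 0" using hc by auto
      then show False using k nz by simp
    qed
    note i = conjunct1[OF ind[OF this nz(2)]] conjunct2[OF ind[OF this nz(2)]]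
    have "vec.dim (rad (vec.span {c, u1})) = 0"
      using dim_rad_pair(3)[OF i] hc by simp
    moreover obtain f where f: "f \<in> forms 2" and eq: "card (X \<inter> zero_locus f) + (let r = vec.dim (rad (vec.span {c, u1})) in
        if r = 0 then t ^ 3 + 1 else if r = 1 then t ^ 3 + t ^ 2 + 1 else t ^ 2 + 1) =
      (if h c c = 0 then t ^ 5 + t ^ 2 + 1 else t ^ 5 + t ^ 3 + t ^ 2 + 1) +
      (if h u1 u1 = 0 then t ^ 5 + t ^ 2 + 1 else t ^ 5 + t ^ 3 + t ^ 2 + 1)"
      using pair_section_form[OF \<open>c \<notin> vec.span {u1}\<close> nz(2)] by blast
    ultimately have "card (X \<inter> zero_locus f) = M" using hu hc 3 by (simp add: Let_def)
    then show ?thesis using f by blast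
  next
    case 4
    have ni: "c \<notin> vec.span {u0}" by (rule notin[of _ u1]) (simp_all add: hu hc)
    note i = conjunct1[OF ind[OF ni nz(1)]] conjunct2[OF ind[OF ni nz(1)]]
    have "c \<in> rad (vec.span {c, u0})" by (simp add: in_rad hc vec.span_base)
    then have "vec.dim (rad (vec.span {c, u0})) > 0" using dim_rad_pair(4)[OF i] nz(3) by blast
    moreover have "vec.dim (rad (vec.span {c, u0})) \<noteq> 2" using dim_rad_pair(2)[OF i] hu by simp
    ultimately have "vec.dim (rad (vec.span {c, u0})) = 1" using dim_rad_pair(1)[OF i] by linarith
    moreover obtain f where f: "f \<in> forms 2" and eq: "card (X \<inter> zero_locus f) + (let r = vec.dim (rad (vec.span {c, u0})) in
        if r = 0 then t ^ 3 + 1 else if r = 1 then t ^ 3 + t ^ 2 + 1 else t ^ 2 + 1) =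
      (if h c c = 0 then t ^ 5 + t ^ 2 + 1 else t ^ 5 + t ^ 3 + t ^ 2 + 1) +
      (if h u0 u0 = 0 then t ^ 5 + t ^ 2 + 1 else t ^ 5 + t ^ 3 + t ^ 2 + 1)"
      using pair_section_form[OF ni nz(1)] by blast
    ultimately have "card (X \<inter> zero_locus f) = M" using hu hc 4 by (simp add: Let_def)
    then show ?thesis using f by blast
  qed
qed

lemma weight_eq:
  fixes f :: "(5, 'a) mpoly"
  assumes "f \<in> forms 2"
  shows "hamming_weight X (codeword X f) = card X - card (X \<inter> zero_locus f)"
    and "card (X \<inter> zero_locus f) \<le> card X"
  using hamming_weight_codeword[OF assms X_subset finite_X] card_mono[OF finite_X] by auto

lemma power_t_less: "2 * t ^ 5 + t ^ 3 + 2 * t ^ 2 + 1 < t ^ 7 + t ^ 5 + t ^ 2 + 1" "t ^ 5 < t ^ 7" "t ^ 2 < t ^ 3"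
proof -
  have "4 \<le> t * t" using mult_le_mono[OF t_ge_2 t_ge_2] by simp
  then have "4 * t ^ 5 \<le> (t * t) * t ^ 5" by (rule mult_le_mono1)
  also have "\<dots> = t ^ 7" by (simp add: eval_nat_numeral)
  finally have "4 * t ^ 5 \<le> t ^ 7" .
  moreover have "t ^ 3 < t ^ 5" "t ^ 2 < t ^ 5" using t_ge_2 by (auto intro: power_strict_increasing)
  ultimately show "2 * t ^ 5 + t ^ 3 + 2 * t ^ 2 + 1 < t ^ 7 + t ^ 5 + t ^ 2 + 1" by linarith
  show "t ^ 5 < t ^ 7" "t ^ 2 < t ^ 3" using t_ge_2 by (auto intro: power_strict_increasing)
qed

lemma weight_eq_iff:
  fixes f :: "(5, 'a) mpoly"
  assumes f: "f \<in> forms 2"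
  shows "hamming_weight X (codeword X f) = t ^ 7 - t ^ 5 \<longleftrightarrow> card (X \<inter> zero_locus f) = 2 * t ^ 5 + t ^ 2 + 1"
    and "hamming_weight X (codeword X f) < t ^ 7 - t ^ 5 \<longleftrightarrow> card (X \<inter> zero_locus f) > 2 * t ^ 5 + t ^ 2 + 1"
  using weight_eq[OF f] power_t_less unfolding card_X by linarith+

lemma fourth_weight_iff:
  fixes f :: "(5, 'a) mpoly"
  assumes f: "f \<in> forms 2"
  shows "hamming_weight X (codeword X f) = t ^ 7 - t ^ 5 \<longleftrightarrow>
    quadric_kind1 t (zero_locus f) \<or> quadric_kind2 t (zero_locus f)"
proof
  assume "hamming_weight X (codeword X f) = t ^ 7 - t ^ 5"
  then have "card (X \<inter> zero_locus f) = 2 * t ^ 5 + t ^ 2 + 1" by (simp only: weight_eq_iff[OF f])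
  then show "quadric_kind1 t (zero_locus f) \<or> quadric_kind2 t (zero_locus f)"
    using section_cases[OF f] power_t_less card_X t_ge_2 by auto
next
  assume "quadric_kind1 t (zero_locus f) \<or> quadric_kind2 t (zero_locus f)"
  then show "hamming_weight X (codeword X f) = t ^ 7 - t ^ 5"
    using card_kind1 card_kind2 weight_eq_iff(1)[OF f] by blast
qed

lemma is_fourth_weight: "is_ith_weight X (code2 X) 4 (t ^ 7 - t ^ 5)"
proof -
  define W where "W = hamming_weight X ` (code2 X - {\<lambda>_. 0})"
  let ?K = "2 * t ^ 5 + t ^ 2 + 1"
  let ?S = "{2 * t ^ 5 + t ^ 3 + 2 * t ^ 2 + 1, 2 * t ^ 5 + t ^ 3 + t ^ 2 + 1, 2 * t ^ 5 + 2 * t ^ 2 + 1}"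
  have in_W: "card X - M \<in> W" if M: "M \<in> insert ?K ?S" for M
  proof -
    have "\<exists>f\<in>forms 2. card (X \<inter> zero_locus f) = M"
      by (rule weights_attained) (use M in blast)
    then obtain f :: "(5, 'a) mpoly" where f: "f \<in> forms 2" "card (X \<inter> zero_locus f) = M"
      by blast
    have "M < card X" using M power_t_less unfolding card_X by auto
    then have "hamming_weight X (codeword X f) \<noteq> 0" using weight_eq(1)[OF f(1)] f(2) by simp
    then have "codeword X f \<noteq> (\<lambda>_. 0)" by (auto simp: hamming_weight_def)
    then have "codeword X f \<in> code2 X - {\<lambda>_. 0}" using f(1) by (simp add: code2_def)
    then show ?thesis unfolding W_def using weight_eq(1)[OF f(1)] f(2) by (metis image_eqI)
  qed
  have "{u \<in> W. u < t ^ 7 - t ^ 5} = (\<lambda>M. card X - M) ` ?S"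
  proof (intro equalityI subsetI)
    fix u assume u: "u \<in> {u \<in> W. u < t ^ 7 - t ^ 5}"
    then obtain f :: "(5, 'a) mpoly" where f: "f \<in> forms 2" "codeword X f \<noteq> (\<lambda>_. 0)"
        "u = hamming_weight X (codeword X f)"
      by (auto simp: W_def code2_def)
    \<comment> \<open>Words are 0 off \<open>X\<close>, so a nonzero word has a nonzero entry on
      \<open>X\<close>; this rules out the alternative \<open>N = card X\<close>.\<close>
    have "{P \<in> X. codeword X f P \<noteq> 0} \<noteq> {}" using f(2) by (auto simp: codeword_def fun_eq_iff split: if_splits)
    then have "u \<noteq> 0" using finite_X by (simp add: f(3) hamming_weight_def)
    then have "card (X \<inter> zero_locus f) \<noteq> card X" using weight_eq(1)[OF f(1)] f(3) by simp
    moreover have "card (X \<inter> zero_locus f) > ?K" using u f(3) weight_eq_iff(2)[OF f(1)] by simp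
    ultimately have "card (X \<inter> zero_locus f) \<in> ?S" using section_cases[OF f(1)] by auto
    then show "u \<in> (\<lambda>M. card X - M) ` ?S" unfolding f(3) weight_eq(1)[OF f(1)] by (rule imageI)
  next
    fix u assume "u \<in> (\<lambda>M. card X - M) ` ?S"
    then obtain M where M: "M \<in> ?S" "u = card X - M" by blast
    have "0 < t ^ 2" using t_ge_2 by simp
    then have "?K < M" "M < card X" using M(1) power_t_less unfolding card_X by auto
    then have "u < t ^ 7 - t ^ 5" using M(2) power_t_less unfolding card_X by linarith
    then show "u \<in> {u \<in> W. u < t ^ 7 - t ^ 5}" using in_W[of M] M by simp
  qed
  moreover have "card ((\<lambda>M. card X - M) ` ?S) = card ?S"
  proof (intro card_image inj_onI)
    \<comment> \<open>Below \<open>card X\<close> the truncated subtraction is injective, so the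
      three weights are distinct.\<close>
    have lt: "M < card X" if "M \<in> ?S" for M using that power_t_less unfolding card_X by auto
    show "M = M'" if "M \<in> ?S" "M' \<in> ?S" "card X - M = card X - M'" for M M'
      using lt[OF that(1)] lt[OF that(2)] that(3) by linarith
  qed
  moreover have "card ?S = 3"
    using power_t_less t_ge_2 by (simp add: card_insert_if)
  moreover have "t ^ 7 - t ^ 5 \<in> W"
  proof -
    have "card X - ?K = t ^ 7 - t ^ 5" unfolding card_X by simp
    then show ?thesis using in_W[of ?K] by simp
  qed
  ultimately show ?thesis by (simp add: is_ith_weight_def W_def Let_def)
qed

end

theorem theorem6p7:
  fixes t :: nat and X :: "('a::{field,finite} ^ 5) set set"
  assumes "primepow t"
    and "CARD('a) = t\<^sup>2"
    and "X = hermitian_variety t"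
  shows "is_ith_weight X (code2 X) 4 (t ^ 7 - t ^ 5) \<and>
         (\<forall>f \<in> forms 2. hamming_weight X (codeword X f) = t ^ 7 - t ^ 5 \<longleftrightarrow>
            quadric_kind1 t (zero_locus f) \<or> quadric_kind2 t (zero_locus f))"
proof -
  interpret square_field t "TYPE('a)" by unfold_locales (use assms in auto)
  show ?thesis using is_fourth_weight fourth_weight_iff assms(3) by blast
qed

end
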